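(* Let $\mathcal D=\{(\mu,\nu)\in\mathcal P^2:\mu\preceq_C\nu\}$. The map $\mathrm{Curt}:(\mu,\nu)\in\mathcal D\mapsto\pi_{\mathrm{lc}}$, which sends a pair to its left-curtain coupling, is continuous from $\mathcal D$ (with the product of the topologies induced by $W$) to the set $\Pi_M$ of martingale transport plans equipped with the topology $\mathcal T_1(\mathbb R^2)$. More precisely, for all $(\mu,\nu),(\mu',\nu')\in\mathcal D$, $$Z\big(\mathrm{Curt}(\mu,\nu),\mathrm{Curt}(\mu',\nu')\big)\le W(\mu,\mu')+2\,W(\nu,\nu').$$
   Context: $\mathcal M$ is the set of finite positive Borel measures on $\mathbb R$ with finite first moment, $\mathcal P\subset\mathcal M$ the probability measures. For $\mu,\nu\in\mathcal M$ of the same mass, $W(\mu,\nu)=\sup_f|\int f\,d\mu-\int f\,d\nu|$ over $1$-Lipschitz $f:\mathbb R\to\mathbb R$. $\mathcal P(\mathbb R^2)$ is the set of Borel probability measures on $\mathbb R^2$ with finite first moment and $\mathcal T_1(\mathbb R^2)$ is the topology on it induced by the Kantorovich ($1$-Wasserstein) metric $W^{\mathbb R^2}$, for a norm on $\mathbb R^2$. Orders on $\mathcal M$: $\mu\preceq_C\nu$ means $\int\varphi\,d\mu\le\int\varphi\,d\nu$ for every convex $\varphi$ growing at most linearly at $\pm\infty$; $\mu\preceq_{C,+}\nu$ is the same with $\varphi$ convex and non-negative; $\preceq_+$ is the setwise order of measures (on $\mathbb R$ or $\mathbb R^2$). If $\mu\preceq_{C,+}\nu$, the shadow $S^\nu(\mu)$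 is the unique $\eta$ such that $\mu\preceq_C\eta\preceq_+\nu$ and $\eta\preceq_C\eta'$ for all $\eta'$ with $\mu\preceq_C\eta'\preceq_+\nu$. For $\mu,\nu\in\mathcal P$, $\Pi_M(\mu,\nu)$ is the set of $\pi=\mathrm{Law}(X,Y)$ with marginals $\mu,\nu$ and $\mathbb E(Y|X)=X$; $\Pi_M$ is the set of all such martingale transport plans. If $\mu\preceq_C\nu$, the left-curtain coupling $\pi_{\mathrm{lc}}=\mathrm{Curt}(\mu,\nu)$ is the unique $\pi\in\Pi_M(\mu,\nu)$ such that for every $x\in\mathbb R$ the restriction of $\pi$ to $]-\infty,x]\times\mathbb R$ has first marginal $\mu|_{]-\infty,x]}$ and second marginal $S^\nu(\mu|_{]-\infty,x]})$ (existence and uniqueness are known). Definition of $Z$: for $\pi,\pi'\in\mathcal P(\mathbb R^2)$, $$Z(\pi,\pi')=\inf\ \sup_{s\in[0,1]}\max\big(W(\mu^s,\mu'^s),W(\nu^s,\nu'^s)\big),$$ where the infimum is over all families $(\pi^s)_{s\in[0,1]}$ admissible for $\pi$ and $(\pi'^s)_{s\in[0,1]}$ admissible for $\pi'$, and $\mu^s,\nu^s$ (resp. $\mu'^s,\nu'^s$) are the first and second marginals of $\pi^s$ (resp. $\pi'^s$). A family $(\pi^s)_{s\in[0,1]}$ of positive measures on $\mathbb R^2$ is admissible for $\pi$ if: (1) $\pi^s(\mathbb R^2)=s$ for all $s$; (2) for all $s$ there is $x\in[-\infty,+\infty]$ with $\pi|_{]-\infty,x[\times\mathbb R}\preceq_+\pi^s\preceq_+\pi|_{]-\infty,x]\times\mathbb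 R}$; (3) $s\le t$ implies $\pi^s\preceq_+\pi^t$. *)

theory Defs
  imports "HOL-Probability.Probability" "HOL-Library.Landau_Symbols"
begin

section \<open>Measures with finite first moment\<close>

text \<open>Used at the types \<^typ>\<open>real\<close> and \<^typ>\<open>real \<times> real\<close>. In the plane, the finite first moment
  does not depend on the norm.\<close>

definition finite_moment_measures ::
    "'a::{banach, second_countable_topology} measure set" where
  "finite_moment_measures =
     {M. sets M = sets borel \<and> finite_measure M \<and> integrable M (\<lambda>x. x)}"

definition finite_moment_probs ::
    "'a::{banach, second_countable_topology} measure set" where
  "finite_moment_probs = {M \<in> finite_moment_measures. prob_space M}"

definition restrict_meas :: "'a measure \<Rightarrow> 'a set \<Rightarrow> 'a measure" where
  "restrict_meas M A = density M (indicator A)"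

abbreviation fst_marginal :: "(real \<times> real) measure \<Rightarrow> real measure" where
  "fst_marginal \<pi> \<equiv> distr \<pi> borel fst"

abbreviation snd_marginal :: "(real \<times> real) measure \<Rightarrow> real measure" where
  "snd_marginal \<pi> \<equiv> distr \<pi> borel snd"

section \<open>Kantorovich distances\<close>

text \<open>The suprema are taken in \<^typ>\<open>ennreal\<close>, so that they are genuine suprema for all arguments.\<close>

definition W :: "real measure \<Rightarrow> real measure \<Rightarrow> ennreal" where
  "W \<mu> \<nu> = (SUP f\<in>{f :: real \<Rightarrow> real. 1-lipschitz_on UNIV f}.
     ennreal \<bar>(\<integral>x. f x \<partial>\<mu>) - (\<integral>x. f x \<partial>\<nu>)\<bar>)"

definition is_norm :: "(real \<times> real \<Rightarrow> real) \<Rightarrow> bool" where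
  "is_norm N \<longleftrightarrow>
     (\<forall>x. N x = 0 \<longleftrightarrow> x = 0) \<and>
     (\<forall>a x. N (a *\<^sub>R x) = \<bar>a\<bar> * N x) \<and>
     (\<forall>x y. N (x + y) \<le> N x + N y)"

definition W_plane ::
    "(real \<times> real \<Rightarrow> real) \<Rightarrow> (real \<times> real) measure \<Rightarrow> (real \<times> real) measure \<Rightarrow> ennreal" where
  "W_plane N \<pi> \<pi>' = (SUP f\<in>{f :: real \<times> real \<Rightarrow> real. \<forall>x y. \<bar>f x - f y\<bar> \<le> N (x - y)}.
     ennreal \<bar>(\<integral>x. f x \<partial>\<pi>) - (\<integral>x. f x \<partial>\<pi>')\<bar>)"

text \<open>On probability measures with finite first moment both distances are finite, so \<^const>\<open>enn2real\<close>
  only changes the type there.\<close>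

definition T1_line :: "real measure topology" where
  "T1_line = Metric_space.mtopology finite_moment_probs (\<lambda>\<mu> \<nu>. enn2real (W \<mu> \<nu>))"

definition T1_plane :: "(real \<times> real \<Rightarrow> real) \<Rightarrow> (real \<times> real) measure topology" where
  "T1_plane N = Metric_space.mtopology finite_moment_probs (\<lambda>\<pi> \<pi>'. enn2real (W_plane N \<pi> \<pi>'))"

section \<open>Orders on measures\<close>

definition convex_le :: "real measure \<Rightarrow> real measure \<Rightarrow> bool" where
  "convex_le \<mu> \<nu> \<longleftrightarrow>
     \<mu> \<in> finite_moment_measures \<and> \<nu> \<in> finite_moment_measures \<and>
     (\<forall>\<phi> :: real \<Rightarrow> real.
        convex_on UNIV \<phi> \<and> \<phi> \<in> O[at_top](\<lambda>x. x) \<and> \<phi> \<in> O[at_bot](\<lambda>x. x) \<longrightarrow>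
        (\<integral>x. \<phi> x \<partial>\<mu>) \<le> (\<integral>x. \<phi> x \<partial>\<nu>))"

text \<open>The library order on measures is lexicographic (first space, then \<open>\<sigma>\<close>-algebra, then values),
  hence this explicit setwise order.\<close>

definition setwise_le :: "'a measure \<Rightarrow> 'a measure \<Rightarrow> bool" where
  "setwise_le M N \<longleftrightarrow> sets M = sets N \<and> (\<forall>A\<in>sets N. emeasure M A \<le> emeasure N A)"

section \<open>Shadows and the left-curtain coupling\<close>

definition is_shadow :: "real measure \<Rightarrow> real measure \<Rightarrow> real measure \<Rightarrow> bool" where
  "is_shadow \<nu> \<mu> \<eta> \<longleftrightarrow>
     convex_le \<mu> \<eta> \<and> setwise_le \<eta> \<nu> \<and>
     (\<forall>\<eta>'. convex_le \<mu> \<eta>' \<and> setwise_le \<eta>' \<nu> \<longrightarrow> convex_le \<eta> \<eta>')"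

text \<open>\<open>shadow \<nu> \<mu>\<close> is \<open>S\<^sup>\<nu>(\<mu>)\<close>. It is well defined if the integral of every non-negative convex
  function of at most linear growth is at most as large under \<open>\<mu>\<close> as under \<open>\<nu>\<close>; in particular if \<open>\<mu>\<close> is
  setwise below some measure that is \<open>\<le>\<close> \<open>\<nu>\<close> in convex order.\<close>

definition shadow :: "real measure \<Rightarrow> real measure \<Rightarrow> real measure" where
  "shadow \<nu> \<mu> = (THE \<eta>. is_shadow \<nu> \<mu> \<eta>)"

text \<open>A plan is represented by the law \<open>\<pi>\<close> of \<open>(X, Y)\<close> on the plane, with \<open>X\<close> and \<open>Y\<close> the coordinate
  projections; the \<open>\<sigma>\<close>-algebra generated by \<open>X\<close> is the pullback of the Borel sets under \<^const>\<open>fst\<close>.\<close>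

definition martingale_plans :: "real measure \<Rightarrow> real measure \<Rightarrow> (real \<times> real) measure set" where
  "martingale_plans \<mu> \<nu> =
     {\<pi>. sets \<pi> = sets borel \<and> prob_space \<pi> \<and>
         fst_marginal \<pi> = \<mu> \<and> snd_marginal \<pi> = \<nu> \<and>
         (AE z in \<pi>. real_cond_exp \<pi> (vimage_algebra (space \<pi>) fst borel) snd z = fst z)}"

definition all_martingale_plans :: "(real \<times> real) measure set" where
  "all_martingale_plans =
     (\<Union>\<mu>\<in>finite_moment_probs. \<Union>\<nu>\<in>finite_moment_probs. martingale_plans \<mu> \<nu>)"

definition is_left_curtain ::
    "real measure \<Rightarrow> real measure \<Rightarrow> (real \<times> real) measure \<Rightarrow> bool" where
  "is_left_curtain \<mu> \<nu> \<pi> \<longleftrightarrow>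
     \<pi> \<in> martingale_plans \<mu> \<nu> \<and>
     (\<forall>x. fst_marginal (restrict_meas \<pi> ({..x} \<times> UNIV)) = restrict_meas \<mu> {..x} \<and>
          snd_marginal (restrict_meas \<pi> ({..x} \<times> UNIV)) = shadow \<nu> (restrict_meas \<mu> {..x}))"

definition Curt :: "real measure \<Rightarrow> real measure \<Rightarrow> (real \<times> real) measure" where
  "Curt \<mu> \<nu> = (THE \<pi>. is_left_curtain \<mu> \<nu> \<pi>)"

definition convex_ordered_pairs :: "(real measure \<times> real measure) set" where
  "convex_ordered_pairs =
     {(\<mu>, \<nu>). \<mu> \<in> finite_moment_probs \<and> \<nu> \<in> finite_moment_probs \<and> convex_le \<mu> \<nu>}"

section \<open>The quantity Z\<close>

text \<open>Only the values of the family at parameters in \<open>[0, 1]\<close> matter. The threshold \<open>x\<close> is extended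
  real.\<close>

definition admissible ::
    "(real \<times> real) measure \<Rightarrow> (real \<Rightarrow> (real \<times> real) measure) \<Rightarrow> bool" where
  "admissible \<pi> p \<longleftrightarrow>
     (\<forall>s\<in>{0..1}. sets (p s) = sets borel \<and> emeasure (p s) UNIV = ennreal s) \<and>
     (\<forall>s\<in>{0..1}. \<exists>x::ereal.
        setwise_le (restrict_meas \<pi> ({u. ereal u < x} \<times> UNIV)) (p s) \<and>
        setwise_le (p s) (restrict_meas \<pi> ({u. ereal u \<le> x} \<times> UNIV))) \<and>
     (\<forall>s\<in>{0..1}. \<forall>t\<in>{0..1}. s \<le> t \<longrightarrow> setwise_le (p s) (p t))"

definition Z :: "(real \<times> real) measure \<Rightarrow> (real \<times> real) measure \<Rightarrow> ennreal" where
  "Z \<pi> \<pi>' = (INF (p, p')\<in>{(p, p'). admissible \<pi> p \<and> admissible \<pi>' p'}.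
     SUP s\<in>{0..1}. max (W (fst_marginal (p s)) (fst_marginal (p' s)))
                        (W (snd_marginal (p s)) (snd_marginal (p' s))))"

end

(* Proof idea: represent mu by its potential P(x) = integral of max 0 (x - y). Then W(mu, nu) is the
   total variation of the difference of the potentials, and the shadow of mu in nu has the potential
   P_nu - co(P_nu - P_mu), where co is the convex envelope. Taking convex envelopes does not increase the
   total variation of a difference, whence W(S^nu(mu), S^nu'(mu')) <= W(mu, mu') + 2 W(nu, nu').
   Applied to the parts mu^s of mu carried by the lowest s-fraction of its mass, this bounds Z. The
   increasing family S^nu(mu^s) is the second marginal of a joint law theta of a uniform variable T and
   Y, restricted to T <= s, and the left-curtain coupling is the law of (Q(T), Y), Q being the quantile
   function of mu. Continuity follows by rounding Q(T) to finitely many values. *)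

theory Submission
  imports Defs
begin

section \<open>Convex envelopes\<close>

text \<open>Neither shadows nor left-curtain couplings come with a formula: both are defined through
  \<open>THE\<close>, so existence and uniqueness are part of the work. Potentials make the two
  orders comparable: convex order is pointwise order of potentials with equal mass and mean, and
  setwise order means that the difference of the potentials is convex. The least \<eta> above \<mu>
  inside \<nu> thus corresponds to the largest convex function below P_\<nu> - P_\<mu>, and the
  point is that P_\<nu> minus this envelope is convex again. The bound on \<open>Z\<close> compares
  only marginals of slices, whereas the topology of the plane tests functions of both coordinates. A
  function that is a step function of the first coordinate is integrated using second marginals of
  slices alone, which is why rounding links the two. The number of steps depends on the tail of
  \<mu>, so the argument gives continuity but no uniform modulus.\<close>

lemma convex_line_outside:
  fixes k :: "real \<Rightarrow> real"
  assumes k: "convex_on UNIV k" and "a < b" and y: "y \<le> a \<or> b \<le> y"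
  shows "k a + (k b - k a) / (b - a) * (y - a) \<le> k y"
proof -
  have K: "convex_on {s..t} k" for s t
    using convex_on_subset[OF k] by auto
  show ?thesis
    using y
  proof
    assume "b \<le> y"
    with convex_onD_Icc'[OF K, of b a y] \<open>a < b\<close>
    have "(k b - k a) * (y - a) \<le> (k y - k a) * (b - a)"
      by (simp add: field_simps)
    then show ?thesis
      using \<open>a < b\<close> by (simp add: field_simps)
  next
    assume "y \<le> a"
    with convex_onD_Icc''[OF K, of a y b] \<open>a < b\<close>
    have "(k a - k b) * (b - y) \<le> (k y - k b) * (b - a)"
      by (simp add: field_simps)
    then show ?thesis
      using \<open>a < b\<close> by (simp add: field_simps)
  qed
qed

lemma convex_line_inside:
  fixes k :: "real \<Rightarrow> real"
  assumes k: "convex_on UNIV k" and "a < b" and y: "a \<le> y" "y \<le> b"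
  shows "k y \<le> k a + (k b - k a) / (b - a) * (y - a)"
  using convex_onD_Icc'[of a b k y] convex_on_subset[OF k, of "{a..b}"] y by auto

lemma convex_on_affine: "convex A \<Longrightarrow> convex_on A (\<lambda>x::real. a * x + b)"
  unfolding convex_on_def
proof (intro conjI ballI allI impI)
  fix x y u v :: real assume "u + v = 1"
  then have "b = u * b + v * b"
    by (metis distrib_right mult_1)
  then show "a * (u *\<^sub>R x + v *\<^sub>R y) + b \<le> u * (a * x + b) + v * (a * y + b)"
    by (simp add: algebra_simps)
qed

lemma convex_on_max_fun:
  fixes f g :: "real \<Rightarrow> real"
  assumes "convex_on A f" "convex_on A g"
  shows "convex_on A (\<lambda>x. max (f x) (g x))"
  unfolding convex_on_def
proof (intro conjI ballI allI impI)
  show "convex A"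
    using assms by (simp add: convex_on_def)
  fix x y u v :: real
  assume *: "x \<in> A" "y \<in> A" "0 \<le> u" "0 \<le> v" "u + v = 1"
  have "u * f x + v * f y \<le> u * max (f x) (g x) + v * max (f y) (g y)"
       "u * g x + v * g y \<le> u * max (f x) (g x) + v * max (f y) (g y)"
    using * by (auto intro!: add_mono mult_left_mono)
  moreover have "f (u *\<^sub>R x + v *\<^sub>R y) \<le> u * f x + v * f y"
                "g (u *\<^sub>R x + v *\<^sub>R y) \<le> u * g x + v * g y"
    using assms * by (auto simp: convex_on_def)
  ultimately show "max (f (u *\<^sub>R x + v *\<^sub>R y)) (g (u *\<^sub>R x + v *\<^sub>R y))
      \<le> u * max (f x) (g x) + v * max (f y) (g y)"
    by linarith
qed

lemma isCont_convex:
  fixes k :: "real \<Rightarrow> real"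
  shows "convex_on UNIV k \<Longrightarrow> isCont k x"
  using convex_on_continuous[of UNIV k] by (simp add: continuous_on_eq_continuous_at)

text \<open>Away from the good set \<open>S\<close>, the leftmost maximiser cannot be an interior point: by local
  convexity the function would be constant around it.\<close>

lemma maximiser_of_locally_convex:
  fixes E :: "real \<Rightarrow> real"
  assumes "u \<le> w" and cont: "continuous_on {u..w} E"
    and conv: "\<And>x. u < x \<Longrightarrow> x < w \<Longrightarrow> x \<notin> S \<Longrightarrow> \<exists>e>0. convex_on {x - e..x + e} E"
  shows "\<exists>z\<in>{u..w}. (\<forall>y\<in>{u..w}. E y \<le> E z) \<and> (z = u \<or> z = w \<or> z \<in> S)"
proof -
  obtain z0 where z0: "z0 \<in> {u..w}" "\<forall>y\<in>{u..w}. E y \<le> E z0"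
    using continuous_attains_sup[of "{u..w}" E] assms by auto
  define M where "M = {x \<in> {u..w}. E x = E z0}"
  have "closed M"
    unfolding M_def using continuous_closed_preimage_constant[OF cont, of "E z0"] by simp
  moreover have "M \<noteq> {}" "bdd_below M"
    using z0 by (auto simp: M_def intro!: bdd_belowI[of _ u])
  ultimately have zM: "Inf M \<in> M"
    by (intro closed_contains_Inf)
  define z where "z = Inf M"
  have zmin: "z \<le> x" if "x \<in> M" for x
    unfolding z_def using \<open>bdd_below M\<close> that by (rule cInf_lower[rotated])
  have z: "z \<in> {u..w}" "E z = E z0"
    using zM by (auto simp: M_def z_def)
  have "z = u \<or> z = w \<or> z \<in> S"
  proof (rule ccontr)
    assume "\<not> ?thesis"
    then have zi: "u < z" "z < w" "z \<notin> S"
      using z by auto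
    from conv[OF this] obtain e where e: "e > 0" "convex_on {z - e..z + e} E"
      by blast
    define d where "d = min e (min (z - u) (w - z))"
    have d: "0 < d" "d \<le> e" "u \<le> z - d" "z + d \<le> w"
      using e zi by (auto simp: d_def)
    have "E ((1/2) *\<^sub>R (z - d) + (1/2) *\<^sub>R (z + d)) \<le> 1/2 * E (z - d) + 1/2 * E (z + d)"
      using convex_onD[OF e(2), of "1/2" "z - d" "z + d"] d by simp
    then have "E z \<le> 1/2 * E (z - d) + 1/2 * E (z + d)"
      by (simp add: field_simps)
    moreover have "E (z - d) \<le> E z" "E (z + d) \<le> E z"
      using z0(2) d zi by (auto simp: z)
    ultimately have "E (z - d) = E z0"
      using z by linarith
    then have "z - d \<in> M"
      using d zi by (auto simp: M_def)
    from zmin[OF this] d show False by simp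
  qed
  with z z0 show ?thesis by (intro bexI[of _ z]) auto
qed

definition convex_envelope :: "(real \<Rightarrow> real) \<Rightarrow> real \<Rightarrow> real" where
  "convex_envelope f x = Sup {c x | c. convex_on UNIV c \<and> (\<forall>y. c y \<le> f y)}"

text \<open>Without a convex minorant the supremum above is taken over the empty set, hence the
  assumption.\<close>

locale convex_minorant =
  fixes f c :: "real \<Rightarrow> real"
  assumes minorant: "convex_on UNIV c" "\<And>x. c x \<le> f x"
begin

lemma envelope_le: "convex_envelope f x \<le> f x"
  unfolding convex_envelope_def using minorant by (intro cSup_least) auto

lemma envelope_ge:
  assumes "convex_on UNIV g" "\<And>x. g x \<le> f x"
  shows "g x \<le> convex_envelope f x"
  unfolding convex_envelope_def using assms by (intro cSup_upper bdd_aboveI[of _ "f x"]) auto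

lemma envelope_convex: "convex_on UNIV (convex_envelope f)"
  unfolding convex_on_def
proof (intro conjI ballI allI impI)
  fix x y u v :: real assume *: "0 \<le> u" "0 \<le> v" "u + v = 1"
  show "convex_envelope f (u *\<^sub>R x + v *\<^sub>R y) \<le> u * convex_envelope f x + v * convex_envelope f y"
    unfolding convex_envelope_def[of f "u *\<^sub>R x + v *\<^sub>R y"]
  proof (rule cSup_least)
    fix r assume "r \<in> {g (u *\<^sub>R x + v *\<^sub>R y) | g. convex_on UNIV g \<and> (\<forall>y. g y \<le> f y)}"
    then obtain g where g: "r = g (u *\<^sub>R x + v *\<^sub>R y)" "convex_on UNIV g" "\<And>y. g y \<le> f y"
      by auto
    have "r \<le> u * g x + v * g y"
      using g * by (auto simp: convex_on_def)
    also have "\<dots> \<le> u * convex_envelope f x + v * convex_envelope f y"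
      using envelope_ge[OF g(2,3)] * by (intro add_mono mult_left_mono) auto
    finally show "r \<le> u * convex_envelope f x + v * convex_envelope f y" .
  qed (use minorant in auto)
qed auto

text \<open>Where \<open>f\<close> stays above its envelope, the chord of the envelope over a short
  interval still lies below \<open>f\<close>. The maximum of envelope and chord is then a convex
  minorant, so the envelope cannot sag below its chord.\<close>

lemma envelope_affine:
  assumes cont: "isCont f x" and less: "convex_envelope f x < f x"
  shows "\<exists>e>0. \<exists>a b. \<forall>y\<in>{x - e..x + e}. convex_envelope f y = a * y + b"
proof -
  let ?k = "convex_envelope f"
  \<comment> \<open>Half of the gap: near \<open>x\<close> the envelope, hence its chord, stays
    below \<open>?k x + d\<close>, and \<open>f\<close> stays above \<open>f x - d\<close>, which is
    the same number.\<close>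
  define d where "d = (f x - ?k x) / 2"
  have d: "d > 0"
    using less by (simp add: d_def)
  have "isCont ?k x"
    using isCont_convex[OF envelope_convex] .
  then obtain e1 where e1: "e1 > 0" "\<And>y. \<bar>y - x\<bar> < e1 \<Longrightarrow> \<bar>?k y - ?k x\<bar> < d"
    using d unfolding continuous_at_real_range by (metis real_norm_def)
  obtain e2 where e2: "e2 > 0" "\<And>y. \<bar>y - x\<bar> < e2 \<Longrightarrow> \<bar>f y - f x\<bar> < d"
    using d cont unfolding continuous_at_real_range by (metis real_norm_def)
  define e where "e = min e1 e2 / 2"
  have e: "e > 0" "e < e1" "e < e2"
    using e1(1) e2(1) by (auto simp: e_def)
  define A where "A = (?k (x + e) - ?k (x - e)) / (2 * e)"
  define l where "l = (\<lambda>y. A * y + (?k (x - e) - A * (x - e)))"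
  have A: "(?k (x + e) - ?k (x - e)) / ((x + e) - (x - e)) = A"
    by (simp add: A_def)
  have l: "l y = ?k (x - e) + A * (y - (x - e))" for y
    by (simp add: l_def algebra_simps)
  have out: "l y \<le> ?k y" if "y \<le> x - e \<or> x + e \<le> y" for y
    using convex_line_outside[OF envelope_convex, of "x - e" "x + e" y, unfolded A] e that by (simp add: l)
  have ins: "?k y \<le> l y" if "x - e \<le> y" "y \<le> x + e" for y
    using convex_line_inside[OF envelope_convex, of "x - e" "x + e" y, unfolded A] e that by (simp add: l)
  have lr: "l (x + e) = ?k (x + e)" "l (x - e) = ?k (x - e)"
    using e by (auto simp: l A_def)
  have near: "l y \<le> f y" if "x - e \<le> y" "y \<le> x + e" for y
  proof -
    have "l y \<le> max (l (x - e)) (l (x + e))"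
    proof (cases "A \<ge> 0")
      case True
      then show ?thesis using that by (auto simp: l_def intro!: max.coboundedI2 mult_left_mono)
    next
      case False
      then show ?thesis using that by (auto simp: l_def intro!: max.coboundedI1 mult_left_mono_neg)
    qed
    moreover have "l (x - e) < ?k x + d" "l (x + e) < ?k x + d"
      using e1(2)[of "x - e"] e1(2)[of "x + e"] e lr by auto
    moreover have "\<bar>y - x\<bar> < e2"
      using e that by linarith
    from e2(2)[OF this] have "f y > f x - d"
      by linarith
    moreover have "f x - d = ?k x + d"
      by (simp add: d_def field_simps)
    ultimately show ?thesis
      by (simp add: max_def split: if_splits)
  qed
  have "max (?k y) (l y) \<le> f y" for y
    using near[of y] out[of y] envelope_le[of y] by fastforce
  moreover have "convex_on UNIV (\<lambda>y. max (?k y) (l y))"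
    unfolding l_def by (intro convex_on_max_fun envelope_convex convex_on_affine) auto
  ultimately have "max (?k y) (l y) \<le> ?k y" for y
    using envelope_ge[of "\<lambda>y. max (?k y) (l y)"] by blast
  then have "?k y = l y" if "y \<in> {x - e..x + e}" for y
    using ins[of y] that by (auto intro: antisym)
  then show ?thesis
    unfolding l_def using e(1) by blast
qed

text \<open>An affine function can be subtracted from a convex one. Contact points apart, this makes
  differences with an envelope locally convex, which is what
  \<open>maximiser_of_locally_convex\<close> asks for.\<close>

lemma locally_convex_minus_envelope:
  assumes "isCont f x" and "convex_envelope f x < f x" and p: "convex_on UNIV p"
  shows "\<exists>e>0. convex_on {x - e..x + e} (\<lambda>y. p y - convex_envelope f y)"
proof -
  obtain e a b where e: "e > 0" "\<forall>y\<in>{x - e..x + e}. convex_envelope f y = a * y + b"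
    using envelope_affine[OF assms(1,2)] by blast
  have "convex_on {x - e..x + e} (\<lambda>y. p y + (- a * y + - b))"
    using convex_on_subset[OF p, of "{x - e..x + e}"] by (intro convex_on_add convex_on_affine) auto
  also have "(\<lambda>y. p y + (- a * y + - b)) = (\<lambda>y. p y - (a * y + b))"
    by auto
  finally have "convex_on {x - e..x + e} (\<lambda>y. p y - (a * y + b))" .
  moreover have *: "u * (x - e) + v * (x - e) \<le> u * y + v * z" "u * y + v * z \<le> u * (x + e) + v * (x + e)"
    if "x - e \<le> y" "y \<le> x + e" "x - e \<le> z" "z \<le> x + e" "0 \<le> u" "0 \<le> v" for u v y z
    using that by (auto intro!: add_mono mult_left_mono)
  have "u * y + v * z \<in> {x - e..x + e}"
    if "y \<in> {x - e..x + e}" "z \<in> {x - e..x + e}" "0 \<le> u" "0 \<le> v" "u + v = 1" for u v y z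
    using *[of y z u v] that by (simp flip: distrib_right)
  ultimately have "convex_on {x - e..x + e} (\<lambda>y. p y - convex_envelope f y)"
    using e(2) unfolding convex_on_def by simp
  with e(1) show ?thesis by blast
qed

end

lemma envelope_eqI:
  assumes "convex_on UNIV k" "\<And>x. k x \<le> f x"
    and "\<And>g x. convex_on UNIV g \<Longrightarrow> (\<And>y. g y \<le> f y) \<Longrightarrow> g x \<le> k x"
  shows "convex_envelope f = k"
proof
  fix x
  interpret convex_minorant f k using assms by unfold_locales
  show "convex_envelope f x = k x"
    using assms(3)[OF envelope_convex envelope_le] envelope_ge[OF assms(1,2)] by (rule antisym)
qed

text \<open>If the difference exceeded one of its chords, it would do so at a contact point \<open>z\<close> of \<open>p - q\<close>
  and its envelope, where the difference agrees with \<open>q\<close>; but it dominates \<open>q\<close> everywhere.\<close>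

lemma convex_minus_envelope:
  fixes p q :: "real \<Rightarrow> real"
  assumes p: "convex_on UNIV p" and q: "convex_on UNIV q"
    and c: "convex_minorant (\<lambda>x. p x - q x) c"
  shows "convex_on UNIV (\<lambda>x. p x - convex_envelope (\<lambda>x. p x - q x) x)"
proof -
  interpret convex_minorant "\<lambda>x. p x - q x" c by fact
  define k where "k = convex_envelope (\<lambda>x. p x - q x)"
  define g where "g = (\<lambda>x. p x - k x)"
  have kc: "convex_on UNIV k"
    unfolding k_def by (rule envelope_convex)
  have gq: "q x \<le> g x" for x
    using envelope_le[of x] by (simp add: g_def k_def)
  have conts: "isCont p x" "isCont q x" "isCont k x" for x
    using isCont_convex p q kc by auto
  have "g ((1 - t) *\<^sub>R a + t *\<^sub>R b) \<le> (1 - t) * g a + t * g b"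
    if t: "0 < t" "t < 1" and "a < b" for a b t
  proof -
    \<comment> \<open>The chord of \<open>g\<close> over \<open>a\<close> and \<open>b\<close>;
      convexity of \<open>g\<close> says that the excess \<open>E\<close> over it is not positive
      between them.\<close>
    define l where "l = (\<lambda>x. g a + (g b - g a) / (b - a) * (x - a))"
    define E where "E = (\<lambda>x. g x - l x)"
    have E0: "E a = 0" "E b = 0"
      using \<open>a < b\<close> by (auto simp: E_def l_def)
    have "continuous_on {a..b} E"
      unfolding E_def g_def l_def using conts
      by (intro continuous_intros) (auto intro!: continuous_at_imp_continuous_on)
    moreover have "\<exists>e>0. convex_on {x - e..x + e} E" if "x \<notin> {x. k x = p x - q x}" for x
    proof -
      have "convex_envelope (\<lambda>x. p x - q x) x < p x - q x"
        using that envelope_le[of x] by (auto simp: k_def)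
      then obtain e where e: "e > 0" "convex_on {x - e..x + e} g"
        using locally_convex_minus_envelope[of x p] conts p by (auto simp: g_def k_def)
      have "convex_on {x - e..x + e} (\<lambda>x. g x +
          (- ((g b - g a) / (b - a)) * x + ((g b - g a) / (b - a) * a - g a)))"
        using e by (intro convex_on_add convex_on_affine) auto
      also have "(\<lambda>x. g x + (- m * x + (m * a - g a))) = (\<lambda>x. g x - (g a + m * (x - a)))" for m
        by (auto simp: algebra_simps)
      also have "(\<lambda>x. g x - (g a + (g b - g a) / (b - a) * (x - a))) = E"
        by (simp add: E_def l_def)
      finally show ?thesis using e by blast
    qed
    ultimately have "\<exists>z\<in>{a..b}. (\<forall>y\<in>{a..b}. E y \<le> E z) \<and> (z = a \<or> z = b \<or> z \<in> {x. k x = p x - q x})"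
      using \<open>a < b\<close> by (intro maximiser_of_locally_convex) simp_all
    then obtain z where z: "z \<in> {a..b}" "\<forall>y\<in>{a..b}. E y \<le> E z"
        "z = a \<or> z = b \<or> k z = p z - q z"
      by blast
    have "E z \<le> 0"
    proof (cases "z = a \<or> z = b")
      case False
      then have "g z = q z"
        using z(3) by (auto simp: g_def)
      also have "q z \<le> q a + (q b - q a) / (b - a) * (z - a)"
        using convex_line_inside[OF q \<open>a < b\<close>, of z] z by auto
      also have "\<dots> = q a * ((b - z) / (b - a)) + q b * ((z - a) / (b - a))"
        using \<open>a < b\<close> by (simp add: divide_simps) (simp add: algebra_simps)
      also have "\<dots> \<le> g a * ((b - z) / (b - a)) + g b * ((z - a) / (b - a))"
        using gq z \<open>a < b\<close> by (intro add_mono mult_right_mono) auto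
      also have "\<dots> = l z"
        using \<open>a < b\<close> by (simp add: l_def divide_simps) (simp add: algebra_simps)
      finally show ?thesis by (simp add: E_def)
    qed (use E0 in auto)
    moreover define x where "x = (1 - t) *\<^sub>R a + t *\<^sub>R b"
    have "a + t * (b - a) \<le> a + 1 * (b - a)" "a \<le> a + t * (b - a)"
      using t \<open>a < b\<close> by (intro add_mono mult_right_mono, auto)
    then have "x \<in> {a..b}"
      by (simp add: x_def algebra_simps)
    ultimately have "E x \<le> 0"
      using z by force
    moreover have "x - a = t * (b - a)"
      by (simp add: x_def algebra_simps)
    then have "l x = g a + (g b - g a) * t"
      using \<open>a < b\<close> by (simp add: l_def)
    ultimately have "g x \<le> g a + (g b - g a) * t"
      by (simp add: E_def)
    then show ?thesis
      by (simp add: x_def algebra_simps)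
  qed
  then have "convex_on UNIV g"
    by (intro convex_on_linorderI) auto
  then show ?thesis by (simp add: g_def k_def)
qed

section \<open>Total variation\<close>

text \<open>Only weakly increasing, so that a chain can be extended by end points that may coincide
  with its own, as in \<open>variation_envelope_diff_le\<close>.\<close>

definition chain :: "(nat \<Rightarrow> real) \<Rightarrow> nat \<Rightarrow> bool" where
  "chain x n \<longleftrightarrow> (\<forall>i<n. x i \<le> x (Suc i))"

text \<open>Along one chain only. The total variation is the supremum over all chains; a bound on it
  is stated as a bound for every chain, which avoids real suprema that might be infinite.\<close>

definition variation :: "(real \<Rightarrow> real) \<Rightarrow> (nat \<Rightarrow> real) \<Rightarrow> nat \<Rightarrow> real" where
  "variation D x n = (\<Sum>i<n. \<bar>D (x (Suc i)) - D (x i)\<bar>)"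

lemma sum_lessThan_add: "(\<Sum>i<p + r. f i) = (\<Sum>i<p. f i) + (\<Sum>i<r. f (p + i))"
  for f :: "nat \<Rightarrow> real"
  by (induction r) auto

text \<open>If \<open>D\<close> does not turn at \<open>x i\<close>, the two adjacent increments
  have compatible signs and merge without loss. This forces a shortest counterexample in
  \<open>variation_le_of_extrema\<close> to alternate.\<close>

lemma chain_remove:
  assumes "chain x n" "0 < i" "i < n"
  defines "y \<equiv> (\<lambda>j. if j < i then x j else x (Suc j))"
  shows "chain y (n - 1)" "y 0 = x 0" "y (n - 1) = x n"
    and "(D (x i) - D (x (i - 1))) * (D (x (Suc i)) - D (x i)) \<ge> 0 \<Longrightarrow>
      variation D y (n - 1) = variation D x n"
proof -
  obtain p where p: "i = Suc p"
    using assms by (cases i) auto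
  obtain r where r: "n = Suc (Suc p) + r"
    using assms(3) p by (metis Suc_leI less_eqE)
  have xm: "x j \<le> x (Suc j)" if "j < n" for j
    using assms that by (auto simp: chain_def)
  have "y j \<le> y (Suc j)" if "j < n - 1" for j
  proof -
    consider "Suc j < i" | "Suc j = i" | "j \<ge> i" by linarith
    then show ?thesis
    proof cases
      case 2
      then show ?thesis using xm[of j] xm[of "Suc j"] that assms(3) by (auto simp: y_def)
    qed (use xm[of j] xm[of "Suc j"] that in \<open>auto simp: y_def\<close>)
  qed
  then show "chain y (n - 1)" by (auto simp: chain_def)
  show "y 0 = x 0" "y (n - 1) = x n"
    using assms by (auto simp: y_def)
  assume *: "(D (x i) - D (x (i - 1))) * (D (x (Suc i)) - D (x i)) \<ge> 0"
  define T where "T = (\<lambda>x j. \<bar>D (x (Suc j)) - D (x j)\<bar>)"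
  have "variation D x n = (\<Sum>j<p. T x j) + (T x p + T x (Suc p)) + (\<Sum>j<r. T x (Suc (Suc p) + j))"
    unfolding variation_def r sum_lessThan_add T_def by simp
  also have "(\<Sum>j<p. T x j) = (\<Sum>j<p. T y j)"
    by (intro sum.cong) (auto simp: T_def y_def p)
  also have "(\<Sum>j<r. T x (Suc (Suc p) + j)) = (\<Sum>j<r. T y (Suc p + j))"
    by (intro sum.cong) (auto simp: T_def y_def p)
  also have "T x p + T x (Suc p) = T y p"
    using * by (auto simp: T_def y_def p zero_le_mult_iff)
  also have "(\<Sum>j<p. T y j) + T y p + (\<Sum>j<r. T y (Suc p + j)) = (\<Sum>j<Suc p + r. T y j)"
    unfolding sum_lessThan_add by simp
  also have "Suc p + r = n - 1"
    using r by simp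
  finally show "variation D y (n - 1) = variation D x n"
    by (simp add: variation_def T_def)
qed

text \<open>A shortest chain along which \<open>D\<close> varies by more than allowed is strictly alternating, so its
  interior points can be replaced one by one by nearby extremal points of \<open>D\<close>. At these the signs of
  \<open>D - h\<close> are such that the increments of \<open>h\<close> are at least those of \<open>D\<close>.\<close>

lemma variation_le_of_extrema:
  fixes D h :: "real \<Rightarrow> real"
  assumes maxi: "\<And>u w. u \<le> w \<Longrightarrow>
      \<exists>z\<in>{u..w}. (\<forall>y\<in>{u..w}. D y \<le> D z) \<and> (z = u \<or> z = w \<or> D z \<le> h z)"
    and mini: "\<And>u w. u \<le> w \<Longrightarrow>
      \<exists>z\<in>{u..w}. (\<forall>y\<in>{u..w}. D z \<le> D y) \<and> (z = u \<or> z = w \<or> h z \<le> D z)"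
    and ends: "\<bar>D a - h a\<bar> \<le> e" "\<bar>D b - h b\<bar> \<le> e"
    and C: "\<And>x n. chain x n \<Longrightarrow> variation h x n \<le> C"
    and x: "chain x n" "x 0 = a" "x n = b"
  shows "variation D x n \<le> C + 2 * e"
proof (rule ccontr)
  define bad where "bad = (\<lambda>x n. chain x n \<and> x 0 = a \<and> x n = b \<and> variation D x n > C + 2 * e)"
  assume "\<not> ?thesis"
  then have ex: "\<exists>n x. bad x n"
    using x by (auto simp: bad_def not_le)
  define m where "m = (LEAST n. \<exists>x. bad x n)"
  have m: "\<exists>x. bad x m"
    unfolding m_def using ex by (rule LeastI_ex)
  have least: "\<not> bad y n" if "n < m" for n y
    using that not_less_Least unfolding m_def by blast
  have alt: "(D (x i) - D (x (i - 1))) * (D (x (Suc i)) - D (x i)) < 0"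
    if "bad x m" "0 < i" "i < m" for x i
  proof (rule ccontr)
    assume "\<not> ?thesis"
    then have "bad (\<lambda>j. if j < i then x j else x (Suc j)) (m - 1)"
      using chain_remove(1-3)[of x m i] chain_remove(4)[of x m i D] that by (auto simp: bad_def)
    with least[of "m - 1"] that show False by auto
  qed
  \<comment> \<open>At a point reached from below \<open>D\<close> is at most \<open>h\<close>, at
    one reached from above it is at least \<open>h\<close>. The two ends of the chain are handled by
    \<open>e\<close> instead.\<close>
  define good where "good = (\<lambda>(x :: nat \<Rightarrow> real) (i :: nat). (D (x i) > D (x (i - 1)) \<longrightarrow> D (x i) \<le> h (x i)) \<and>
      (D (x i) < D (x (i - 1)) \<longrightarrow> h (x i) \<le> D (x i)))"
  \<comment> \<open>Points are made good from left to right. Goodness of a point involves only the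
    point and its predecessor, so later moves do not disturb earlier ones. The case
    \<open>j = 0\<close> covers \<open>m = 0\<close>.\<close>
  have "\<exists>x. bad x m \<and> (\<forall>i. 0 < i \<and> i \<le> j \<longrightarrow> good x i)" if "j < m \<or> j = 0" for j
    using that
  proof (induction j)
    case 0
    then show ?case using m by auto
  next
    case (Suc j)
    then obtain x where x: "bad x m" "\<And>i. 0 < i \<Longrightarrow> i \<le> j \<Longrightarrow> good x i" by auto
    have jm: "Suc j < m" using Suc by auto
    have xm: "x i \<le> x (Suc i)" if "i < m" for i
      using x that by (auto simp: bad_def chain_def)
    have x3: "x j \<le> x (Suc j)" "x (Suc j) \<le> x (Suc (Suc j))"
      using xm jm by auto
    have "\<exists>z. x j \<le> z \<and> z \<le> x (Suc (Suc j)) \<and> good (x(Suc j := z)) (Suc j) \<and>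
        \<bar>D (x (Suc j)) - D (x j)\<bar> \<le> \<bar>D z - D (x j)\<bar> \<and>
        \<bar>D (x (Suc (Suc j))) - D (x (Suc j))\<bar> \<le> \<bar>D (x (Suc (Suc j))) - D z\<bar>"
    proof (cases "D (x (Suc j)) > D (x j)")
      case True
      then have lt: "D (x (Suc (Suc j))) < D (x (Suc j))"
        using alt[OF x(1), of "Suc j"] jm by (auto simp: mult_less_0_iff)
      obtain z where z: "z \<in> {x j..x (Suc (Suc j))}" "\<forall>y\<in>{x j..x (Suc (Suc j))}. D y \<le> D z"
          "z = x j \<or> z = x (Suc (Suc j)) \<or> D z \<le> h z"
        using maxi[OF order_trans[OF x3]] by blast
      \<comment> \<open>Hence \<open>z\<close> is no end point of the interval:
        \<open>D (x (Suc j))\<close> already exceeds \<open>D\<close> at both neighbours.\<close>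
      have "D (x (Suc j)) \<le> D z"
        using z(2) x3 by auto
      with z True lt show ?thesis
        by (intro exI[of _ z]) (auto simp: good_def)
    next
      case False
      then have lt: "D (x (Suc j)) < D (x j)" "D (x (Suc j)) < D (x (Suc (Suc j)))"
        using alt[OF x(1), of "Suc j"] jm by (auto simp: mult_less_0_iff)
      obtain z where z: "z \<in> {x j..x (Suc (Suc j))}" "\<forall>y\<in>{x j..x (Suc (Suc j))}. D z \<le> D y"
          "z = x j \<or> z = x (Suc (Suc j)) \<or> h z \<le> D z"
        using mini[OF order_trans[OF x3]] by blast
      have "D z \<le> D (x (Suc j))"
        using z(2) x3 by auto
      with z False lt show ?thesis
        by (intro exI[of _ z]) (auto simp: good_def)
    qed
    then obtain z where z: "x j \<le> z" "z \<le> x (Suc (Suc j))" "good (x(Suc j := z)) (Suc j)"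
        "\<bar>D (x (Suc j)) - D (x j)\<bar> \<le> \<bar>D z - D (x j)\<bar>"
        "\<bar>D (x (Suc (Suc j))) - D (x (Suc j))\<bar> \<le> \<bar>D (x (Suc (Suc j))) - D z\<bar>"
      by blast
    let ?y = "x(Suc j := z)"
    have "variation D x m \<le> variation D ?y m"
      unfolding variation_def using z(4,5) by (intro sum_mono) auto
    moreover have "chain ?y m"
      using xm z(1,2) by (auto simp: chain_def)
    ultimately have "bad ?y m"
      using x(1) jm by (auto simp: bad_def)
    moreover have "good ?y i" if "0 < i" "i \<le> Suc j" for i
      using that x(2)[of i] z(3) by (cases "i = Suc j") (auto simp: good_def)
    ultimately show ?case by blast
  qed
  from this[of "m - 1"] obtain x where x: "bad x m" "\<And>i. 0 < i \<Longrightarrow> i < m \<Longrightarrow> good x i"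
    by (cases "m = 0") auto
  \<comment> \<open>By alternation an increase of \<open>D\<close> starts at a point where
    \<open>h\<close> is at most \<open>D\<close> and ends at one where \<open>D\<close> is at most
    \<open>h\<close>, so \<open>h\<close> increases at least as much; decreases are symmetric. Each
    end of the chain costs \<open>e\<close>.\<close>
  have incr: "\<bar>D (x (Suc i)) - D (x i)\<bar> \<le> \<bar>h (x (Suc i)) - h (x i)\<bar> +
      ((if i = 0 then e else 0) + (if i = m - 1 then e else 0))" if i: "i < m" for i
  proof -
    have x0: "x 0 = a" "x m = b" using x by (auto simp: bad_def)
    have right: "\<bar>D (x (Suc i)) - h (x (Suc i))\<bar> \<le> e" if "i = m - 1"
      using that x0 ends i by auto
    have left: "\<bar>D (x i) - h (x i)\<bar> \<le> e" if "i = 0"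
      using that x0 ends by auto
    have e: "e \<ge> 0" using ends by auto
    consider "D (x (Suc i)) = D (x i)" | "D (x (Suc i)) > D (x i)" | "D (x (Suc i)) < D (x i)"
      by linarith
    then show ?thesis
    proof cases
      case 1 then show ?thesis using e by auto
    next
      case 2
      have "D (x (Suc i)) \<le> h (x (Suc i)) + (if i = m - 1 then e else 0)"
        using right x(2)[of "Suc i"] 2 i by (auto simp: good_def)
      moreover have "h (x i) - (if i = 0 then e else 0) \<le> D (x i)"
        using left x(2)[of i] alt[OF x(1), of i] 2 i by (auto simp: good_def mult_less_0_iff)
      ultimately show ?thesis using 2 by linarith
    next
      case 3
      have "h (x (Suc i)) - (if i = m - 1 then e else 0) \<le> D (x (Suc i))"
        using right x(2)[of "Suc i"] 3 i by (auto simp: good_def)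
      moreover have "D (x i) \<le> h (x i) + (if i = 0 then e else 0)"
        using left x(2)[of i] alt[OF x(1), of i] 3 i by (auto simp: good_def mult_less_0_iff)
      ultimately show ?thesis using 3 by linarith
    qed
  qed
  have e: "e \<ge> 0" using ends by auto
  have "variation D x m \<le> variation h x m + ((\<Sum>i<m. if i = 0 then e else 0) + (\<Sum>i<m. if i = m - 1 then e
      else 0))"
    unfolding variation_def sum.distrib[symmetric] using incr by (intro sum_mono) auto
  also have "\<dots> \<le> C + 2 * e"
    using C[of x m] x(1) e by (auto simp: bad_def sum.delta)
  finally show False
    using x(1) by (auto simp: bad_def)
qed

text \<open>Write \<open>D\<close> for the difference of the envelopes and \<open>h\<close> for that
  of the functions. Where \<open>D\<close> exceeds \<open>h\<close>, the envelope of
  \<open>g\<close> lies strictly below \<open>g\<close>, so \<open>D\<close> is locally convex and a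
  maximum can be found elsewhere; where \<open>D\<close> is below \<open>h\<close>, the same holds
  with \<open>f\<close> and minima. The limits at both ends allow the chain to start and stop where
  \<open>D\<close> and \<open>h\<close> almost agree.\<close>

lemma variation_envelope_diff_le:
  fixes f g :: "real \<Rightarrow> real"
  assumes f: "convex_minorant f c" and g: "convex_minorant g d"
    and cont: "\<And>x. isCont f x" "\<And>x. isCont g x"
    and bot: "((\<lambda>x. (convex_envelope f x - convex_envelope g x) - (f x - g x)) \<longlongrightarrow> 0) at_bot"
    and top: "((\<lambda>x. (convex_envelope f x - convex_envelope g x) - (f x - g x)) \<longlongrightarrow> 0) at_top"
    and C: "\<And>x n. chain x n \<Longrightarrow> variation (\<lambda>x. f x - g x) x n \<le> C"
    and x: "chain x n"
  shows "variation (\<lambda>x. convex_envelope f x - convex_envelope g x) x n \<le> C"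
proof -
  define F where "F = convex_envelope f"
  define G where "G = convex_envelope g"
  define D where "D = (\<lambda>x. F x - G x)"
  define h where "h = (\<lambda>x. f x - g x)"
  interpret f: convex_minorant f c by fact
  interpret g: convex_minorant g d by fact
  have conv: "convex_on UNIV F" "convex_on UNIV G"
    using f.envelope_convex g.envelope_convex by (auto simp: F_def G_def)
  have contD: "continuous_on A D" for A
    unfolding D_def using conv
    by (intro continuous_intros continuous_at_imp_continuous_on ballI isCont_convex)
  have contD': "continuous_on A (\<lambda>x. - D x)" for A
    using contD by (intro continuous_intros)
  have maxi: "\<exists>z\<in>{u..w}. (\<forall>y\<in>{u..w}. D y \<le> D z) \<and> (z = u \<or> z = w \<or> D z \<le> h z)" if "u \<le> w" for u w
  proof -
    have "\<exists>e>0. convex_on {x - e..x + e} D" if "x \<notin> {z. D z \<le> h z}" for x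
    proof -
      have "convex_envelope g x < g x"
        using that f.envelope_le[of x] by (auto simp: D_def h_def F_def G_def)
      from g.locally_convex_minus_envelope[OF cont(2) this conv(1)] show ?thesis
        by (simp add: D_def G_def)
    qed
    from maximiser_of_locally_convex[OF that contD, of "{z. D z \<le> h z}"] this show ?thesis by auto
  qed
  have mini: "\<exists>z\<in>{u..w}. (\<forall>y\<in>{u..w}. D z \<le> D y) \<and> (z = u \<or> z = w \<or> h z \<le> D z)" if "u \<le> w" for u w
  proof -
    have "\<exists>e>0. convex_on {x - e..x + e} (\<lambda>x. - D x)" if "x \<notin> {z. h z \<le> D z}" for x
    proof -
      have "convex_envelope f x < f x"
        using that g.envelope_le[of x] by (auto simp: D_def h_def F_def G_def)
      from f.locally_convex_minus_envelope[OF cont(1) this conv(2)] show ?thesis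
        by (simp add: D_def F_def)
    qed
    from maximiser_of_locally_convex[OF that contD', of "{z. h z \<le> D z}"] this show ?thesis by auto
  qed
  have "variation D x n \<le> C + e" if "e > 0" for e
  proof -
    have "eventually (\<lambda>x. \<bar>D x - h x\<bar> < e / 2) at_bot" "eventually (\<lambda>x. \<bar>D x - h x\<bar> < e / 2) at_top"
      using tendstoD[OF bot, of "e / 2"] tendstoD[OF top, of "e / 2"] that
      by (auto simp: D_def h_def F_def G_def dist_real_def)
    then obtain a0 b0 where ab0: "\<And>y. y \<le> a0 \<Longrightarrow> \<bar>D y - h y\<bar> < e / 2" "\<And>y. b0 \<le> y \<Longrightarrow> \<bar>D y - h y\<bar> < e / 2"
      unfolding eventually_at_bot_linorder eventually_at_top_linorder by metis
    \<comment> \<open>The chain is lengthened to reach these far points, which can only increase its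
      variation.\<close>
    define a where "a = min a0 (x 0)"
    define b where "b = max b0 (x n)"
    have ab: "\<bar>D a - h a\<bar> \<le> e / 2" "\<bar>D b - h b\<bar> \<le> e / 2"
      using ab0(1)[of a] ab0(2)[of b] by (auto simp: a_def b_def)
    \<comment> \<open>The point \<open>a\<close>, the \<open>n + 1\<close> points of
      \<open>x\<close>, and \<open>b\<close>: this makes \<open>n + 2\<close> increments.\<close>
    define y where "y = (\<lambda>i. case i of 0 \<Rightarrow> a | Suc i \<Rightarrow> if i \<le> n then x i else b)"
    have "y i \<le> y (Suc i)" if i: "i < Suc (Suc n)" for i
    proof (cases i)
      case 0
      then show ?thesis by (simp add: y_def a_def)
    next
      case (Suc j)
      then consider "j < n" | "j = n" using i by linarith
      then show ?thesis
        by cases (use x in \<open>simp_all add: Suc y_def b_def chain_def\<close>)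
    qed
    then have "chain y (Suc (Suc n))"
      by (simp add: chain_def)
    then have "variation D y (Suc (Suc n)) \<le> C + 2 * (e / 2)"
      using ab C maxi mini
      by (intro variation_le_of_extrema[of D h a "e / 2" b C y]) (auto simp: y_def h_def)
    moreover have "variation D x n \<le> variation D y (Suc (Suc n))"
    proof -
      have "variation D x n = (\<Sum>i<n. \<bar>D (y (Suc (Suc i))) - D (y (Suc i))\<bar>)"
        unfolding variation_def by (intro sum.cong) (auto simp: y_def)
      also have "\<dots> \<le> variation D y (Suc n)"
        unfolding variation_def sum.lessThan_Suc_shift by simp
      also have "\<dots> \<le> variation D y (Suc (Suc n))"
        by (simp add: variation_def)
      finally show ?thesis .
    qed
    ultimately show ?thesis by simp
  qed
  then show ?thesis
    unfolding D_def F_def G_def by (rule field_le_epsilon)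
qed

section \<open>Potentials of measures with finite first moment\<close>

lemma finite_momentD:
  fixes M :: "'a::{banach, second_countable_topology} measure"
  assumes "M \<in> finite_moment_measures"
  shows "finite_measure M" "sets M = sets borel" "space M = UNIV" "integrable M (\<lambda>x. x)"
  using assms sets_eq_imp_space_eq[of M borel] by (auto simp: finite_moment_measures_def)

lemma finite_moment_measurable:
  fixes M :: "'a::{banach, second_countable_topology} measure"
  assumes "M \<in> finite_moment_measures"
  shows "borel_measurable M = borel_measurable borel"
  using finite_momentD(2)[OF assms] by (auto intro!: measurable_cong_sets)

lemma integrable_linear_growth:
  fixes M :: "'a::{banach, second_countable_topology} measure" and f :: "'a \<Rightarrow> real"
  assumes M: "M \<in> finite_moment_measures" and f: "f \<in> borel_measurable borel"
    and le: "\<And>x. \<bar>f x\<bar> \<le> a + b * norm x"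
  shows "integrable M f"
proof (rule Bochner_Integration.integrable_bound)
  interpret finite_measure M using finite_momentD[OF M] by simp
  show "integrable M (\<lambda>x. a + b * norm x)"
    using finite_momentD(4)[OF M] by (intro Bochner_Integration.integrable_add integrable_mult_right
        integrable_norm) auto
  show "f \<in> borel_measurable M"
    using f by (simp add: finite_moment_measurable[OF M])
  show "AE x in M. norm (f x) \<le> norm (a + b * norm x)"
    using le by (auto intro!: AE_I2 order_trans[OF le])
qed

lemma integrable_lipschitz:
  fixes f :: "real \<Rightarrow> real"
  assumes M: "M \<in> finite_moment_measures" and f: "L-lipschitz_on UNIV f"
  shows "integrable M f"
proof (rule integrable_linear_growth[OF M])
  show "f \<in> borel_measurable borel"
    by (intro borel_measurable_continuous_onI lipschitz_on_continuous_on[OF f])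
  fix x
  have "\<bar>f x - f 0\<bar> \<le> L * \<bar>x\<bar>"
    using lipschitz_onD[OF f, of x 0] by (simp add: dist_real_def)
  then show "\<bar>f x\<bar> \<le> \<bar>f 0\<bar> + L * norm x"
    by simp
qed

text \<open>In financial terms the put price as a function of the strike. Its right derivative is
  the distribution function, and twice it differs from the integral of \<bar>x - y\<bar> by an
  affine function of \<open>x\<close>.\<close>

definition potential :: "real measure \<Rightarrow> real \<Rightarrow> real" where
  "potential \<mu> x = (\<integral>y. max 0 (x - y) \<partial>\<mu>)"

definition mass :: "real measure \<Rightarrow> real" where
  "mass \<mu> = measure \<mu> UNIV"

text \<open>The unnormalised first moment, which is additive over sums of measures.\<close>

definition mean :: "real measure \<Rightarrow> real" where
  "mean \<mu> = (\<integral>y. y \<partial>\<mu>)"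

text \<open>These conditions characterise the potentials of measures of mass \<open>m\<close> and
  first moment \<open>c\<close>, see \<open>is_potential_potential\<close> and
  \<open>ex_measure_with_potential\<close>. The asymptote at infinity carries both numbers.\<close>

definition is_potential :: "(real \<Rightarrow> real) \<Rightarrow> real \<Rightarrow> real \<Rightarrow> bool" where
  "is_potential k m c \<longleftrightarrow> convex_on UNIV k \<and> (k \<longlongrightarrow> 0) at_bot \<and>
     ((\<lambda>x. k x - (m * x - c)) \<longlongrightarrow> 0) at_top"

lemma hinge_lipschitz:
  "1-lipschitz_on UNIV (\<lambda>y::real. max 0 (x - y))"
  "1-lipschitz_on UNIV (\<lambda>y::real. max 0 (y - x))"
  by (auto intro!: lipschitz_onI simp: dist_real_def)

lemma integrable_hinge:
  assumes "\<mu> \<in> finite_moment_measures"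
  shows "integrable \<mu> (\<lambda>y::real. max 0 (x - y))" "integrable \<mu> (\<lambda>y::real. max 0 (y - x))"
  using integrable_lipschitz[OF assms] hinge_lipschitz by blast+

lemma integrable_const_moment:
  assumes "\<mu> \<in> finite_moment_measures"
  shows "integrable \<mu> (\<lambda>y::real. c::real)"
proof -
  interpret finite_measure \<mu> using finite_momentD[OF assms] by simp
  show ?thesis by simp
qed

text \<open>Put-call parity: the two hinges differ by \<open>x - y\<close>. The right-hand side
  vanishes at infinity, which gives the asymptote of the potential.\<close>

lemma potential_call:
  assumes "\<mu> \<in> finite_moment_measures"
  shows "potential \<mu> x - (mass \<mu> * x - mean \<mu>) = (\<integral>y. max 0 (y - x) \<partial>\<mu>)"
proof -
  have "(\<integral>y. max 0 (x - y) \<partial>\<mu>) = (\<integral>y. max 0 (y - x) + (x - y) \<partial>\<mu>)"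
    by (intro Bochner_Integration.integral_cong) (auto simp: max_def)
  also have "\<dots> = (\<integral>y. max 0 (y - x) \<partial>\<mu>) + (x * mass \<mu> - mean \<mu>)"
    using integrable_hinge[OF assms] integrable_const_moment[OF assms] finite_momentD(4)[OF assms]
    by (simp add: mean_def mass_def finite_momentD(3)[OF assms])
  finally show ?thesis
    by (simp add: potential_def algebra_simps)
qed

lemma is_potential_potential:
  assumes "\<mu> \<in> finite_moment_measures"
  shows "is_potential (potential \<mu>) (mass \<mu>) (mean \<mu>)"
  unfolding is_potential_def
proof (intro conjI)
  note [simp] = finite_moment_measurable[OF assms]
  have abs: "integrable \<mu> (\<lambda>y. \<bar>y\<bar>)"
    using finite_momentD(4)[OF assms] by (rule integrable_abs)
  show "convex_on UNIV (potential \<mu>)"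
    unfolding convex_on_def
  proof (intro conjI ballI allI impI)
    fix x y u v :: real assume *: "0 \<le> u" "0 \<le> v" "u + v = 1"
    have "potential \<mu> (u *\<^sub>R x + v *\<^sub>R y) \<le> (\<integral>z. u * max 0 (x - z) + v * max 0 (y - z) \<partial>\<mu>)"
      unfolding potential_def
    proof (intro integral_mono Bochner_Integration.integrable_add integrable_mult_right integrable_hinge
        assms)
      fix z
      have "u *\<^sub>R x + v *\<^sub>R y - (u + v) * z = u * (x - z) + v * (y - z)"
        by (simp add: algebra_simps)
      also have "\<dots> \<le> u * max 0 (x - z) + v * max 0 (y - z)"
        using * by (intro add_mono mult_left_mono) auto
      finally have "u *\<^sub>R x + v *\<^sub>R y - (u + v) * z \<le> u * max 0 (x - z) + v * max 0 (y - z)" .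
      then show "max 0 (u *\<^sub>R x + v *\<^sub>R y - z) \<le> u * max 0 (x - z) + v * max 0 (y - z)"
        using * by simp
    qed
    also have "\<dots> = u * potential \<mu> x + v * potential \<mu> y"
      using integrable_hinge[OF assms] by (simp add: potential_def)
    finally show "potential \<mu> (u *\<^sub>R x + v *\<^sub>R y) \<le> u * potential \<mu> x + v * potential \<mu> y" .
  qed auto
  have "((\<lambda>x. \<integral>y. max 0 (- x - y) \<partial>\<mu>) \<longlongrightarrow> (\<integral>y. 0 \<partial>\<mu>)) at_top"
  proof (rule integral_dominated_convergence_at_top[where w = "\<lambda>y. \<bar>y\<bar>"])
    show "AE y in \<mu>. ((\<lambda>x. max 0 (- x - y)) \<longlongrightarrow> 0) at_top"
    proof (rule AE_I2)
      fix y :: real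
      show "((\<lambda>x. max 0 (- x - y)) \<longlongrightarrow> 0) at_top"
        by (intro tendsto_eventually eventually_mono[OF eventually_ge_at_top[of "- y"]]) auto
    qed
    show "\<forall>\<^sub>F x in at_top. AE y in \<mu>. norm (max 0 (- x - y)) \<le> \<bar>y\<bar>"
      by (intro eventually_mono[OF eventually_ge_at_top[of 0]] AE_I2) auto
  qed (use abs in auto)
  then show "(potential \<mu> \<longlongrightarrow> 0) at_bot"
    unfolding filterlim_at_bot_mirror potential_def by simp
  have "((\<lambda>x. \<integral>y. max 0 (y - x) \<partial>\<mu>) \<longlongrightarrow> (\<integral>y. 0 \<partial>\<mu>)) at_top"
  proof (rule integral_dominated_convergence_at_top[where w = "\<lambda>y. \<bar>y\<bar>"])
    show "AE y in \<mu>. ((\<lambda>x. max 0 (y - x)) \<longlongrightarrow> 0) at_top"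
    proof (rule AE_I2)
      fix y :: real
      show "((\<lambda>x. max 0 (y - x)) \<longlongrightarrow> 0) at_top"
        by (intro tendsto_eventually eventually_mono[OF eventually_ge_at_top[of y]]) auto
    qed
    show "\<forall>\<^sub>F x in at_top. AE y in \<mu>. norm (max 0 (y - x)) \<le> \<bar>y\<bar>"
      by (intro eventually_mono[OF eventually_ge_at_top[of 0]] AE_I2) auto
  qed (use abs in auto)
  then show "((\<lambda>x. potential \<mu> x - (mass \<mu> * x - mean \<mu>)) \<longlongrightarrow> 0) at_top"
    by (simp add: potential_call[OF assms])
qed

text \<open>The difference of the two asymptotes is affine with limit 0. Its slope is its increment
  over a step of length 1, hence 0, and then its constant is 0 as well. This reads mass and mean off
  a potential.\<close>

lemma is_potential_unique:
  assumes "is_potential k m c" "is_potential k' m' c'"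
    and lim: "((\<lambda>x. k x - k' x) \<longlongrightarrow> 0) at_top"
  shows "m = m'" "c = c'"
proof -
  define q where "q = (\<lambda>x. (m - m') * x - (c - c'))"
  have "((\<lambda>x. (k x - k' x) - (k x - (m * x - c)) + (k' x - (m' * x - c'))) \<longlongrightarrow> 0 - 0 + 0) at_top"
    using assms by (intro tendsto_intros) (auto simp: is_potential_def)
  then have q: "(q \<longlongrightarrow> 0) at_top"
    by (simp add: q_def algebra_simps)
  have "filterlim (\<lambda>x::real. x + 1) at_top at_top"
    by (intro filterlim_at_top_mono[OF filterlim_ident] always_eventually) auto
  from filterlim_compose[OF q this] have "((\<lambda>x. q (x + 1) - q x) \<longlongrightarrow> 0 - 0) at_top"
    using q by (intro tendsto_diff)
  moreover have "(\<lambda>x. q (x + 1) - q x) = (\<lambda>x. m - m')"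
    by (auto simp: q_def algebra_simps)
  ultimately show "m = m'"
    using tendsto_unique[of at_top "\<lambda>x::real. m - m'" "m - m'" 0] by simp
  with q show "c = c'"
    using tendsto_unique[of at_top "\<lambda>x::real. - (c - c')" "- (c - c')" 0] by (simp add: q_def)
qed

section \<open>Distribution functions as slopes: uniqueness and existence of the measure with a
  given potential\<close>

lemma finite_borel_measure_moment:
  "\<mu> \<in> finite_moment_measures \<Longrightarrow> finite_borel_measure \<mu>"
  by (auto simp: finite_moment_measures_def finite_borel_measure_def finite_borel_measure_axioms_def)

text \<open>The integrand lies between \<open>t - s\<close> times the indicators of the half lines
  up to \<open>s\<close> and up to \<open>t\<close>. It is stated for differences of hinges, which
  are bounded, because \<open>ex_measure_with_potential\<close> applies it to a measure whose first
  moment is not yet known to be finite.\<close>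

lemma cdf_slope:
  assumes "finite_borel_measure \<mu>" "s \<le> t" and D: "D = (\<lambda>y. max 0 (t - y) - max 0 (s - y))"
  shows "cdf \<mu> s * (t - s) \<le> (\<integral>y. D y \<partial>\<mu>)"
    and "(\<integral>y. D y \<partial>\<mu>) \<le> cdf \<mu> t * (t - s)"
    and "integrable \<mu> D"
proof -
  interpret finite_borel_measure \<mu> by fact
  have [measurable_cong, simp]: "sets \<mu> = sets borel"
    by (rule M_is_borel)
  show int: "integrable \<mu> D"
    by (rule integrable_const_bound[of _ "t - s"]) (use \<open>s \<le> t\<close> in \<open>auto simp: D\<close>)
  have *: "(\<integral>y. indicator {..x} y * (t - s) \<partial>\<mu>) = cdf \<mu> x * (t - s)"
    "integrable \<mu> (\<lambda>y. indicator {..x} y * (t - s))" for x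
    by (simp_all add: cdf_def borel_UNIV less_top[symmetric])
  show "cdf \<mu> s * (t - s) \<le> (\<integral>y. D y \<partial>\<mu>)"
    unfolding *(1)[symmetric] using \<open>s \<le> t\<close>
    by (intro integral_mono int *(2)) (auto simp: D indicator_def)
  show "(\<integral>y. D y \<partial>\<mu>) \<le> cdf \<mu> t * (t - s)"
    unfolding *(1)[symmetric] using \<open>s \<le> t\<close>
    by (intro integral_mono int *(2)) (auto simp: D indicator_def)
qed

lemma potential_slope:
  assumes "\<mu> \<in> finite_moment_measures" "s \<le> t"
  shows "cdf \<mu> s * (t - s) \<le> potential \<mu> t - potential \<mu> s"
    and "potential \<mu> t - potential \<mu> s \<le> cdf \<mu> t * (t - s)"
proof -
  have "potential \<mu> t - potential \<mu> s = (\<integral>y. max 0 (t - y) - max 0 (s - y) \<partial>\<mu>)"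
    using integrable_hinge[OF assms(1)] by (simp add: potential_def)
  with cdf_slope[OF finite_borel_measure_moment[OF assms(1)] assms(2) refl]
  show "cdf \<mu> s * (t - s) \<le> potential \<mu> t - potential \<mu> s"
    and "potential \<mu> t - potential \<mu> s \<le> cdf \<mu> t * (t - s)"
    by simp_all
qed

text \<open>Slopes of the potential over \<open>s\<close> and \<open>t\<close> lie between the two
  values of the distribution function. Equal potentials thus give
  \<open>cdf \<mu> s \<le> cdf \<nu> t\<close> for \<open>t\<close> beyond \<open>s\<close>, and
  right continuity lets \<open>t\<close> return to \<open>s\<close>.\<close>

lemma potential_inj:
  assumes "\<mu> \<in> finite_moment_measures" "\<nu> \<in> finite_moment_measures"
    and eq: "potential \<mu> = potential \<nu>"
  shows "\<mu> = \<nu>"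
proof -
  have le: "cdf \<mu> s \<le> cdf \<nu> s"
    if "\<mu> \<in> finite_moment_measures" "\<nu> \<in> finite_moment_measures" "potential \<mu> = potential \<nu>"
    for \<mu> \<nu> s
  proof (rule tendsto_lowerbound)
    show "(cdf \<nu> \<longlongrightarrow> cdf \<nu> s) (at_right s)"
      using finite_borel_measure.cdf_is_right_cont[OF finite_borel_measure_moment[OF that(2)]]
      by (simp add: continuous_within)
    show "\<forall>\<^sub>F t in at_right s. cdf \<mu> s \<le> cdf \<nu> t"
      unfolding eventually_at_filter
    proof (intro always_eventually allI impI)
      fix t assume "t \<in> {s<..}"
      then have "cdf \<mu> s * (t - s) \<le> cdf \<nu> t * (t - s)"
        using potential_slope(1)[OF that(1), of s t] potential_slope(2)[OF that(2), of s t] that(3)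
        by (metis less_imp_le greaterThan_iff order_trans)
      then show "cdf \<mu> s \<le> cdf \<nu> t"
        using \<open>t \<in> {s<..}\<close> by (auto dest: mult_right_le_imp_le)
    qed
  qed simp
  have "cdf \<mu> = cdf \<nu>"
    using le[OF assms] le[OF assms(2,1) eq[symmetric]] by (auto intro!: ext antisym)
  then show ?thesis
    using assms by (intro cdf_unique' finite_borel_measure_moment)
qed

text \<open>The bound is of second order: over \<open>n\<close> equal steps the increments of
  \<open>F\<close> telescope, leaving a total of order \<open>1 / n\<close>. Two functions with the
  same one-sided slopes can so be compared without differentiating them.\<close>

lemma constant_of_slope_bound:
  fixes e F :: "real \<Rightarrow> real"
  assumes e: "\<And>s t. s \<le> t \<Longrightarrow> \<bar>e t - e s\<bar> \<le> (F t - F s) * (t - s)" and "a \<le> x"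
  shows "e x = e a"
proof -
  have bound: "\<bar>e x - e a\<bar> \<le> (F x - F a) * (x - a) / real n" if "n > 0" for n :: nat
  proof -
    define t where "t = (\<lambda>i::nat. a + real i * ((x - a) / real n))"
    have step: "t (Suc i) - t i = (x - a) / real n" for i
      by (simp add: t_def algebra_simps add_divide_distrib diff_divide_distrib)
    have ends: "t 0 = a" "t n = x"
      using that by (auto simp: t_def)
    have "\<bar>e x - e a\<bar> = \<bar>\<Sum>i<n. e (t (Suc i)) - e (t i)\<bar>"
      by (simp add: sum_lessThan_telescope[of "\<lambda>i. e (t i)"] ends)
    also have "\<dots> \<le> (\<Sum>i<n. \<bar>e (t (Suc i)) - e (t i)\<bar>)"
      by (rule sum_abs)
    also have "\<dots> \<le> (\<Sum>i<n. (F (t (Suc i)) - F (t i)) * ((x - a) / real n))"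
    proof (rule sum_mono)
      fix i
      have "0 \<le> (x - a) / real n" using \<open>a \<le> x\<close> by simp
      then have "t i \<le> t (Suc i)" using step[of i] by linarith
      from e[OF this] show "\<bar>e (t (Suc i)) - e (t i)\<bar> \<le> (F (t (Suc i)) - F (t i)) * ((x - a) / real n)"
        by (simp add: step)
    qed
    also have "\<dots> = (F x - F a) * ((x - a) / real n)"
      unfolding sum_distrib_right[symmetric] sum_lessThan_telescope[of "\<lambda>i. F (t i)"] by (simp add: ends)
    finally show ?thesis by simp
  qed
  have "(\<lambda>n. (F x - F a) * (x - a) / real n) \<longlonglongrightarrow> 0"
    by (rule lim_const_over_n)
  then have "\<bar>e x - e a\<bar> \<le> 0"
    by (rule LIMSEQ_le_const) (use bound in \<open>auto intro!: exI[of _ 1]\<close>)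
  then show ?thesis by simp
qed

text \<open>The difference quotients of a convex function increase with \<open>t\<close>, so this
  infimum is the right derivative.\<close>

definition right_slope :: "(real \<Rightarrow> real) \<Rightarrow> real \<Rightarrow> real" where
  "right_slope k x = (INF t\<in>{x<..}. (k t - k x) / (t - x))"

lemma right_slope_bounds:
  fixes k :: "real \<Rightarrow> real"
  assumes k: "convex_on UNIV k"
  shows "s < t \<Longrightarrow> right_slope k s \<le> (k t - k s) / (t - s)"
    and "s < t \<Longrightarrow> (k t - k s) / (t - s) \<le> right_slope k t"
    and "u < x \<Longrightarrow> \<exists>t>x. (k t - k x) / (t - x) < r \<Longrightarrow> right_slope k x < r"
proof -
  have sl: "(k x - k s) / (x - s) \<le> (k t - k x) / (t - x)" if "s < x" "x < t" for s x t
  proof -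
    have "(k x - k s) / (x - s) = (k s - k x) / (s - x)" "(k t - k x) / (t - x) = (k x - k t) / (x - t)"
      by (metis minus_diff_eq minus_divide_divide)+
    with convex_on_slope_le[OF k, of s t x] that show ?thesis by simp
  qed
  \<comment> \<open>A chord to the left of \<open>x\<close> bounds all quotients on the right from
    below.\<close>
  have bdd: "bdd_below ((\<lambda>t. (k t - k x) / (t - x)) ` {x<..})" for x
    using sl[of "x - 1" x] by (intro bdd_belowI2[of _ "(k x - k (x - 1)) / (x - (x - 1))"]) auto
  show "s < t \<Longrightarrow> right_slope k s \<le> (k t - k s) / (t - s)"
    unfolding right_slope_def by (intro cINF_lower bdd) auto
  show "s < t \<Longrightarrow> (k t - k s) / (t - s) \<le> right_slope k t"
    unfolding right_slope_def by (intro cINF_greatest) (use gt_ex[of t] sl in auto)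
  show "\<exists>t>x. (k t - k x) / (t - x) < r \<Longrightarrow> right_slope k x < r"
    unfolding right_slope_def using bdd[of x] gt_ex[of x]
    by (subst cINF_less_iff) auto
qed

text \<open>Together with \<open>0 \<le> m\<close> this is what \<open>interval_measure\<close>
  requires in order to yield a finite measure with distribution function
  \<open>right_slope k\<close> and mass \<open>m\<close>.\<close>

lemma is_potential_right_slope:
  assumes "is_potential k m c"
  shows "\<And>x y. x \<le> y \<Longrightarrow> right_slope k x \<le> right_slope k y"
    and "\<And>a. continuous (at_right a) (right_slope k)"
    and "(right_slope k \<longlongrightarrow> 0) at_bot" and "(right_slope k \<longlongrightarrow> m) at_top"
proof -
  have k: "convex_on UNIV k" and bot: "(k \<longlongrightarrow> 0) at_bot"
    and top: "((\<lambda>x. k x - (m * x - c)) \<longlongrightarrow> 0) at_top"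
    using assms by (auto simp: is_potential_def)
  note bd = right_slope_bounds[OF k]
  show mono: "right_slope k x \<le> right_slope k y" if "x \<le> y" for x y
    using bd(1,2)[of x y] that by (cases "x = y") auto
  show "continuous (at_right a) (right_slope k)" for a
    unfolding continuous_within
  proof (rule order_tendstoI)
    fix l assume "l < right_slope k a"
    then show "\<forall>\<^sub>F x in at_right a. l < right_slope k x"
      unfolding eventually_at_filter
      by (intro always_eventually) (auto intro!: less_le_trans[of l "right_slope k a"] mono)
  next
    fix u assume "right_slope k a < u"
    have "bdd_below ((\<lambda>t. (k t - k a) / (t - a)) ` {a<..})"
      using bd(1) by (intro bdd_belowI2[of _ "right_slope k a"]) auto
    then obtain t where t: "t > a" "(k t - k a) / (t - a) < u"
      using \<open>right_slope k a < u\<close> gt_ex[of a] unfolding right_slope_def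
      by (subst (asm) cINF_less_iff) auto
    \<comment> \<open>A chord from \<open>a\<close> with slope below \<open>u\<close> keeps a slope
      below \<open>u\<close> when its left end moves slightly to the right.\<close>
    have "isCont (\<lambda>y. (k t - k y) / (t - y)) a"
      using t isCont_convex[OF k] by (intro continuous_intros) auto
    then have "((\<lambda>y. (k t - k y) / (t - y)) \<longlongrightarrow> (k t - k a) / (t - a)) (at_right a)"
      using continuous_at_imp_continuous_at_within unfolding continuous_within by blast
    then have "\<forall>\<^sub>F y in at_right a. (k t - k y) / (t - y) < u"
      using t(2) by (rule order_tendstoD)
    moreover have "\<forall>\<^sub>F y in at_right a. y < t"
      using t(1) by (rule order_tendstoD[OF tendsto_ident_at])
    ultimately show "\<forall>\<^sub>F x in at_right a. right_slope k x < u"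
      by eventually_elim (use bd(1) in \<open>force intro: le_less_trans\<close>)
  qed
  have shift: "filterlim (\<lambda>x::real. x + a) at_top at_top" for a
    by (rule filterlim_tendsto_add_at_top[OF tendsto_const filterlim_ident, of a, unfolded add.commute[of
        a]])
  have shift': "filterlim (\<lambda>x::real. x + a) at_bot at_bot" for a
    unfolding filterlim_at_bot
  proof
    fix Z
    show "\<forall>\<^sub>F x in at_bot. x + a \<le> Z"
      by (rule eventually_mono[OF eventually_le_at_bot[of "Z - a"]]) simp
  qed
  \<comment> \<open>Chords of length 1 on either side of \<open>x\<close>; the asymptotes of
    \<open>k\<close> give the limits of their slopes.\<close>
  have b1: "right_slope k x \<le> k (x + 1) - k x" "k x - k (x + - 1) \<le> right_slope k x" for x
    using bd(1)[of x "x + 1"] bd(2)[of "x - 1" x] by simp_all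
  show "(right_slope k \<longlongrightarrow> 0) at_bot"
  proof (rule tendsto_sandwich)
    show "((\<lambda>x. k x - k (x + - 1)) \<longlongrightarrow> 0) at_bot"
      using tendsto_diff[OF bot filterlim_compose[OF bot shift'[of "- 1"]]] by simp
    show "((\<lambda>x. k (x + 1) - k x) \<longlongrightarrow> 0) at_bot"
      using tendsto_diff[OF filterlim_compose[OF bot shift'[of 1]] bot] by simp
  qed (use b1 in auto)
  show "(right_slope k \<longlongrightarrow> m) at_top"
  proof (rule tendsto_sandwich)
    let ?r = "\<lambda>x. k x - (m * x - c)"
    have "((\<lambda>x. ?r x - ?r (x + - 1) + m) \<longlongrightarrow> 0 - 0 + m) at_top"
      using top filterlim_compose[OF top shift[of "- 1"]] by (intro tendsto_intros)
    then show "((\<lambda>x. k x - k (x + - 1)) \<longlongrightarrow> m) at_top"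
      by (simp add: algebra_simps)
    have "((\<lambda>x. ?r (x + 1) - ?r x + m) \<longlongrightarrow> 0 - 0 + m) at_top"
      using top filterlim_compose[OF top shift[of 1]] by (intro tendsto_intros)
    then show "((\<lambda>x. k (x + 1) - k x) \<longlongrightarrow> m) at_top"
      by (simp add: algebra_simps)
  qed (use b1 in auto)
qed

text \<open>The Stieltjes measure of the right derivative is the candidate. Increments of its
  potential and of \<open>k\<close> obey the same bounds in terms of the distribution function, so
  \<open>constant_of_slope_bound\<close> identifies them up to a constant, which vanishes at the
  left end. At first only differences of hinges are known to be integrable, so both tails are
  reached by monotone convergence.\<close>

lemma ex_measure_with_potential:
  assumes pot: "is_potential k m c"
  shows "\<exists>\<mu>\<in>finite_moment_measures. potential \<mu> = k"
proof -
  have k: "convex_on UNIV k" and bot: "(k \<longlongrightarrow> 0) at_bot"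
    and top: "((\<lambda>x. k x - (m * x - c)) \<longlongrightarrow> 0) at_top"
    using assms by (auto simp: is_potential_def)
  define F where "F = right_slope k"
  note F = is_potential_right_slope[OF pot, folded F_def]
  have Fk: "F s * (t - s) \<le> k t - k s" "k t - k s \<le> F t * (t - s)" if "s \<le> t" for s t
    using right_slope_bounds(1,2)[OF k, of s t] that
    by (cases "s = t"; simp add: F_def field_simps)+
  have F0: "0 \<le> F x" for x
    using F(1) by (intro tendsto_upperbound[OF F(3)] eventually_mono[OF eventually_le_at_bot[of x]]) auto
  have "0 \<le> m"
    using F0 by (intro tendsto_lowerbound[OF F(4)]) auto
  define \<mu> where "\<mu> = interval_measure F"
  have fb: "finite_borel_measure \<mu>"
    unfolding \<mu>_def by (rule finite_borel_measure_interval_measure[OF F \<open>0 \<le> m\<close>])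
  interpret finite_borel_measure \<mu> by fact
  have [measurable_cong, simp]: "sets \<mu> = sets borel"
    by (rule M_is_borel)
  have UNIV: "measure \<mu> UNIV = m"
    using interval_measure_UNIV[OF F \<open>0 \<le> m\<close>] \<open>0 \<le> m\<close> by (simp add: \<mu>_def measure_def)
  \<comment> \<open>Both functions have the same increments and the limit 0 at the left end.\<close>
  have "cdf \<mu> x = F x" for x
  proof -
    have "cdf \<mu> x - cdf \<mu> a = F x - F a" if "a < x" for a
      using cdf_diff_eq[OF that] measure_interval_measure_Ioc[of a x F] F(1,2) that
      by (simp add: \<mu>_def)
    then have "\<forall>\<^sub>F a in at_bot. cdf \<mu> a - F a = cdf \<mu> x - F x"
      by (intro eventually_mono[OF eventually_gt_at_bot[of x]]) force
    moreover have "((\<lambda>a. cdf \<mu> a - F a) \<longlongrightarrow> 0 - 0) at_bot"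
      by (intro tendsto_diff cdf_lim_at_bot F)
    ultimately have "((\<lambda>a. cdf \<mu> x - F x) \<longlongrightarrow> 0 - 0) (at_bot :: real filter)"
      by (rule Lim_transform_eventually[rotated])
    then show ?thesis
      by (simp add: tendsto_const_iff)
  qed
  then have cdf: "cdf \<mu> = F" by auto
  have diff: "(\<integral>y. max 0 (x - y) - max 0 (a - y) \<partial>\<mu>) = k x - k a" if "a \<le> x" for a x
  proof -
    define e where "e = (\<lambda>t. (\<integral>y. max 0 (t - y) - max 0 (a - y) \<partial>\<mu>) - k t)"
    have int: "integrable \<mu> (\<lambda>y. max 0 (t - y) - max 0 (a - y))" for t
      by (rule integrable_const_bound[of _ "\<bar>t - a\<bar>"]) auto
    have "\<bar>e t - e s\<bar> \<le> (F t - F s) * (t - s)" if "s \<le> t" for s t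
    proof -
      have "(\<integral>y. max 0 (t - y) - max 0 (a - y) \<partial>\<mu>) - (\<integral>y. max 0 (s - y) - max 0 (a - y) \<partial>\<mu>)
          = (\<integral>y. (max 0 (t - y) - max 0 (a - y)) - (max 0 (s - y) - max 0 (a - y)) \<partial>\<mu>)"
        by (rule Bochner_Integration.integral_diff[OF int int, symmetric])
      also have "\<dots> = (\<integral>y. max 0 (t - y) - max 0 (s - y) \<partial>\<mu>)"
        by (intro Bochner_Integration.integral_cong) auto
      finally show ?thesis
        using cdf_slope(1,2)[OF fb that refl] Fk[OF that] by (simp add: e_def cdf algebra_simps)
    qed
    from constant_of_slope_bound[of e F, OF this \<open>a \<le> x\<close>] show ?thesis
      by (simp add: e_def)
  qed
  have diff_int: "integrable \<mu> (\<lambda>y. max 0 (x - y) - max 0 (a - y))" for a x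
    by (rule integrable_const_bound[of _ "\<bar>x - a\<bar>"]) auto
  have put: "integrable \<mu> (\<lambda>y. max 0 (x - y))" "(\<integral>y. max 0 (x - y) \<partial>\<mu>) = k x" for x
  proof -
    have lim: "(\<lambda>i. k x - k (x - real i)) \<longlonglongrightarrow> k x - 0"
    proof (intro tendsto_diff tendsto_const filterlim_compose[OF bot])
      have "filterlim (\<lambda>i. - x + real i) at_top sequentially"
        by (intro filterlim_tendsto_add_at_top[OF tendsto_const] filterlim_real_sequentially)
      then show "filterlim (\<lambda>i. x - real i) at_bot sequentially"
        by (simp add: filterlim_uminus_at_bot)
    qed
    \<comment> \<open>This is the minimum of \<open>max 0 (x - y)\<close> and \<open>real i\<close>,
      hence increasing in \<open>i\<close>.\<close>
    let ?f = "\<lambda>i y. max 0 (x - y) - max 0 ((x - real i) - y)"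
    have "(\<lambda>i. ?f i y) \<longlonglongrightarrow> max 0 (x - y)" for y
    proof (rule tendsto_eventually)
      obtain n where "x - y \<le> real n" using real_arch_simple by blast
      then show "\<forall>\<^sub>F i in sequentially. ?f i y = max 0 (x - y)"
        by (intro eventually_mono[OF eventually_ge_at_top[of n]]) (auto simp: max_def)
    qed
    then have ae: "AE y in \<mu>. (\<lambda>i. ?f i y) \<longlonglongrightarrow> max 0 (x - y)"
      by auto
    have mono: "AE y in \<mu>. mono (\<lambda>i. ?f i y)" and nn: "AE y in \<mu>. 0 \<le> ?f i y" for i
      by (auto intro!: monoI)
    have "(\<lambda>i. \<integral>y. ?f i y \<partial>\<mu>) \<longlonglongrightarrow> k x"
      using lim by (simp add: diff)
    from integral_monotone_convergence_nonneg[OF diff_int mono nn ae this]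
    show "integrable \<mu> (\<lambda>y. max 0 (x - y))" "(\<integral>y. max 0 (x - y) \<partial>\<mu>) = k x" by auto
  qed
  \<comment> \<open>The truncation is the minimum of \<open>max 0 y\<close> and
    \<open>real i\<close>, written with hinges so that \<open>diff\<close> applies. Its integrals
    converge to the call price at 0, which by put-call parity is \<open>k 0 + c\<close>.\<close>
  have call: "integrable \<mu> (\<lambda>y. max 0 y)"
  proof (rule integral_monotone_convergence_nonneg(1)[where f = "\<lambda>i y. real i - (max 0 (real i - y) - max 0
      (0 - y))"])
    have "(\<lambda>i. real i - (max 0 (real i - y) - max 0 (0 - y))) \<longlonglongrightarrow> max 0 y" for y
    proof (rule tendsto_eventually)
      obtain n where "y \<le> real n" using real_arch_simple by blast
      then show "\<forall>\<^sub>F i in sequentially. real i - (max 0 (real i - y) - max 0 (0 - y)) = max 0 y"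
        by (intro eventually_mono[OF eventually_ge_at_top[of n]]) (auto simp: max_def)
    qed
    then show "AE y in \<mu>. (\<lambda>i. real i - (max 0 (real i - y) - max 0 (0 - y))) \<longlonglongrightarrow> max 0 y"
      by auto
    have "(\<lambda>i. k 0 + c - (k (real i) - (m * real i - c))) \<longlonglongrightarrow> k 0 + c - 0"
      by (intro tendsto_intros filterlim_compose[OF top] filterlim_real_sequentially)
    moreover have "(\<integral>y. real i - (max 0 (real i - y) - max 0 (0 - y)) \<partial>\<mu>) = m * real i - (k (real i) - k 0)"
        for i
      using diff[of 0 "real i"] diff_int[of "real i" 0] by (simp add: UNIV borel_UNIV)
    then have "(\<integral>y. real i - (max 0 (real i - y) - max 0 (0 - y)) \<partial>\<mu>) = k 0 + c - (k (real i) - (m * real i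
        - c))" for i
      by simp
    ultimately show "(\<lambda>i. \<integral>y. real i - (max 0 (real i - y) - max 0 (0 - y)) \<partial>\<mu>) \<longlonglongrightarrow> k 0 + c"
      by (simp only: diff_0_right)
  qed (auto intro!: monoI Bochner_Integration.integrable_diff simp: put(1) put(1)[of 0, simplified])
  have "integrable \<mu> (\<lambda>y. max 0 y - max 0 (0 - y))"
    using call put(1)[of 0] by (intro Bochner_Integration.integrable_diff)
  also have "(\<lambda>y::real. max 0 y - max 0 (0 - y)) = (\<lambda>y. y)"
    by (auto simp: max_def)
  finally have "\<mu> \<in> finite_moment_measures"
    by (simp add: finite_moment_measures_def finite_measure_axioms)
  moreover have "potential \<mu> = k"
    using put(2) by (auto simp: potential_def)
  ultimately show ?thesis by blast
qed

section \<open>Kantorovich distance and convex order in terms of potentials\<close>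

text \<open>Each difference of hinges is monotone in \<open>y\<close>, and without weights the sum
  telescopes to a difference of two hinges, which is 1-Lipschitz. Weights of size at most
  \<open>L\<close> cost the factor \<open>L\<close>.\<close>

lemma hinge_sum_lipschitz:
  fixes x :: "nat \<Rightarrow> real"
  assumes x: "chain x n" and s: "\<And>i. i < n \<Longrightarrow> \<bar>s i\<bar> \<le> L" and "0 \<le> L"
  shows "L-lipschitz_on UNIV (\<lambda>y. \<Sum>i<n. s i * (max 0 (x (Suc i) - y) - max 0 (x i - y)))"
    (is "L-lipschitz_on UNIV ?J")
proof (rule lipschitz_onI)
  define h where "h = (\<lambda>i y. max 0 (x (Suc i) - y) - max 0 (x i - y))"
  have *: "\<bar>?J y - ?J z\<bar> \<le> L * (z - y)" if "y \<le> z" for y z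
  proof -
    have "\<bar>?J y - ?J z\<bar> = \<bar>\<Sum>i<n. s i * (h i y - h i z)\<bar>"
      by (simp add: sum_subtractf h_def right_diff_distrib)
    also have "\<dots> \<le> (\<Sum>i<n. \<bar>s i * (h i y - h i z)\<bar>)"
      by (rule sum_abs)
    also have "\<dots> \<le> (\<Sum>i<n. L * (h i y - h i z))"
    proof (rule sum_mono)
      fix i assume "i \<in> {..<n}"
      then have "h i z \<le> h i y" "\<bar>s i\<bar> \<le> L"
        using x s that by (auto simp: h_def chain_def max_def)
      then show "\<bar>s i * (h i y - h i z)\<bar> \<le> L * (h i y - h i z)"
        by (auto simp: abs_mult intro!: mult_right_mono)
    qed
    also have "\<dots> = L * (\<Sum>i<n. (max 0 (x (Suc i) - y) - max 0 (x (Suc i) - z)) - (max 0 (x i - y) - max 0 (x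
        i - z)))"
      by (simp add: h_def sum_distrib_left algebra_simps)
    also have "\<dots> = L * ((max 0 (x n - y) - max 0 (x n - z)) - (max 0 (x 0 - y) - max 0 (x 0 - z)))"
      by (subst sum_lessThan_telescope) simp
    also have "\<dots> \<le> L * (z - y)"
      using that \<open>0 \<le> L\<close> by (intro mult_left_mono) (auto simp: max_def)
    finally show ?thesis .
  qed
  show "dist (?J y) (?J z) \<le> L * dist y z" for y z
    using *[of y z] *[of z y] by (cases "y \<le> z") (auto simp: dist_real_def abs_minus_commute)
qed fact

text \<open>The function compared with \<open>f\<close> is its piecewise affine interpolation at the
  points \<open>x i\<close>. Cells to the right of \<open>y\<close> telescope down to the cell
  containing \<open>y\<close>, and cells to the left contribute 0; within one cell \<open>f\<close>
  and its interpolation each move by at most \<open>L * d\<close>.\<close>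

lemma hinge_interpolation:
  fixes x :: "nat \<Rightarrow> real"
  assumes f: "L-lipschitz_on UNIV f"
    and x: "\<And>i. x (Suc i) = x i + d" and "0 < d"
    and y: "x 0 \<le> y" "y \<le> x n"
  shows "\<bar>f (x n) - (\<Sum>i<n. (f (x (Suc i)) - f (x i)) / d * (max 0 (x (Suc i) - y) - max 0 (x i - y))) - f y\<bar>
    \<le> 2 * L * d"
  using y(2)
proof (induction n)
  case 0
  then show ?case
    using y(1) \<open>0 < d\<close> lipschitz_on_nonneg[OF f] by simp
next
  case (Suc n)
  let ?S = "\<lambda>n. \<Sum>i<n. (f (x (Suc i)) - f (x i)) / d * (max 0 (x (Suc i) - y) - max 0 (x i - y))"
  show ?case
  proof (cases "y \<le> x n")
    case True
    then have "max 0 (x (Suc n) - y) - max 0 (x n - y) = d"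
      using \<open>0 < d\<close> by (simp add: x)
    then have "?S (Suc n) = ?S n + (f (x (Suc n)) - f (x n)) / d * d"
      by (simp only: sum.lessThan_Suc)
    then have "?S (Suc n) = ?S n + (f (x (Suc n)) - f (x n))"
      using \<open>0 < d\<close> by simp
    then have "f (x (Suc n)) - ?S (Suc n) = f (x n) - ?S n"
      by linarith
    then show ?thesis
      using Suc.IH[OF True] by simp
  next
    case False
    have mono: "x i \<le> x j" if "i \<le> j" for i j
      using lift_Suc_mono_le[of x, OF _ that] x \<open>0 < d\<close> by simp
    have "?S n = 0"
    proof (rule sum.neutral, rule ballI)
      fix i assume "i \<in> {..<n}"
      then have "x i \<le> x n" "x (Suc i) \<le> x n" by (auto intro!: mono)
      with False have "max 0 (x (Suc i) - y) - max 0 (x i - y) = 0" by simp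
      then show "(f (x (Suc i)) - f (x i)) / d * (max 0 (x (Suc i) - y) - max 0 (x i - y)) = 0"
        by simp
    qed
    then have S: "?S (Suc n) = (f (x (Suc n)) - f (x n)) / d * (x (Suc n) - y)"
      using False Suc.prems by simp
    have L: "\<bar>f s - f t\<bar> \<le> L * \<bar>s - t\<bar>" for s t
      using lipschitz_onD[OF f, of s t] by (simp add: dist_real_def)
    have r: "0 \<le> (x (Suc n) - y) / d" "(x (Suc n) - y) / d \<le> 1"
      using False Suc.prems \<open>0 < d\<close> by (auto simp: x)
    have Ld: "L * \<bar>x (Suc n) - y\<bar> \<le> L * d"
      using False Suc.prems lipschitz_on_nonneg[OF f] by (intro mult_left_mono) (auto simp: x)
    have "\<bar>?S (Suc n)\<bar> = \<bar>f (x (Suc n)) - f (x n)\<bar> * ((x (Suc n) - y) / d)"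
    proof -
      have "?S (Suc n) = (f (x (Suc n)) - f (x n)) * ((x (Suc n) - y) / d)"
        unfolding S by simp
      then show ?thesis
        using r(1) by (simp only: abs_mult abs_of_nonneg)
    qed
    also have "\<dots> \<le> \<bar>f (x (Suc n)) - f (x n)\<bar> * 1"
      using r by (intro mult_left_mono) auto
    also have "\<dots> \<le> L * d"
      using L[of "x (Suc n)" "x n"] \<open>0 < d\<close> by (simp add: x)
    finally have "\<bar>?S (Suc n)\<bar> \<le> L * d" .
    moreover have "\<bar>f (x (Suc n)) - f y\<bar> \<le> L * d"
      using L[of "x (Suc n)" y] Ld by linarith
    ultimately show ?thesis
      by linarith
  qed
qed

text \<open>Range and resolution grow together: mesh width \<open>1 / n\<close> on
  \<open>[-n, n]\<close>, which takes \<open>2 * n * n\<close> cells. For \<open>n = 0\<close>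
  division by zero makes every point 0.\<close>

definition grid :: "nat \<Rightarrow> nat \<Rightarrow> real" where
  "grid n i = - real n + real i / real n"

lemma grid_simps:
  "grid n (Suc i) = grid n i + 1 / real n" "grid n 0 = - real n" "grid n (2 * n * n) = real n"
  by (auto simp: grid_def add_divide_distrib)

lemma chain_grid: "chain (grid n) k"
  by (simp add: chain_def grid_simps)

lemma grid_less: "n > 0 \<Longrightarrow> grid n i < grid n (Suc i)"
  by (simp add: grid_simps)

lemma secant_le:
  assumes f: "L-lipschitz_on UNIV f"
  shows "\<bar>(f (grid n (Suc i)) - f (grid n i)) / (1 / real n)\<bar> \<le> L"
proof (cases "n = 0")
  case False
  have "\<bar>f (grid n (Suc i)) - f (grid n i)\<bar> \<le> L * \<bar>grid n (Suc i) - grid n i\<bar>"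
    using lipschitz_onD[OF f, of "grid n (Suc i)" "grid n i"] by (simp add: dist_real_def)
  then have "\<bar>f (grid n (Suc i)) - f (grid n i)\<bar> * real n \<le> (L * \<bar>grid n (Suc i) - grid n i\<bar>) * real n"
    by (intro mult_right_mono) auto
  also have "\<dots> = L"
    using False by (simp add: grid_simps)
  finally show ?thesis
    by (simp add: abs_mult)
qed (use lipschitz_on_nonneg[OF f] in simp)

text \<open>The functions \<open>x \<mapsto> max 0 (x - y)\<close> span the piecewise affine interpolations of \<open>f\<close>, so the
  integral of \<open>f\<close> can be recovered from the potential.\<close>

lemma integral_diff_as_limit:
  assumes f: "L-lipschitz_on UNIV f"
    and \<mu>: "\<mu> \<in> finite_moment_measures" and \<nu>: "\<nu> \<in> finite_moment_measures"
    and mass: "mass \<mu> = mass \<nu>"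
  shows "(\<lambda>n. - (\<Sum>i<2 * n * n. (f (grid n (Suc i)) - f (grid n i)) / (1 / real n) *
      ((potential \<mu> (grid n (Suc i)) - potential \<nu> (grid n (Suc i))) -
       (potential \<mu> (grid n i) - potential \<nu> (grid n i)))))
    \<longlonglongrightarrow> (\<integral>x. f x \<partial>\<mu>) - (\<integral>x. f x \<partial>\<nu>)"
proof -
  define s where "s = (\<lambda>n i. (f (grid n (Suc i)) - f (grid n i)) / (1 / real n))"
  define H where "H = (\<lambda>n i y. max 0 (grid n (Suc i) - y) - max 0 (grid n i - y))"
  \<comment> \<open>On \<open>[-n, n]\<close> this is the piecewise affine interpolation of
    \<open>f\<close> on the grid.\<close>
  define J where "J = (\<lambda>n y. f (real n) - (\<Sum>i<2 * n * n. s n i * H n i y))"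
  note L0 = lipschitz_on_nonneg[OF f]
  have sL: "\<bar>s n i\<bar> \<le> L" for n i
    unfolding s_def by (rule secant_le[OF f])
  have Jlip: "L-lipschitz_on UNIV (\<lambda>y. \<Sum>i<2 * n * n. s n i * H n i y)" for n
    unfolding H_def using sL L0 by (intro hinge_sum_lipschitz chain_grid)
  have close: "\<bar>J n y - f y\<bar> \<le> 2 * L * (1 / real n)" if "\<bar>y\<bar> \<le> real n" "n > 0" for n y
    using hinge_interpolation[OF f, of "grid n" "1 / real n" y "2 * n * n"] that
    by (simp add: J_def s_def H_def grid_simps)
  have lim: "(\<lambda>n. J n y) \<longlonglongrightarrow> f y" for y
  proof (rule Lim_null[THEN iffD2], rule Lim_null_comparison)
    obtain n0 where n0: "\<bar>y\<bar> \<le> real n0" using real_arch_simple by blast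
    show "\<forall>\<^sub>F n in sequentially. norm (J n y - f y) \<le> 2 * L / real n"
      using eventually_ge_at_top[of n0] eventually_gt_at_top[of 0]
      by eventually_elim (use close n0 in \<open>force intro: order_trans\<close>)
    show "(\<lambda>n. 2 * L / real n) \<longlonglongrightarrow> 0"
      by (rule lim_const_over_n)
  qed
  \<comment> \<open>A bound uniform in \<open>n\<close>, for dominated convergence:
    \<open>J n\<close> is \<open>L\<close>-Lipschitz and differs from \<open>f\<close> at 0 by at
    most \<open>2 * L\<close>, the mesh width being at most 1.\<close>
  have bound: "\<bar>J n y\<bar> \<le> (\<bar>f 0\<bar> + 2 * L) + L * norm y" for n y
  proof (cases "n = 0")
    case True
    then show ?thesis using L0 by (simp add: J_def)
  next
    case False
    have "\<bar>J n y - J n 0\<bar> \<le> L * \<bar>y\<bar>"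
      using lipschitz_onD[OF Jlip, of y 0 n] by (simp add: J_def dist_real_def abs_minus_commute)
    moreover have "\<bar>J n 0 - f 0\<bar> \<le> 2 * L"
    proof -
      have "\<bar>J n 0 - f 0\<bar> \<le> 2 * L * (1 / real n)"
        using close[of 0 n] False by simp
      also have "\<dots> \<le> 2 * L * 1"
        using False L0 by (intro mult_left_mono) auto
      finally show ?thesis by simp
    qed
    ultimately show ?thesis by simp
  qed
  have meas: "J n \<in> borel_measurable borel" for n
    unfolding J_def
    by (intro borel_measurable_diff borel_measurable_const borel_measurable_continuous_onI
        lipschitz_on_continuous_on[OF Jlip])
  have fmeas: "f \<in> borel_measurable borel"
    by (intro borel_measurable_continuous_onI lipschitz_on_continuous_on[OF f])
  have conv: "(\<lambda>n. \<integral>y. J n y \<partial>M) \<longlonglongrightarrow> (\<integral>y. f y \<partial>M)" if M: "M \<in> finite_moment_measures" for M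
  proof (rule integral_dominated_convergence)
    show "integrable M (\<lambda>y. (\<bar>f 0\<bar> + 2 * L) + L * norm y)"
      using finite_momentD(4)[OF M]
      by (intro Bochner_Integration.integrable_add integrable_mult_right integrable_norm
          integrable_const_moment[OF M])
  qed (use lim bound meas fmeas in \<open>auto simp: finite_moment_measurable[OF M]\<close>)
  have JI: "(\<integral>y. J n y \<partial>M) = f (real n) * mass M - (\<Sum>i<2 * n * n. s n i * (potential M (grid n (Suc i)) -
      potential M (grid n i)))"
    if M: "M \<in> finite_moment_measures" for M n
  proof -
    have *: "(\<integral>y. s n i * H n i y \<partial>M) = s n i * (potential M (grid n (Suc i)) - potential M (grid n i))" for
        i
      by (simp add: H_def potential_def integrable_hinge[OF M])
    have "(\<integral>y. J n y \<partial>M) = (\<integral>y. f (real n) \<partial>M) - (\<Sum>i<2 * n * n. (\<integral>y. s n i * H n i y \<partial>M))"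
      unfolding J_def
      by (subst Bochner_Integration.integral_diff; (subst Bochner_Integration.integral_sum)?)
        (auto simp: H_def integrable_const_moment[OF M] integrable_hinge[OF M]
          intro!: Bochner_Integration.integrable_sum integrable_mult_right)
    then show ?thesis
      unfolding * by (simp add: mass_def finite_momentD(3)[OF M])
  qed
  have "(\<lambda>n. (\<integral>y. J n y \<partial>\<mu>) - (\<integral>y. J n y \<partial>\<nu>)) \<longlonglongrightarrow> (\<integral>x. f x \<partial>\<mu>) - (\<integral>x. f x \<partial>\<nu>)"
    by (intro tendsto_diff conv \<mu> \<nu>)
  \<comment> \<open>The constants \<open>f (real n)\<close> times the mass cancel because the masses
    agree.\<close>
  moreover have "(\<integral>y. J n y \<partial>\<mu>) - (\<integral>y. J n y \<partial>\<nu>) = - (\<Sum>i<2 * n * n. s n i *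
      ((potential \<mu> (grid n (Suc i)) - potential \<nu> (grid n (Suc i))) -
       (potential \<mu> (grid n i) - potential \<nu> (grid n i))))" for n
    by (simp add: JI[OF \<mu>] JI[OF \<nu>] mass sum_subtractf[symmetric] sum_negf[symmetric] algebra_simps)
  ultimately show ?thesis
    by (simp add: s_def)
qed

text \<open>All secant slopes of a test function have size at most 1, so every approximating sum of
  \<open>integral_diff_as_limit\<close> is bounded by the variation along the grid.\<close>

lemma W_le_variation:
  assumes \<mu>: "\<mu> \<in> finite_moment_measures" and \<nu>: "\<nu> \<in> finite_moment_measures"
    and mass: "mass \<mu> = mass \<nu>"
    and C: "\<And>x n. chain x n \<Longrightarrow> variation (\<lambda>x. potential \<mu> x - potential \<nu> x) x n \<le> C"
  shows "W \<mu> \<nu> \<le> ennreal C"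
  unfolding W_def
proof (rule SUP_least)
  fix f :: "real \<Rightarrow> real" assume "f \<in> {f. 1-lipschitz_on UNIV f}"
  then have f: "1-lipschitz_on UNIV f" by simp
  let ?D = "\<lambda>x. potential \<mu> x - potential \<nu> x"
  have "\<bar>(\<integral>x. f x \<partial>\<mu>) - (\<integral>x. f x \<partial>\<nu>)\<bar> \<le> C"
  proof (rule LIMSEQ_le_const2[OF tendsto_rabs[OF integral_diff_as_limit[OF f \<mu> \<nu> mass]]], intro exI allI
      impI)
    fix n :: nat
    let ?s = "\<lambda>i. (f (grid n (Suc i)) - f (grid n i)) / (1 / real n)"
    have "\<bar>- (\<Sum>i<2 * n * n. ?s i * (?D (grid n (Suc i)) - ?D (grid n i)))\<bar>
        \<le> (\<Sum>i<2 * n * n. \<bar>?s i * (?D (grid n (Suc i)) - ?D (grid n i))\<bar>)"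
      by (subst abs_minus_cancel) (rule sum_abs)
    also have "\<dots> \<le> variation ?D (grid n) (2 * n * n)"
      unfolding variation_def
    proof (rule sum_mono)
      fix i
      have "\<bar>?s i\<bar> \<le> 1"
        by (rule secant_le[OF f])
      then show "\<bar>?s i * (?D (grid n (Suc i)) - ?D (grid n i))\<bar> \<le> \<bar>?D (grid n (Suc i)) - ?D (grid n i)\<bar>"
        unfolding abs_mult by (intro mult_left_le_one_le) auto
    qed
    also have "\<dots> \<le> C"
      by (intro C chain_grid)
    finally show "\<bar>- (\<Sum>i<2 * n * n. ?s i * (?D (grid n (Suc i)) - ?D (grid n i)))\<bar> \<le> C" .
  qed
  then show "ennreal \<bar>(\<integral>x. f x \<partial>\<mu>) - (\<integral>x. f x \<partial>\<nu>)\<bar> \<le> ennreal C"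
    by (rule ennreal_leI)
qed

text \<open>A test function built from hinges with the signs of the increments as weights turns the
  sum of increments into the sum of their absolute values.\<close>

lemma variation_le_W:
  assumes \<mu>: "\<mu> \<in> finite_moment_measures" and \<nu>: "\<nu> \<in> finite_moment_measures"
    and x: "chain x n"
  shows "ennreal (variation (\<lambda>x. potential \<mu> x - potential \<nu> x) x n) \<le> W \<mu> \<nu>"
proof -
  let ?D = "\<lambda>x. potential \<mu> x - potential \<nu> x"
  define s where "s = (\<lambda>i. sgn (?D (x (Suc i)) - ?D (x i)))"
  define J where "J = (\<lambda>y. \<Sum>i<n. s i * (max 0 (x (Suc i) - y) - max 0 (x i - y)))"
  have JL: "1-lipschitz_on UNIV J"
    unfolding J_def by (intro hinge_sum_lipschitz x) (auto simp: s_def sgn_if)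
  have JI: "(\<integral>y. J y \<partial>M) = (\<Sum>i<n. s i * (potential M (x (Suc i)) - potential M (x i)))"
    if M: "M \<in> finite_moment_measures" for M
    unfolding J_def
    by (subst Bochner_Integration.integral_sum)
      (auto simp: integrable_hinge[OF M] potential_def intro!: integrable_mult_right)
  have "(\<integral>y. J y \<partial>\<mu>) - (\<integral>y. J y \<partial>\<nu>) = (\<Sum>i<n. s i * (?D (x (Suc i)) - ?D (x i)))"
    by (simp add: JI[OF \<mu>] JI[OF \<nu>] sum_subtractf[symmetric] algebra_simps)
  also have "\<dots> = variation ?D x n"
    unfolding variation_def by (intro sum.cong) (auto simp: s_def sgn_if)
  finally have "ennreal (variation ?D x n) \<le> ennreal \<bar>(\<integral>y. J y \<partial>\<mu>) - (\<integral>y. J y \<partial>\<nu>)\<bar>"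
    by (simp add: ennreal_leI)
  also have "\<dots> \<le> W \<mu> \<nu>"
    unfolding W_def using JL by (intro SUP_upper) auto
  finally show ?thesis .
qed

section \<open>Convex order as pointwise order of potentials\<close>

text \<open>A chord prolonged to a far point \<open>u\<close> runs below the graph, which is at most
  \<open>C * u\<close> there; in the limit its slope is at most \<open>C\<close>. Prolonging to the
  left bounds the slope from below. Convex order thus only needs Lipschitz test functions, to which
  \<open>integral_diff_as_limit\<close> applies.\<close>

lemma convex_linear_growth_lipschitz:
  fixes \<phi> :: "real \<Rightarrow> real"
  assumes \<phi>: "convex_on UNIV \<phi>" and top: "\<phi> \<in> O[at_top](\<lambda>x. x)" and bot: "\<phi> \<in> O[at_bot](\<lambda>x. x)"
  shows "\<exists>L. L-lipschitz_on UNIV \<phi>"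
proof -
  obtain C where C: "C > 0" "\<forall>\<^sub>F x in at_top. norm (\<phi> x) \<le> C * norm x"
    using landau_o.bigE[OF top] by blast
  obtain B where B: "B > 0" "\<forall>\<^sub>F x in at_bot. norm (\<phi> x) \<le> B * norm x"
    using landau_o.bigE[OF bot] by blast
  have up: "(\<phi> t - \<phi> s) / (t - s) \<le> C" if "s < t" for s t
  proof (rule tendsto_lowerbound)
    show "((\<lambda>u. (C * u - \<phi> t) / (u - t)) \<longlongrightarrow> C) at_top"
      by real_asymp
    show "\<forall>\<^sub>F u in at_top. (\<phi> t - \<phi> s) / (t - s) \<le> (C * u - \<phi> t) / (u - t)"
      using C(2) eventually_gt_at_top[of t] eventually_gt_at_top[of 0]
    proof eventually_elim
      case (elim u)
      have "\<phi> s + (\<phi> t - \<phi> s) / (t - s) * (u - s) \<le> \<phi> u"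
        using convex_line_outside[OF \<phi> that, of u] elim by simp
      moreover have "(\<phi> t - \<phi> s) / (t - s) * (u - s) = (\<phi> t - \<phi> s) / (t - s) * (u - t) + (\<phi> t - \<phi> s) / (t -
          s) * (t - s)"
        by (simp only: distrib_left[symmetric]) simp
      moreover have "(\<phi> t - \<phi> s) / (t - s) * (t - s) = \<phi> t - \<phi> s"
        using that by simp
      ultimately have "(\<phi> t - \<phi> s) / (t - s) * (u - t) \<le> C * u - \<phi> t"
        using elim by simp
      then show ?case
        using elim by (simp add: pos_le_divide_eq)
    qed
  qed simp
  have lo: "- B \<le> (\<phi> t - \<phi> s) / (t - s)" if "s < t" for s t
  proof (rule tendsto_upperbound)
    show "((\<lambda>u. (- B * u - \<phi> s) / (u - s)) \<longlongrightarrow> - B) at_bot"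
      by real_asymp
    show "\<forall>\<^sub>F u in at_bot. (- B * u - \<phi> s) / (u - s) \<le> (\<phi> t - \<phi> s) / (t - s)"
      using B(2) eventually_gt_at_bot[of s] eventually_gt_at_bot[of 0]
    proof eventually_elim
      case (elim u)
      have "\<phi> s + (\<phi> t - \<phi> s) / (t - s) * (u - s) \<le> \<phi> u"
        using convex_line_outside[OF \<phi> that, of u] elim by simp
      then have "(\<phi> t - \<phi> s) / (t - s) * (u - s) \<le> - B * u - \<phi> s"
        using elim by simp
      then show ?case
        using elim by (simp add: neg_divide_le_eq)
    qed
  qed simp
  have "\<bar>\<phi> t - \<phi> s\<bar> \<le> max C B * (t - s)" if "s < t" for s t
  proof -
    have "\<phi> t - \<phi> s \<le> C * (t - s)" "- (\<phi> t - \<phi> s) \<le> B * (t - s)"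
      using up[OF that] lo[OF that] that by (simp_all add: field_simps)
    moreover have "C * (t - s) \<le> max C B * (t - s)" "B * (t - s) \<le> max C B * (t - s)"
      using that by (auto intro!: mult_right_mono)
    ultimately show ?thesis by linarith
  qed
  then have "(max C B)-lipschitz_on UNIV \<phi>"
    using C(1) by (intro lipschitz_onI) (metis abs_minus_commute abs_of_pos diff_gt_0_iff_gt dist_real_def
      linorder_cases dist_self mult_zero_right order_refl, simp)
  then show ?thesis ..
qed

text \<open>Summation by parts: the interior terms pair the non-negative \<open>d\<close> with
  increments of the increasing \<open>s\<close>, both of known sign, so only boundary terms
  remain.\<close>

lemma sum_monotone_slopes_le:
  fixes s d :: "nat \<Rightarrow> real"
  assumes s: "\<And>i. s i \<le> s (Suc i)" and d: "\<And>i. 0 \<le> d i"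
  shows "(\<Sum>i<n. s i * (d (Suc i) - d i)) \<le> s n * d n - s 0 * d 0"
proof (induction n)
  case (Suc n)
  have "(\<Sum>i<Suc n. s i * (d (Suc i) - d i)) \<le> s n * d n - s 0 * d 0 + s n * (d (Suc n) - d n)"
    using Suc by simp
  also have "\<dots> = s n * d (Suc n) - s 0 * d 0"
    by (simp add: algebra_simps)
  also have "\<dots> \<le> s (Suc n) * d (Suc n) - s 0 * d 0"
    using s[of n] d[of "Suc n"] by (simp add: mult_right_mono)
  finally show ?case .
qed simp

text \<open>Constants and the identity are convex together with their negatives, which turns
  inequalities into equalities of mass and mean. The hinges give the potentials.\<close>

lemma convex_leD:
  assumes "convex_le \<mu> \<nu>"
  shows "\<mu> \<in> finite_moment_measures" "\<nu> \<in> finite_moment_measures" "mass \<mu> = mass \<nu>" "mean \<mu> = mean \<nu>"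
    "potential \<mu> x \<le> potential \<nu> x"
proof -
  show \<mu>: "\<mu> \<in> finite_moment_measures" and \<nu>: "\<nu> \<in> finite_moment_measures"
    using assms by (auto simp: convex_le_def)
  have le: "(\<integral>x. \<phi> x \<partial>\<mu>) \<le> (\<integral>x. \<phi> x \<partial>\<nu>)"
    if "convex_on UNIV \<phi>" "\<phi> \<in> O[at_top](\<lambda>x. x)" "\<phi> \<in> O[at_bot](\<lambda>x. x)" for \<phi> :: "real \<Rightarrow> real"
    using assms that by (simp add: convex_le_def)
  have lin: "convex_on UNIV (\<lambda>x::real. a * x + b)" "(\<lambda>x::real. a * x + b) \<in> O[at_top](\<lambda>x. x)"
    "(\<lambda>x::real. a * x + b) \<in> O[at_bot](\<lambda>x. x)" for a b
    by (rule convex_on_affine, simp, real_asymp+)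
  show "mass \<mu> = mass \<nu>"
    using le[OF lin, of 0 1] le[OF lin, of 0 "-1"]
    by (simp add: mass_def finite_momentD(3)[OF \<mu>] finite_momentD(3)[OF \<nu>])
  show "mean \<mu> = mean \<nu>"
    using le[OF lin, of 1 0] le[OF lin, of "-1" 0] by (simp add: mean_def)
  show "potential \<mu> x \<le> potential \<nu> x"
    unfolding potential_def
  proof (rule le)
    show "convex_on UNIV (\<lambda>y. max 0 (x - y))"
      using convex_on_max_fun[OF convex_on_affine[of UNIV 0 0] convex_on_affine[of UNIV "-1" x]] by simp
    have "(\<lambda>y. 0) \<in> O[at_top](\<lambda>y::real. y)"
      by simp
    moreover have "\<forall>\<^sub>F y in at_top. 0 = max 0 (x - y)"
      by (rule eventually_mono[OF eventually_ge_at_top[of x]]) simp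
    ultimately show "(\<lambda>y. max 0 (x - y)) \<in> O[at_top](\<lambda>y. y)"
      by (subst (asm) landau_o.big.in_cong)
    have "(\<lambda>y. x - y) \<in> O[at_bot](\<lambda>y::real. y)"
      by real_asymp
    moreover have "\<forall>\<^sub>F y in at_bot. x - y = max 0 (x - y)"
      by (rule eventually_mono[OF eventually_le_at_bot[of x]]) simp
    ultimately show "(\<lambda>y. max 0 (x - y)) \<in> O[at_bot](\<lambda>y. y)"
      by (subst (asm) landau_o.big.in_cong)
  qed
qed

text \<open>The difference of integrals is a limit of sums of secant slopes times increments of
  \<open>D\<close>. Secant slopes of a convex function increase and \<open>D\<close> is
  non-negative, so \<open>sum_monotone_slopes_le\<close> leaves only boundary terms. They vanish in
  the limit, at the right end because mass and mean agree.\<close>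

lemma convex_leI:
  assumes \<mu>: "\<mu> \<in> finite_moment_measures" and \<nu>: "\<nu> \<in> finite_moment_measures"
    and mass: "mass \<mu> = mass \<nu>" and mean: "mean \<mu> = mean \<nu>"
    and le: "\<And>x. potential \<mu> x \<le> potential \<nu> x"
  shows "convex_le \<mu> \<nu>"
  unfolding convex_le_def
proof (intro conjI \<mu> \<nu> allI impI)
  fix \<phi> :: "real \<Rightarrow> real"
  assume *: "convex_on UNIV \<phi> \<and> \<phi> \<in> O[at_top](\<lambda>x. x) \<and> \<phi> \<in> O[at_bot](\<lambda>x. x)"
  then obtain L where L: "L-lipschitz_on UNIV \<phi>"
    using convex_linear_growth_lipschitz by blast
  note L0 = lipschitz_on_nonneg[OF L]
  define D where "D = (\<lambda>x. potential \<nu> x - potential \<mu> x)"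
  have D0: "0 \<le> D x" for x
    using le[of x] by (simp add: D_def)
  define s where "s = (\<lambda>n i. (\<phi> (grid n (Suc i)) - \<phi> (grid n i)) / (1 / real n))"
  have lim: "(\<lambda>n. (\<Sum>i<2 * n * n. s n i * (D (grid n (Suc i)) - D (grid n i))))
      \<longlonglongrightarrow> (\<integral>x. \<phi> x \<partial>\<mu>) - (\<integral>x. \<phi> x \<partial>\<nu>)"
    using integral_diff_as_limit[OF L \<mu> \<nu> mass]
    by (simp add: s_def D_def sum_negf[symmetric] algebra_simps)
  have bound: "(\<Sum>i<2 * n * n. s n i * (D (grid n (Suc i)) - D (grid n i))) \<le> L * D (real n) + L * D (- real
      n)"
    if "n > 0" for n
  proof -
    have "(\<Sum>i<2 * n * n. s n i * (D (grid n (Suc i)) - D (grid n i)))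
        \<le> s n (2 * n * n) * D (grid n (2 * n * n)) - s n 0 * D (grid n 0)"
    proof (rule sum_monotone_slopes_le[where s = "s n" and d = "\<lambda>i. D (grid n i)"])
      fix i
      have "grid n i < grid n (Suc i)" "grid n (Suc i) < grid n (Suc (Suc i))"
        using that by (auto intro: grid_less)
      from convex_on_slope_le[of UNIV \<phi>, OF _ _ _ this]
      have "(\<phi> (grid n i) - \<phi> (grid n (Suc i))) / (grid n i - grid n (Suc i))
          \<le> (\<phi> (grid n (Suc i)) - \<phi> (grid n (Suc (Suc i)))) / (grid n (Suc i) - grid n (Suc (Suc i)))"
        using * by (auto intro: order_trans)
      then show "s n i \<le> s n (Suc i)"
        using that by (simp add: s_def grid_simps)
    qed (rule D0)
    also have "\<dots> \<le> \<bar>s n (2 * n * n)\<bar> * D (real n) + \<bar>s n 0\<bar> * D (- real n)"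
      using D0[of "real n"] D0[of "- real n"] unfolding grid_simps
      by (smt (verit) mult_right_mono mult_minus_left)
    also have "\<dots> \<le> L * D (real n) + L * D (- real n)"
    proof -
      have "\<bar>s n i\<bar> \<le> L" for i
        unfolding s_def by (rule secant_le[OF L])
      then show ?thesis
        using D0 by (intro add_mono mult_right_mono)
    qed
    finally show ?thesis .
  qed
  have "((\<lambda>x. (potential \<nu> x - (mass \<nu> * x - mean \<nu>)) - (potential \<mu> x - (mass \<mu> * x - mean \<mu>))) \<longlongrightarrow> 0 - 0)
      at_top"
    using is_potential_potential[OF \<mu>] is_potential_potential[OF \<nu>]
    by (intro tendsto_diff) (auto simp: is_potential_def)
  then have Dt: "(D \<longlongrightarrow> 0) at_top"
    by (simp add: D_def mass mean)
  have "((\<lambda>x. potential \<nu> x - potential \<mu> x) \<longlongrightarrow> 0 - 0) at_bot"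
    using is_potential_potential[OF \<mu>] is_potential_potential[OF \<nu>]
    by (intro tendsto_diff) (auto simp: is_potential_def)
  then have Db: "(D \<longlongrightarrow> 0) at_bot"
    by (simp add: D_def)
  have "filterlim (\<lambda>n. - real n) at_bot sequentially"
    by (simp add: filterlim_uminus_at_top[symmetric] filterlim_real_sequentially)
  then have lim0: "(\<lambda>n. L * D (real n) + L * D (- real n)) \<longlonglongrightarrow> L * 0 + L * 0"
    by (intro tendsto_add tendsto_mult_left filterlim_compose[OF Dt filterlim_real_sequentially]
        filterlim_compose[OF Db])
  have "(\<integral>x. \<phi> x \<partial>\<mu>) - (\<integral>x. \<phi> x \<partial>\<nu>) \<le> L * 0 + L * 0"
    by (rule LIMSEQ_le[OF lim lim0]) (use bound in \<open>auto intro!: exI[of _ 1]\<close>)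
  then show "(\<integral>x. \<phi> x \<partial>\<mu>) \<le> (\<integral>x. \<phi> x \<partial>\<nu>)"
    by simp
qed

section \<open>Sums of measures\<close>

text \<open>There is no addition on the type of measures, hence a relation for \<open>\<nu> = \<eta> + \<kappa>\<close>.\<close>

definition sum_measure :: "'a measure \<Rightarrow> 'a measure \<Rightarrow> 'a measure \<Rightarrow> bool" where
  "sum_measure \<nu> \<eta> \<kappa> \<longleftrightarrow> sets \<eta> = sets \<nu> \<and> sets \<kappa> = sets \<nu> \<and>
     (\<forall>A\<in>sets \<nu>. emeasure \<nu> A = emeasure \<eta> A + emeasure \<kappa> A)"

lemma nn_integral_sum_measure:
  assumes sum: "sum_measure \<nu> \<eta> \<kappa>" and f: "f \<in> borel_measurable \<nu>"
  shows "(\<integral>\<^sup>+x. f x \<partial>\<nu>) = (\<integral>\<^sup>+x. f x \<partial>\<eta>) + (\<integral>\<^sup>+x. f x \<partial>\<kappa>)"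
  using f
proof (induction f rule: borel_measurable_induct)
  have [measurable_cong]: "sets \<eta> = sets \<nu>" "sets \<kappa> = sets \<nu>"
    using sum by (auto simp: sum_measure_def)
  have [simp]: "space \<eta> = space \<nu>" "space \<kappa> = space \<nu>"
    using sum by (auto simp: sum_measure_def intro!: sets_eq_imp_space_eq)
  {
    case (cong f g)
    then show ?case
      by (simp cong: nn_integral_cong_simp)
  next
    case (set A)
    then show ?case
      using sum by (simp add: sum_measure_def)
  next
    case (mult u c)
    then show ?case
      by (simp add: nn_integral_cmult distrib_left)
  next
    case (add u v)
    then show ?case
      by (simp add: nn_integral_add algebra_simps)
  next
    case (seq U)
    note [measurable] = seq(1)
    have mono: "incseq (\<lambda>i. \<integral>\<^sup>+x. U i x \<partial>M)" for M
      using seq(3) by (auto simp: incseq_def le_fun_def intro!: nn_integral_mono)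
    have "(\<integral>\<^sup>+x. (SUP i. U i) x \<partial>\<nu>) = (SUP i. (\<integral>\<^sup>+x. U i x \<partial>\<nu>))"
      using seq(3) by (simp add: image_comp nn_integral_monotone_convergence_SUP)
    also have "\<dots> = (SUP i. (\<integral>\<^sup>+x. U i x \<partial>\<eta>) + (\<integral>\<^sup>+x. U i x \<partial>\<kappa>))"
      using seq by simp
    also have "\<dots> = (SUP i. (\<integral>\<^sup>+x. U i x \<partial>\<eta>)) + (SUP i. (\<integral>\<^sup>+x. U i x \<partial>\<kappa>))"
      by (intro ennreal_SUP_add mono)
    also have "\<dots> = (\<integral>\<^sup>+x. (SUP i. U i) x \<partial>\<eta>) + (\<integral>\<^sup>+x. (SUP i. U i) x \<partial>\<kappa>)"
      using seq(3) by (simp add: image_comp nn_integral_monotone_convergence_SUP)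
    finally show ?case by (simp add: image_comp)
  }
qed

lemma sum_measure_commute: "sum_measure \<nu> \<eta> \<kappa> \<Longrightarrow> sum_measure \<nu> \<kappa> \<eta>"
  by (auto simp: sum_measure_def add.commute)

lemma sum_measure_moment:
  fixes \<nu> :: "real measure"
  assumes sum: "sum_measure \<nu> \<eta> \<kappa>" and \<nu>: "\<nu> \<in> finite_moment_measures"
  shows "\<eta> \<in> finite_moment_measures"
proof -
  have sets: "sets \<eta> = sets borel"
    using sum finite_momentD(2)[OF \<nu>] by (simp add: sum_measure_def)
  have le: "(\<integral>\<^sup>+x. f x \<partial>\<eta>) \<le> (\<integral>\<^sup>+x. f x \<partial>\<nu>)" if "f \<in> borel_measurable borel" for f
    using nn_integral_sum_measure[OF sum, of f] that by (simp add: finite_moment_measurable[OF \<nu>])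
  interpret finite_measure \<nu> using finite_momentD[OF \<nu>] by simp
  have "emeasure \<eta> (space \<eta>) \<le> emeasure \<nu> (space \<nu>)"
    using le[of "\<lambda>_. 1"] by simp
  then have "emeasure \<eta> (space \<eta>) \<noteq> \<infinity>"
    using emeasure_finite[of "space \<nu>"] by (auto simp: top_unique)
  moreover have "(\<integral>\<^sup>+x. ennreal (norm x) \<partial>\<eta>) < \<infinity>"
    using le[of "\<lambda>x. ennreal (norm x)"] integrableD(2)[OF integrable_norm[OF finite_momentD(4)[OF \<nu>]]]
    by (simp add: le_less_trans less_top)
  moreover have "(\<lambda>x. x) \<in> borel_measurable \<eta>"
    by (subst measurable_cong_sets[OF sets refl]) simp
  ultimately have "finite_measure \<eta>" "integrable \<eta> (\<lambda>x. x)"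
    by (auto intro!: finite_measureI integrableI_bounded)
  then show ?thesis
    by (simp add: finite_moment_measures_def sets)
qed

lemma integral_sum_measure:
  fixes f :: "'a \<Rightarrow> real"
  assumes sum: "sum_measure \<nu> \<eta> \<kappa>" and f: "integrable \<nu> f"
  shows "(\<integral>x. f x \<partial>\<nu>) = (\<integral>x. f x \<partial>\<eta>) + (\<integral>x. f x \<partial>\<kappa>)"
proof -
  have [measurable_cong]: "sets \<eta> = sets \<nu>" "sets \<kappa> = sets \<nu>"
    using sum by (auto simp: sum_measure_def)
  have fm[measurable]: "f \<in> borel_measurable \<nu>"
    using f by simp
  have fm': "f \<in> borel_measurable \<eta>" "f \<in> borel_measurable \<kappa>"
    by measurable
  note nn = nn_integral_sum_measure[OF sum]
  have int: "integrable \<eta> f" "integrable \<kappa> f"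
    using f fm' nn[of "\<lambda>x. ennreal (norm (f x))"] by (auto simp: integrable_iff_bounded)
  have fin: "(\<integral>\<^sup>+x. ennreal (g x) \<partial>M) < \<infinity>" if "integrable M f" "g = f \<or> g = (\<lambda>x. - f x)" for M :: "'a
      measure" and g
    using integrableD(2,3)[OF that(1)] that(2) by (auto simp: less_top)
  show ?thesis
    unfolding real_lebesgue_integral_def[OF f] real_lebesgue_integral_def[OF int(1)]
        real_lebesgue_integral_def[OF int(2)]
    using fin[OF int(1)] fin[OF int(2)]
    by (subst nn, measurable)+ (simp add: enn2real_plus)
qed

lemma sum_measure_potential:
  assumes sum: "sum_measure \<nu> \<eta> \<kappa>" and \<nu>: "\<nu> \<in> finite_moment_measures"
  shows "potential \<nu> x = potential \<eta> x + potential \<kappa> x"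
    and "mass \<nu> = mass \<eta> + mass \<kappa>" and "mean \<nu> = mean \<eta> + mean \<kappa>"
proof -
  note int = integral_sum_measure[OF sum]
  show "potential \<nu> x = potential \<eta> x + potential \<kappa> x"
    unfolding potential_def by (intro int integrable_hinge \<nu>)
  show "mean \<nu> = mean \<eta> + mean \<kappa>"
    unfolding mean_def by (intro int finite_momentD \<nu>)
  note m = sum_measure_moment[OF sum \<nu>] sum_measure_moment[OF sum_measure_commute[OF sum] \<nu>]
  show "mass \<nu> = mass \<eta> + mass \<kappa>"
    using int[OF integrable_const_moment[OF \<nu>, of 1]]
    by (simp add: mass_def finite_momentD(3)[OF \<nu>] finite_momentD(3)[OF m(1)] finite_momentD(3)[OF m(2)])
qed

lemma ex_sum_measure:
  assumes "sets \<kappa> = sets \<eta>"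
  shows "\<exists>\<nu>. sum_measure \<nu> \<eta> \<kappa>"
proof
  let ?\<nu> = "measure_of (space \<eta>) (sets \<eta>) (\<lambda>A. emeasure \<eta> A + emeasure \<kappa> A)"
  have "emeasure ?\<nu> A = emeasure \<eta> A + emeasure \<kappa> A" if "A \<in> sets \<eta>" for A
  proof (rule emeasure_measure_of_sigma)
    show "sigma_algebra (space \<eta>) (sets \<eta>)" ..
    show "positive (sets \<eta>) (\<lambda>A. emeasure \<eta> A + emeasure \<kappa> A)"
      by (simp add: positive_def)
    show "countably_additive (sets \<eta>) (\<lambda>A. emeasure \<eta> A + emeasure \<kappa> A)"
      unfolding countably_additive_def
    proof (intro allI impI)
      fix A :: "nat \<Rightarrow> 'a set" assume "range A \<subseteq> sets \<eta>" "disjoint_family A"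
      then show "(\<Sum>i. emeasure \<eta> (A i) + emeasure \<kappa> (A i)) = emeasure \<eta> (\<Union>i. A i) + emeasure \<kappa> (\<Union>i. A i)"
        using assms by (subst suminf_add[symmetric]) (auto simp: suminf_emeasure)
    qed
  qed fact
  then show "sum_measure ?\<nu> \<eta> \<kappa>"
    using assms by (simp add: sum_measure_def)
qed

text \<open>The actual sum of \<open>\<eta>\<close> and \<open>\<kappa>\<close> has the potential of
  \<open>\<nu>\<close>, and a potential determines its measure.\<close>

lemma sum_measureI_potential:
  assumes \<nu>: "\<nu> \<in> finite_moment_measures" and \<eta>: "\<eta> \<in> finite_moment_measures"
    and \<kappa>: "\<kappa> \<in> finite_moment_measures"
    and pot: "\<And>x. potential \<nu> x = potential \<eta> x + potential \<kappa> x"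
  shows "sum_measure \<nu> \<eta> \<kappa>"
proof -
  obtain \<sigma> where \<sigma>: "sum_measure \<sigma> \<eta> \<kappa>"
    using ex_sum_measure[of \<kappa> \<eta>] finite_momentD(2)[OF \<eta>] finite_momentD(2)[OF \<kappa>] by auto
  have sets: "sets \<sigma> = sets borel"
    using \<sigma> finite_momentD(2)[OF \<eta>] by (simp add: sum_measure_def)
  have meas: "borel_measurable \<sigma> = borel_measurable borel"
    using sets by (auto intro!: measurable_cong_sets)
  have space: "space \<sigma> = UNIV"
    using sets_eq_imp_space_eq[OF sets] by simp
  have "UNIV \<in> sets \<sigma>"
    by (simp add: sets)
  then have "emeasure \<sigma> (space \<sigma>) = emeasure \<eta> UNIV + emeasure \<kappa> UNIV"
    unfolding space using \<sigma> by (auto simp: sum_measure_def)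
  also have "\<dots> \<noteq> \<infinity>"
    using finite_measure.emeasure_finite[OF finite_momentD(1)[OF \<eta>], of UNIV]
      finite_measure.emeasure_finite[OF finite_momentD(1)[OF \<kappa>], of UNIV] by simp
  finally have "finite_measure \<sigma>"
    by (rule finite_measureI)
  moreover have "integrable \<sigma> (\<lambda>x. x)"
  proof -
    have "(\<integral>\<^sup>+x. ennreal (norm x) \<partial>\<sigma>) = (\<integral>\<^sup>+x. ennreal (norm x) \<partial>\<eta>) + (\<integral>\<^sup>+x. ennreal (norm x) \<partial>\<kappa>)"
      by (rule nn_integral_sum_measure[OF \<sigma>]) (simp add: meas)
    also have "\<dots> < \<infinity>"
      using integrableD(2)[OF integrable_norm[OF finite_momentD(4)[OF \<eta>]]]
        integrableD(2)[OF integrable_norm[OF finite_momentD(4)[OF \<kappa>]]] by (simp add: less_top)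
    finally show ?thesis
      by (intro integrableI_bounded) (simp_all add: meas)
  qed
  ultimately have m: "\<sigma> \<in> finite_moment_measures"
    using sets by (simp add: finite_moment_measures_def)
  have "potential \<sigma> = potential \<nu>"
    using sum_measure_potential(1)[OF \<sigma> m] pot by auto
  from potential_inj[OF m \<nu> this] \<sigma> show ?thesis by simp
qed

text \<open>The difference measure is the complement. Through \<open>sum_measure_potential\<close>,
  setwise order becomes a statement on potentials: their difference is again the potential of a
  measure.\<close>

lemma setwise_le_iff_sum_measure:
  assumes \<nu>: "\<nu> \<in> finite_moment_measures"
  shows "setwise_le \<eta> \<nu> \<longleftrightarrow> (\<exists>\<kappa>. sum_measure \<nu> \<eta> \<kappa>)"
proof
  assume le: "setwise_le \<eta> \<nu>"
  then have sets: "sets \<eta> = sets \<nu>" by (simp add: setwise_le_def)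
  have fin: "finite_measure \<nu>" using finite_momentD(1)[OF \<nu>] .
  have "emeasure \<eta> (space \<eta>) \<le> emeasure \<nu> (space \<nu>)"
    using le sets_eq_imp_space_eq[OF sets] by (simp add: setwise_le_def)
  then have fin': "finite_measure \<eta>"
    using finite_measure.emeasure_finite[OF fin, of "space \<nu>"] by (auto intro!: finite_measureI simp:
        top_unique)
  have "sum_measure \<nu> \<eta> (diff_measure \<nu> \<eta>)"
    unfolding sum_measure_def
  proof (intro conjI ballI)
    fix A assume A: "A \<in> sets \<nu>"
    have "emeasure \<eta> A \<le> emeasure \<nu> A"
      using le A by (simp add: setwise_le_def)
    moreover have "emeasure (diff_measure \<nu> \<eta>) A = emeasure \<nu> A - emeasure \<eta> A"
      using le A by (intro emeasure_diff_measure[OF fin fin']) (auto simp: setwise_le_def)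
    ultimately show "emeasure \<nu> A = emeasure \<eta> A + emeasure (diff_measure \<nu> \<eta>) A"
      by (simp add: add_diff_inverse_ennreal)
  qed (use sets in auto)
  then show "\<exists>\<kappa>. sum_measure \<nu> \<eta> \<kappa>" ..
qed (auto simp: sum_measure_def setwise_le_def)

section \<open>The potential of the shadow\<close>

lemma is_potential_diff:
  assumes "is_potential k m c" "is_potential k' m' c'" and "convex_on UNIV (\<lambda>x. k x - k' x)"
  shows "is_potential (\<lambda>x. k x - k' x) (m - m') (c - c')"
  unfolding is_potential_def
proof (intro conjI assms(3))
  show "((\<lambda>x. k x - k' x) \<longlongrightarrow> 0) at_bot"
    using tendsto_diff[of k 0 at_bot k' 0] assms by (simp add: is_potential_def)
  show "((\<lambda>x. k x - k' x - ((m - m') * x - (c - c'))) \<longlongrightarrow> 0) at_top"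
    using tendsto_diff[of "\<lambda>x. k x - (m * x - c)" 0 at_top "\<lambda>x. k' x - (m' * x - c')" 0] assms
    by (simp add: is_potential_def algebra_simps)
qed

lemma mass_mean_of_potential:
  assumes "\<mu> \<in> finite_moment_measures" "is_potential (potential \<mu>) m c"
  shows "mass \<mu> = m" "mean \<mu> = c"
  using is_potential_unique[OF is_potential_potential[OF assms(1)] assms(2)] by simp_all

lemma convex_le_antisym:
  assumes "convex_le \<mu> \<nu>" "convex_le \<nu> \<mu>"
  shows "\<mu> = \<nu>"
  using convex_leD[OF assms(1)] convex_leD[OF assms(2)]
  by (intro potential_inj) (auto intro: antisym)

text \<open>The measure \<open>\<rho>\<close> witnesses that \<open>\<mu>\<close> can be completed to a measure dominated by \<open>\<nu>\<close> in convex
  order. Its potential is a convex minorant of the difference of those of \<open>\<nu>\<close> and \<open>\<mu>\<close>.\<close>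

locale shadow_data =
  fixes \<nu> \<mu> \<rho> :: "real measure"
  assumes \<nu>: "\<nu> \<in> finite_moment_measures" and \<mu>: "\<mu> \<in> finite_moment_measures"
    and \<rho>: "\<rho> \<in> finite_moment_measures"
    and mass_eq: "mass \<nu> = mass \<mu> + mass \<rho>" and mean_eq: "mean \<nu> = mean \<mu> + mean \<rho>"
    and potential_le: "\<And>x. potential \<mu> x + potential \<rho> x \<le> potential \<nu> x"
begin

abbreviation gap :: "real \<Rightarrow> real" where
  "gap \<equiv> \<lambda>x. potential \<nu> x - potential \<mu> x"

definition k :: "real \<Rightarrow> real" where
  "k = convex_envelope gap"

lemma pot\<nu>: "is_potential (potential \<nu>) (mass \<nu>) (mean \<nu>)"
  and pot\<mu>: "is_potential (potential \<mu>) (mass \<mu>) (mean \<mu>)"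
  and pot\<rho>: "is_potential (potential \<rho>) (mass \<rho>) (mean \<rho>)"
  by (intro is_potential_potential \<nu> \<mu> \<rho>)+

sublocale convex_minorant gap "potential \<rho>"
proof
  show "convex_on UNIV (potential \<rho>)"
    using pot\<rho> by (simp add: is_potential_def)
  show "potential \<rho> x \<le> gap x" for x
    using potential_le[of x] by simp
qed

lemma isCont_gap: "isCont gap x"
  using pot\<nu> pot\<mu> by (intro continuous_intros isCont_convex) (auto simp: is_potential_def)

lemma k_bounds: "potential \<rho> x \<le> k x" "k x \<le> gap x"
  using envelope_ge[OF minorant] envelope_le by (auto simp: k_def)

lemma gap_tendsto:
  "(gap \<longlongrightarrow> 0) at_bot" "((\<lambda>x. gap x - (mass \<rho> * x - mean \<rho>)) \<longlongrightarrow> 0) at_top"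
proof -
  show "(gap \<longlongrightarrow> 0) at_bot"
    using tendsto_diff[of "potential \<nu>" 0 at_bot "potential \<mu>" 0] pot\<nu> pot\<mu> by (simp add: is_potential_def)
  show "((\<lambda>x. gap x - (mass \<rho> * x - mean \<rho>)) \<longlongrightarrow> 0) at_top"
    using tendsto_diff[of "\<lambda>x. potential \<nu> x - (mass \<nu> * x - mean \<nu>)" 0 at_top "\<lambda>x. potential \<mu> x - (mass \<mu>
        * x - mean \<mu>)" 0]
      pot\<nu> pot\<mu> by (simp add: is_potential_def mass_eq mean_eq algebra_simps)
qed

text \<open>The envelope is squeezed between the potential of \<open>\<rho>\<close> and the gap,
  which have the same asymptotes at both ends.\<close>

lemma potential_k: "is_potential k (mass \<rho>) (mean \<rho>)"
  unfolding is_potential_def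
proof (intro conjI)
  show "convex_on UNIV k"
    unfolding k_def by (rule envelope_convex)
  show "(k \<longlongrightarrow> 0) at_bot"
    by (rule tendsto_sandwich[OF _ _ _ gap_tendsto(1), of "potential \<rho>"])
      (use k_bounds pot\<rho> in \<open>auto simp: is_potential_def\<close>)
  show "((\<lambda>x. k x - (mass \<rho> * x - mean \<rho>)) \<longlongrightarrow> 0) at_top"
    by (rule tendsto_sandwich[OF _ _ _ gap_tendsto(2), of "\<lambda>x. potential \<rho> x - (mass \<rho> * x - mean \<rho>)"])
      (use k_bounds pot\<rho> in \<open>auto simp: is_potential_def intro!: diff_right_mono\<close>)
qed

lemma potential_minus_k: "is_potential (\<lambda>x. potential \<nu> x - k x) (mass \<mu>) (mean \<mu>)"
proof -
  have "convex_on UNIV (\<lambda>x. potential \<nu> x - k x)"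
    unfolding k_def using pot\<nu> pot\<mu>
    by (intro convex_minus_envelope[OF _ _ convex_minorant_axioms]) (auto simp: is_potential_def)
  from is_potential_diff[OF pot\<nu> potential_k this] show ?thesis
    by (simp add: mass_eq mean_eq)
qed

text \<open>Measures with potentials \<open>k\<close> and \<open>potential \<nu> x - k x\<close> add
  up to \<open>\<nu>\<close>, so the second is setwise below it. The complement in
  \<open>\<nu>\<close> of any competitor has a convex potential below the gap, hence below the
  envelope, which makes the competitor larger in convex order.\<close>

lemma shadow_ex:
  "\<exists>\<eta>\<in>finite_moment_measures. potential \<eta> = (\<lambda>x. potential \<nu> x - k x) \<and> is_shadow \<nu> \<mu> \<eta>"
proof -
  obtain \<kappa> where \<kappa>: "\<kappa> \<in> finite_moment_measures" "potential \<kappa> = k"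
    using ex_measure_with_potential[OF potential_k] by blast
  obtain \<eta> where \<eta>: "\<eta> \<in> finite_moment_measures" "potential \<eta> = (\<lambda>x. potential \<nu> x - k x)"
    using ex_measure_with_potential[OF potential_minus_k] by blast
  have mm: "mass \<eta> = mass \<mu>" "mean \<eta> = mean \<mu>"
    using mass_mean_of_potential[OF \<eta>(1), of "mass \<mu>" "mean \<mu>"] potential_minus_k \<eta>(2) by simp_all
  have "sum_measure \<nu> \<eta> \<kappa>"
    by (rule sum_measureI_potential[OF \<nu> \<eta>(1) \<kappa>(1)]) (simp add: \<kappa>(2) \<eta>(2))
  then have "setwise_le \<eta> \<nu>"
    using setwise_le_iff_sum_measure[OF \<nu>] by blast
  moreover have "convex_le \<mu> \<eta>"
    using k_bounds(2) by (intro convex_leI \<mu> \<eta>(1)) (auto simp: mm \<eta>(2) algebra_simps)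
  moreover have "convex_le \<eta> \<eta>'" if le: "convex_le \<mu> \<eta>'" and sub: "setwise_le \<eta>' \<nu>" for \<eta>'
  proof -
    obtain \<kappa>' where \<kappa>': "sum_measure \<nu> \<eta>' \<kappa>'"
      using sub setwise_le_iff_sum_measure[OF \<nu>] by blast
    have m': "\<kappa>' \<in> finite_moment_measures"
      using sum_measure_moment[OF sum_measure_commute[OF \<kappa>'] \<nu>] .
    have "potential \<kappa>' x \<le> k x" for x
      unfolding k_def
    proof (rule envelope_ge)
      show "convex_on UNIV (potential \<kappa>')"
        using is_potential_potential[OF m'] by (simp add: is_potential_def)
      show "potential \<kappa>' x \<le> gap x" for x
        using sum_measure_potential(1)[OF \<kappa>' \<nu>, of x] convex_leD(5)[OF le, of x] by simp
    qed
    then have "potential \<eta> x \<le> potential \<eta>' x" for x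
      using sum_measure_potential(1)[OF \<kappa>' \<nu>, of x] by (simp add: \<eta>(2) algebra_simps)
    then show ?thesis
      using convex_leD[OF le] by (intro convex_leI \<eta>(1)) (auto simp: mm)
  qed
  ultimately show ?thesis
    using \<eta> by (auto simp: is_shadow_def)
qed

lemma is_shadow_shadow: "is_shadow \<nu> \<mu> (shadow \<nu> \<mu>)"
  unfolding shadow_def
proof (rule theI')
  show "\<exists>!\<eta>. is_shadow \<nu> \<mu> \<eta>"
    using shadow_ex by (auto simp: is_shadow_def intro: convex_le_antisym)
qed

lemma shadow_moment: "shadow \<nu> \<mu> \<in> finite_moment_measures"
  using is_shadow_shadow by (auto simp: is_shadow_def dest: convex_leD)

lemma potential_shadow: "potential (shadow \<nu> \<mu>) = (\<lambda>x. potential \<nu> x - k x)"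
proof -
  obtain \<eta> where \<eta>: "potential \<eta> = (\<lambda>x. potential \<nu> x - k x)" "is_shadow \<nu> \<mu> \<eta>"
    using shadow_ex by blast
  have "shadow \<nu> \<mu> = \<eta>"
    using \<eta>(2) is_shadow_shadow by (auto simp: is_shadow_def intro: convex_le_antisym)
  with \<eta>(1) show ?thesis by simp
qed

lemma mass_shadow: "mass (shadow \<nu> \<mu>) = mass \<mu>" and mean_shadow: "mean (shadow \<nu> \<mu>) = mean \<mu>"
  using is_shadow_shadow convex_leD(3,4)[of \<mu> "shadow \<nu> \<mu>"] by (auto simp: is_shadow_def)

lemma shadow_le: "setwise_le (shadow \<nu> \<mu>) \<nu>"
  using is_shadow_shadow by (simp add: is_shadow_def)

end

lemma variation_add_le: "variation (\<lambda>x. f x + g x) x n \<le> variation f x n + variation g x n"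
  unfolding variation_def sum.distrib[symmetric] by (intro sum_mono) auto

lemma variation_uminus: "variation (\<lambda>x. - f x) x n = variation f x n"
  unfolding variation_def by (intro sum.cong) auto

lemma variation_diff_le: "variation (\<lambda>x. f x - g x) x n \<le> variation f x n + variation g x n"
  using variation_add_le[of f "\<lambda>x. - g x"] by (simp add: variation_uminus)

text \<open>Since the potential of the shadow is that of \<open>\<nu>\<close> minus an envelope, and envelopes contract the
  total variation, \<open>\<nu>\<close> enters twice and \<open>\<mu>\<close> once.\<close>

theorem W_shadow_le:
  assumes "shadow_data \<nu> \<mu> \<rho>" "shadow_data \<nu>' \<mu>' \<rho>'"
    and mass: "mass \<mu> = mass \<mu>'" "mass \<nu> = mass \<nu>'"
  shows "W (shadow \<nu> \<mu>) (shadow \<nu>' \<mu>') \<le> W \<mu> \<mu>' + 2 * W \<nu> \<nu>'"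
proof (cases "W \<mu> \<mu>' = \<top> \<or> W \<nu> \<nu>' = \<top>")
  case False
  interpret A: shadow_data \<nu> \<mu> \<rho> by fact
  interpret B: shadow_data \<nu>' \<mu>' \<rho>' by fact
  define a where "a = enn2real (W \<mu> \<mu>')"
  define b where "b = enn2real (W \<nu> \<nu>')"
  have ab: "W \<mu> \<mu>' = ennreal a" "W \<nu> \<nu>' = ennreal b" "0 \<le> a" "0 \<le> b"
    using False by (auto simp: a_def b_def less_top)
  have va: "variation (\<lambda>x. potential \<mu> x - potential \<mu>' x) x n \<le> a" if "chain x n" for x n
    using variation_le_W[OF A.\<mu> B.\<mu> that] ab by simp
  have vb: "variation (\<lambda>x. potential \<nu> x - potential \<nu>' x) x n \<le> b" if "chain x n" for x n
    using variation_le_W[OF A.\<nu> B.\<nu> that] ab by simp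
  have mr: "mass \<rho> = mass \<rho>'"
    using A.mass_eq B.mass_eq mass by simp
  have gaps: "variation (\<lambda>x. A.gap x - B.gap x) x n \<le> a + b" if "chain x n" for x n
  proof -
    have "(\<lambda>x. A.gap x - B.gap x) =
        (\<lambda>x. (potential \<nu> x - potential \<nu>' x) - (potential \<mu> x - potential \<mu>' x))"
      by auto
    then show ?thesis
      using variation_diff_le[of "\<lambda>x. potential \<nu> x - potential \<nu>' x" "\<lambda>x. potential \<mu> x - potential \<mu>' x" x
          n]
        va[OF that] vb[OF that] by simp
  qed
  have bot: "((\<lambda>x. (A.k x - B.k x) - (A.gap x - B.gap x)) \<longlongrightarrow> 0) at_bot"
  proof -
    have "((\<lambda>x. (A.k x - B.k x) - (A.gap x - B.gap x)) \<longlongrightarrow> (0 - 0) - (0 - 0)) at_bot"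
      using A.potential_k B.potential_k A.gap_tendsto B.gap_tendsto
      by (intro tendsto_diff) (auto simp: is_potential_def)
    then show ?thesis by simp
  qed
  have top: "((\<lambda>x. (A.k x - B.k x) - (A.gap x - B.gap x)) \<longlongrightarrow> 0) at_top"
  proof -
    \<comment> \<open>Gap and envelope have the same asymptote, so subtracting it from both changes
      nothing in total and makes each of the four terms tend to 0.\<close>
    have "((\<lambda>x. ((A.k x - (mass \<rho> * x - mean \<rho>)) - (B.k x - (mass \<rho>' * x - mean \<rho>'))) -
        ((A.gap x - (mass \<rho> * x - mean \<rho>)) - (B.gap x - (mass \<rho>' * x - mean \<rho>')))) \<longlongrightarrow> (0 - 0) - (0 - 0))
            at_top"
      using A.potential_k B.potential_k A.gap_tendsto B.gap_tendsto
      by (intro tendsto_diff) (auto simp: is_potential_def)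
    then show ?thesis by (simp add: algebra_simps)
  qed
  have "W (shadow \<nu> \<mu>) (shadow \<nu>' \<mu>') \<le> ennreal (a + 2 * b)"
  proof (rule W_le_variation[OF A.shadow_moment B.shadow_moment])
    show "mass (shadow \<nu> \<mu>) = mass (shadow \<nu>' \<mu>')"
      by (simp add: A.mass_shadow B.mass_shadow mass)
    fix x n assume x: "chain x n"
    have "variation (\<lambda>x. A.k x - B.k x) x n \<le> a + b"
      unfolding A.k_def B.k_def
      by (rule variation_envelope_diff_le[OF A.convex_minorant_axioms B.convex_minorant_axioms
            A.isCont_gap B.isCont_gap bot[unfolded A.k_def B.k_def] top[unfolded A.k_def B.k_def] gaps x])
    moreover have "(\<lambda>x. potential (shadow \<nu> \<mu>) x - potential (shadow \<nu>' \<mu>') x) =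
        (\<lambda>x. (potential \<nu> x - potential \<nu>' x) - (A.k x - B.k x))"
      by (auto simp: A.potential_shadow B.potential_shadow)
    ultimately show "variation (\<lambda>x. potential (shadow \<nu> \<mu>) x - potential (shadow \<nu>' \<mu>') x) x n \<le> a + 2 * b"
      using variation_diff_le[of "\<lambda>x. potential \<nu> x - potential \<nu>' x" "\<lambda>x. A.k x - B.k x" x n] vb[OF x] by
          simp
  qed
  also have "\<dots> = W \<mu> \<mu>' + 2 * W \<nu> \<nu>'"
    using ab by (simp add: ennreal_mult)
  finally show ?thesis .
qed (auto simp: ennreal_mult_eq_top_iff)

text \<open>Associativity of shadows: the difference of the two shadows is the shadow of
  \<open>\<mu>\<^sub>3\<close> in what \<open>shadow \<nu> \<mu>\<^sub>1\<close> leaves of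
  \<open>\<nu>\<close>. In potentials it is \<open>B.k\<close> minus the envelope of
  \<open>B.k - potential \<mu>\<^sub>3\<close>, which is convex by
  \<open>convex_minus_envelope\<close>.\<close>

lemma shadow_mono:
  assumes "shadow_data \<nu> \<mu>\<^sub>2 \<rho>" and \<mu>3: "sum_measure \<mu>\<^sub>2 \<mu>\<^sub>1 \<mu>\<^sub>3" and "shadow_data \<nu> \<mu>\<^sub>1 \<rho>'"
  shows "setwise_le (shadow \<nu> \<mu>\<^sub>1) (shadow \<nu> \<mu>\<^sub>2)"
proof -
  interpret A: shadow_data \<nu> \<mu>\<^sub>2 \<rho> by fact
  interpret B: shadow_data \<nu> \<mu>\<^sub>1 \<rho>' by fact
  have m3: "\<mu>\<^sub>3 \<in> finite_moment_measures"
    using sum_measure_moment[OF sum_measure_commute[OF \<mu>3] A.\<mu>] .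
  have conv3: "convex_on UNIV (potential \<mu>\<^sub>3)"
    using is_potential_potential[OF m3] by (simp add: is_potential_def)
  have convA: "convex_on UNIV A.k" and convB: "convex_on UNIV B.k"
    using A.potential_k B.potential_k by (auto simp: is_potential_def)
  have p: "potential \<mu>\<^sub>2 x = potential \<mu>\<^sub>1 x + potential \<mu>\<^sub>3 x" for x
    using sum_measure_potential(1)[OF \<mu>3 A.\<mu>] .
  have le: "A.k x \<le> B.k x - potential \<mu>\<^sub>3 x" for x
  proof -
    have "A.k x + potential \<mu>\<^sub>3 x \<le> B.k x"
      unfolding B.k_def
    proof (rule B.envelope_ge)
      show "convex_on UNIV (\<lambda>x. A.k x + potential \<mu>\<^sub>3 x)"
        by (intro convex_on_add convA conv3)
      show "A.k x + potential \<mu>\<^sub>3 x \<le> B.gap x" for x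
        using A.k_bounds(2)[of x] by (simp add: p)
    qed
    then show ?thesis by simp
  qed
  \<comment> \<open>Taking the envelope in two steps, first for \<open>\<mu>\<^sub>1\<close> and
    then for the remainder, gives the envelope for \<open>\<mu>\<^sub>2\<close>.\<close>
  have "convex_envelope (\<lambda>x. B.k x - potential \<mu>\<^sub>3 x) = A.k"
  proof (rule envelope_eqI[OF convA le])
    fix g x assume g: "convex_on UNIV g" "\<And>y. g y \<le> B.k y - potential \<mu>\<^sub>3 y"
    have "g y \<le> A.gap y" for y
      using g(2)[of y] B.k_bounds(2)[of y] by (simp add: p)
    then show "g x \<le> A.k x"
      unfolding A.k_def using g(1) by (intro A.envelope_ge)
  qed
  moreover have "convex_minorant (\<lambda>x. B.k x - potential \<mu>\<^sub>3 x) A.k"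
    using convA le by unfold_locales
  ultimately have conv: "convex_on UNIV (\<lambda>x. B.k x - A.k x)"
    using convex_minus_envelope[OF convB conv3] by simp
  obtain \<kappa> where \<kappa>: "\<kappa> \<in> finite_moment_measures" "potential \<kappa> = (\<lambda>x. B.k x - A.k x)"
    using ex_measure_with_potential[OF is_potential_diff[OF B.potential_k A.potential_k conv]] by blast
  have "sum_measure (shadow \<nu> \<mu>\<^sub>2) (shadow \<nu> \<mu>\<^sub>1) \<kappa>"
    by (rule sum_measureI_potential[OF A.shadow_moment B.shadow_moment \<kappa>(1)])
      (simp add: A.potential_shadow B.potential_shadow \<kappa>(2))
  then show ?thesis
    using setwise_le_iff_sum_measure[OF A.shadow_moment] by blast
qed

section \<open>Quantile functions\<close>

lemma finite_moment_probsD: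
  fixes M :: "'a::{banach, second_countable_topology} measure"
  assumes "M \<in> finite_moment_probs"
  shows "M \<in> finite_moment_measures" "prob_space M"
  using assms by (auto simp: finite_moment_probs_def)

lemma restrict_meas_simps:
  "sets (restrict_meas M A) = sets M" "space (restrict_meas M A) = space M"
  by (simp_all add: restrict_meas_def)

lemma emeasure_restrict_meas:
  assumes "A \<in> sets M" "B \<in> sets M"
  shows "emeasure (restrict_meas M A) B = emeasure M (A \<inter> B)"
  using assms by (simp add: restrict_meas_def emeasure_density flip: indicator_inter_arith)

lemma measurable_restrict_meas: "measurable (restrict_meas M A) N = measurable M N"
  by (intro measurable_cong_sets) (simp_all add: restrict_meas_simps)

text \<open>The left-continuous generalised inverse of the distribution function, with default value
  0 outside the open unit interval.\<close>

definition quantile :: "real measure \<Rightarrow> real \<Rightarrow> real" where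
  "quantile \<mu> u = (if u \<in> {0<..<1} then Inf {x. u \<le> cdf \<mu> x} else 0)"

text \<open>The mass of \<open>\<mu>\<close> at quantile levels between \<open>s\<close> and
  \<open>t\<close>. Levels are used instead of half lines so that atoms can be split at any
  height.\<close>

definition part :: "real measure \<Rightarrow> real \<Rightarrow> real \<Rightarrow> real measure" where
  "part \<mu> s t = distr (restrict_meas lborel {s<..<t}) borel (quantile \<mu>)"

lemma cdf_distributionI: "\<mu> \<in> finite_moment_probs \<Longrightarrow> cdf_distribution \<mu>"
  using finite_moment_probsD[of \<mu>] finite_momentD[of \<mu>]
  by (simp add: cdf_distribution_def real_distribution_def real_distribution_axioms_def)

lemma quantile_le_iff:
  assumes "\<mu> \<in> finite_moment_probs" "0 < u" "u < 1"
  shows "quantile \<mu> u \<le> x \<longleftrightarrow> u \<le> cdf \<mu> x"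
proof -
  interpret cdf_distribution \<mu> using cdf_distributionI[OF assms(1)] .
  show ?thesis
    using pseudoinverse[of u x] assms by (simp add: quantile_def)
qed

lemma measurable_quantile[measurable]:
  assumes "\<mu> \<in> finite_moment_probs"
  shows "quantile \<mu> \<in> borel_measurable borel"
proof -
  interpret cdf_distribution \<mu> using cdf_distributionI[OF assms] .
  have "(\<lambda>u. if u \<in> {0<..<1} then Inf {x. u \<le> cdf \<mu> x} else 0) \<in> borel_measurable borel"
  proof -
    have "{u. 0 < u \<and> u < 1} = {0<..<1::real}"
      by auto
    then show ?thesis
      by (subst measurable_If_restrict_space_iff) (use measurable_CI in auto)
  qed
  then show ?thesis
    by (simp add: quantile_def[abs_def])
qed

lemma sets_part: "sets (part \<mu> s t) = sets borel"
  by (simp add: part_def)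

lemma emeasure_part:
  assumes \<mu>: "\<mu> \<in> finite_moment_probs" and B: "B \<in> sets borel"
  shows "emeasure (part \<mu> s t) B = emeasure lborel ({s<..<t} \<inter> quantile \<mu> -` B)"
proof -
  note [measurable] = measurable_quantile[OF \<mu>]
  have "quantile \<mu> -` B \<in> sets borel"
    using measurable_sets[OF measurable_quantile[OF \<mu>] B] by simp
  then show ?thesis
    using B unfolding part_def
    by (subst emeasure_distr) (auto simp: measurable_restrict_meas restrict_meas_simps
        emeasure_restrict_meas)
qed

lemma sum_measure_part:
  assumes \<mu>: "\<mu> \<in> finite_moment_probs" and "r \<le> s" "s \<le> t"
  shows "sum_measure (part \<mu> r t) (part \<mu> r s) (part \<mu> s t)"
  unfolding sum_measure_def
proof (intro conjI ballI)
  fix B assume "B \<in> sets (part \<mu> r t)"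
  then have B: "B \<in> sets borel" by (simp add: sets_part)
  let ?Q = "quantile \<mu> -` B"
  have Q: "?Q \<in> sets borel"
    using measurable_sets[OF measurable_quantile[OF \<mu>] B] by simp
  have "emeasure lborel ({r<..<t} \<inter> ?Q) = emeasure lborel (({r<..<s} \<inter> ?Q) \<union> ({s<..<t} \<inter> ?Q))"
  proof (rule emeasure_eq_AE)
    show "AE x in lborel. x \<in> {r<..<t} \<inter> ?Q \<longleftrightarrow> x \<in> ({r<..<s} \<inter> ?Q) \<union> ({s<..<t} \<inter> ?Q)"
      using AE_lborel_singleton[of s] by eventually_elim (use assms in auto)
  qed (use Q in auto)
  also have "\<dots> = emeasure lborel ({r<..<s} \<inter> ?Q) + emeasure lborel ({s<..<t} \<inter> ?Q)"
    using Q by (intro plus_emeasure[symmetric]) auto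
  finally show "emeasure (part \<mu> r t) B = emeasure (part \<mu> r s) B + emeasure (part \<mu> s t) B"
    by (simp add: emeasure_part[OF \<mu> B])
qed (simp_all add: sets_part)

lemma emeasure_part_atMost:
  assumes \<mu>: "\<mu> \<in> finite_moment_probs" and t: "0 \<le> t" "t \<le> 1"
  shows "emeasure (part \<mu> 0 t) {..x} = ennreal (min t (cdf \<mu> x))"
proof -
  interpret cdf_distribution \<mu> using cdf_distributionI[OF \<mu>] .
  have "emeasure (part \<mu> 0 t) {..x} = emeasure lborel ({0<..<t} \<inter> quantile \<mu> -` {..x})"
    by (intro emeasure_part \<mu>) auto
  also have "{0<..<t} \<inter> quantile \<mu> -` {..x} = {0<..<t} \<inter> {..cdf \<mu> x}"
    using quantile_le_iff[OF \<mu>] t by auto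
  also have "emeasure lborel \<dots> = ennreal (min t (cdf \<mu> x))"
  proof (cases "cdf \<mu> x < t")
    case True
    then have "{0<..<t} \<inter> {..cdf \<mu> x} = {0<..cdf \<mu> x}"
      by auto
    then show ?thesis
      using True cdf_nonneg[of x] by (simp add: min_def)
  next
    case False
    then have "{0<..<t} \<inter> {..cdf \<mu> x} = {0<..<t}"
      by auto
    then show ?thesis
      using False t by (simp add: min_def)
  qed
  finally show ?thesis .
qed

lemma emeasure_part_UNIV:
  assumes "\<mu> \<in> finite_moment_probs" "s \<le> t"
  shows "emeasure (part \<mu> s t) UNIV = ennreal (t - s)"
  using assms by (simp add: emeasure_part)

lemma measure_eqI_atMost:
  fixes M N :: "real measure"
  assumes "sets M = sets borel" "sets N = sets borel" "finite_measure M" "finite_measure N"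
    and "\<And>x. emeasure M {..x} = emeasure N {..x}"
  shows "M = N"
  using assms by (intro cdf_unique')
    (auto simp: finite_borel_measure_def finite_borel_measure_axioms_def cdf_def measure_def)

lemma part_0_1:
  assumes \<mu>: "\<mu> \<in> finite_moment_probs"
  shows "part \<mu> 0 1 = \<mu>"
proof (rule measure_eqI_atMost)
  interpret cdf_distribution \<mu> using cdf_distributionI[OF \<mu>] .
  show "finite_measure \<mu>"
    using finite_momentD(1)[OF finite_moment_probsD(1)[OF \<mu>]] .
  show "finite_measure (part \<mu> 0 1)"
    using emeasure_part_UNIV[OF \<mu>, of 0 1] by (intro finite_measureI) (simp add: part_def)
  show "emeasure (part \<mu> 0 1) {..x} = emeasure \<mu> {..x}" for x
    using cdf_bounded_prob[of x] by (simp add: emeasure_part_atMost[OF \<mu>] cdf_def emeasure_eq_measure)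
qed (use \<mu> in \<open>auto simp: sets_part finite_moment_probs_def finite_moment_measures_def\<close>)

lemma part_moment:
  assumes \<mu>: "\<mu> \<in> finite_moment_probs" and "0 \<le> s" "s \<le> t" "t \<le> 1"
  shows "part \<mu> s t \<in> finite_moment_measures"
proof -
  have "part \<mu> 0 t \<in> finite_moment_measures"
    using sum_measure_moment[OF sum_measure_part[OF \<mu>, of 0 t 1]] assms finite_moment_probsD(1)[OF \<mu>]
    by (simp add: part_0_1)
  then show ?thesis
    using sum_measure_moment[OF sum_measure_commute[OF sum_measure_part[OF \<mu>, of 0 s t]]] assms by simp
qed

lemma mass_part: "\<mu> \<in> finite_moment_probs \<Longrightarrow> s \<le> t \<Longrightarrow> mass (part \<mu> s t) = t - s"
  by (simp add: mass_def measure_def emeasure_part_UNIV)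

text \<open>At a level attained by the distribution function no atom is split. This connects levels
  with the half lines in the definition of the coupling.\<close>

lemma part_eq_restrict:
  assumes \<mu>: "\<mu> \<in> finite_moment_probs"
  shows "part \<mu> 0 (cdf \<mu> x) = restrict_meas \<mu> {..x}"
proof (rule measure_eqI_atMost)
  interpret cdf_distribution \<mu> using cdf_distributionI[OF \<mu>] .
  note bounds = cdf_nonneg[of x] cdf_bounded_prob[of x]
  show "finite_measure (part \<mu> 0 (cdf \<mu> x))"
    using finite_momentD(1)[OF part_moment[OF \<mu>]] bounds by simp
  show "finite_measure (restrict_meas \<mu> {..x})"
    by (intro finite_measureI) (simp add: restrict_meas_simps emeasure_restrict_meas)
  have *: "min (cdf \<mu> x) (cdf \<mu> y) = cdf \<mu> (min x y)" for y
    by (rule min_of_mono) (intro monoI cdf_nondecreasing)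
  show "emeasure (part \<mu> 0 (cdf \<mu> x)) {..y} = emeasure (restrict_meas \<mu> {..x}) {..y}" for y
    using bounds
    by (simp add: emeasure_part_atMost[OF \<mu>] emeasure_restrict_meas *)
      (simp add: cdf_def emeasure_eq_measure)
qed (simp_all add: sets_part restrict_meas_simps finite_momentD(2)[OF finite_moment_probsD(1)[OF \<mu>]])

lemma has_integral_part:
  fixes f :: "real \<Rightarrow> real"
  assumes \<mu>: "\<mu> \<in> finite_moment_probs" and f: "f \<in> borel_measurable borel"
  shows "integrable (part \<mu> s t) f \<longleftrightarrow> set_integrable lborel {s<..<t} (\<lambda>u. f (quantile \<mu> u))"
    and "(\<integral>x. f x \<partial>part \<mu> s t) = (LINT u:{s<..<t}|lborel. f (quantile \<mu> u))"
proof -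
  note [measurable] = measurable_quantile[OF \<mu>] f
  have Q: "quantile \<mu> \<in> borel_measurable (restrict_meas lborel {s<..<t})"
    unfolding measurable_restrict_meas by measurable
  have r: "restrict_meas lborel {s<..<t} = density lborel (\<lambda>x. ennreal (indicator {s<..<t} x))"
    by (simp add: restrict_meas_def ennreal_indicator)
  show "integrable (part \<mu> s t) f \<longleftrightarrow> set_integrable lborel {s<..<t} (\<lambda>u. f (quantile \<mu> u))"
    unfolding part_def set_integrable_def integrable_distr_eq[OF Q f] unfolding r
    by (subst integrable_density) auto
  show "(\<integral>x. f x \<partial>part \<mu> s t) = (LINT u:{s<..<t}|lborel. f (quantile \<mu> u))"
    unfolding part_def set_lebesgue_integral_def integral_distr[OF Q f] unfolding r
    by (subst integral_density) auto
qed

section \<open>The distance of quantile functions\<close>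

text \<open>The optimal test function has slope \<open>1\<close> where the first distribution function is the smaller
  one, that is on the set \<open>A\<close> below, and slope \<open>-1\<close> elsewhere.\<close>

lemma ex_lipschitz_quantile_diff:
  assumes \<mu>: "\<mu> \<in> finite_moment_probs" and \<nu>: "\<nu> \<in> finite_moment_probs"
  shows "\<exists>f. 1-lipschitz_on UNIV f \<and> (\<forall>u\<in>{0<..<1}. \<bar>quantile \<mu> u - quantile \<nu> u\<bar> = f (quantile \<mu> u) - f
      (quantile \<nu> u))"
proof -
  interpret M: cdf_distribution \<mu> using cdf_distributionI[OF \<mu>] .
  interpret N: cdf_distribution \<nu> using cdf_distributionI[OF \<nu>] .
  define A where "A = {x. cdf \<mu> x < cdf \<nu> x}"
  have A[measurable]: "A \<in> sets borel"
    unfolding A_def by measurable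
  \<comment> \<open>The signed measure of \<open>A\<close> between 0 and \<open>y\<close>, so that
    increments of \<open>m\<close> are measures of \<open>A\<close> in intervals.\<close>
  define m where "m = (\<lambda>y. if 0 \<le> y then measure lborel (A \<inter> {0<..y}) else - measure lborel (A \<inter> {y<..0}))"
  have fm: "A \<inter> {a<..b} \<in> fmeasurable lborel" for a b
    by (rule fmeasurableI2[of "{a..b}"]) (auto intro!: fmeasurableI simp: emeasure_lborel_Icc_eq)
  have add: "measure lborel (A \<inter> {a<..b}) + measure lborel (A \<inter> {b<..c}) = measure lborel (A \<inter> {a<..c})"
    if "a \<le> b" "b \<le> c" for a b c
  proof -
    have "A \<inter> {a<..c} = (A \<inter> {a<..b}) \<union> (A \<inter> {b<..c})" "(A \<inter> {a<..b}) \<inter> (A \<inter> {b<..c}) = {}"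
      using that by auto
    then show ?thesis
      using measure_Un3[OF fm[of a b] fm[of b c]] by simp
  qed
  have m: "m b - m a = measure lborel (A \<inter> {a<..b})" if "a \<le> b" for a b
    using add[of a 0 b] add[of 0 a b] add[of a b 0] that by (auto simp: m_def)
  have mb: "measure lborel (A \<inter> {a<..b}) \<le> b - a" if "a \<le> b" for a b
    using measure_mono_fmeasurable[of "A \<inter> {a<..b}" "{a..b}" lborel] that
    by (force intro!: fmeasurableI simp: emeasure_lborel_Icc_eq)
  define f where "f = (\<lambda>y. 2 * m y - y)"
  have "1-lipschitz_on UNIV f"
  proof (rule lipschitz_onI)
    fix x y :: real
    have *: "\<bar>f b - f a\<bar> \<le> b - a" if "a \<le> b" for a b
      using m[OF that] mb[OF that] measure_nonneg[of lborel "A \<inter> {a<..b}"]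
      unfolding f_def by linarith
    show "dist (f x) (f y) \<le> 1 * dist x y"
      using *[of x y] *[of y x] by (cases "x \<le> y") (auto simp: dist_real_def abs_minus_commute)
  qed simp
  moreover have "\<bar>quantile \<mu> u - quantile \<nu> u\<bar> = f (quantile \<mu> u) - f (quantile \<nu> u)" if u: "u \<in> {0<..<1}"
      for u
  proof -
    define p where "p = quantile \<mu> u"
    define q where "q = quantile \<nu> u"
    have p: "p \<le> x \<longleftrightarrow> u \<le> cdf \<mu> x" and q: "q \<le> x \<longleftrightarrow> u \<le> cdf \<nu> x" for x
      using quantile_le_iff[OF \<mu>, of u x] quantile_le_iff[OF \<nu>, of u x] u by (auto simp: p_def q_def)
    consider "p = q" | "p < q" | "q < p" by linarith
    then have "\<bar>p - q\<bar> = f p - f q"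
    proof cases
      case 2
      \<comment> \<open>Strictly between \<open>p\<close> and \<open>q\<close> the second
        distribution function is below \<open>u\<close> and the first is not. Only the end point
        \<open>q\<close> may lie in \<open>A\<close>, and it is null.\<close>
      have "A \<inter> {p<..q} \<subseteq> {q}"
      proof
        fix x assume x: "x \<in> A \<inter> {p<..q}"
        then have "u \<le> cdf \<mu> x" using p[of x] by auto
        then have "u \<le> cdf \<nu> x" using x by (auto simp: A_def)
        then show "x \<in> {q}" using q[of x] x by auto
      qed
      then have "emeasure lborel (A \<inter> {p<..q}) \<le> emeasure lborel {q}"
        by (intro emeasure_mono) auto
      then have "measure lborel (A \<inter> {p<..q}) = 0"
        by (simp add: measure_def)
      with 2 m[of p q] show ?thesis by (simp add: f_def)
    next
      case 3
      have "{q<..<p} \<subseteq> A \<inter> {q<..p}"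
      proof
        fix x assume x: "x \<in> {q<..<p}"
        then have "u \<le> cdf \<nu> x" "\<not> u \<le> cdf \<mu> x"
          using p[of x] q[of x] by auto
        then show "x \<in> A \<inter> {q<..p}"
          using x by (auto simp: A_def)
      qed
      then have "measure lborel {q<..<p} \<le> measure lborel (A \<inter> {q<..p})"
        by (intro measure_mono_fmeasurable fm) auto
      with 3 m[of q p] mb[of q p] show ?thesis by (simp add: f_def)
    qed simp
    then show ?thesis by (simp add: p_def q_def)
  qed
  ultimately show ?thesis by blast
qed

lemma W_ge_lipschitz: "1-lipschitz_on UNIV f \<Longrightarrow> ennreal \<bar>(\<integral>x. f x \<partial>\<mu>) - (\<integral>x. f x \<partial>\<nu>)\<bar> \<le> W \<mu> \<nu>"
  unfolding W_def by (intro SUP_upper) auto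

lemma lipschitz_borel_measurable: "L-lipschitz_on UNIV (f :: real \<Rightarrow> real) \<Longrightarrow> f \<in> borel_measurable borel"
  by (intro borel_measurable_continuous_onI lipschitz_on_continuous_on)

lemma set_integrable_lipschitz_quantile:
  fixes f :: "real \<Rightarrow> real"
  assumes \<mu>: "\<mu> \<in> finite_moment_probs" and f: "L-lipschitz_on UNIV f" and s: "0 \<le> s" "s \<le> 1"
  shows "set_integrable lborel {0<..<s} (\<lambda>u. f (quantile \<mu> u))"
  using has_integral_part(1)[OF \<mu> lipschitz_borel_measurable[OF f], of 0 s]
    integrable_lipschitz[OF part_moment[OF \<mu>] f, of 0 s] s by simp

lemma quantile_distance:
  assumes \<mu>: "\<mu> \<in> finite_moment_probs" and \<nu>: "\<nu> \<in> finite_moment_probs"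
  shows "set_integrable lborel {0<..<1} (\<lambda>u. \<bar>quantile \<mu> u - quantile \<nu> u\<bar>)"
    and "ennreal (LINT u:{0<..<1}|lborel. \<bar>quantile \<mu> u - quantile \<nu> u\<bar>) \<le> W \<mu> \<nu>"
proof -
  obtain f where f: "1-lipschitz_on UNIV f"
    and eq: "\<And>u. u \<in> {0<..<1} \<Longrightarrow> \<bar>quantile \<mu> u - quantile \<nu> u\<bar> = f (quantile \<mu> u) - f (quantile \<nu> u)"
    using ex_lipschitz_quantile_diff[OF \<mu> \<nu>] by blast
  note int = set_integrable_lipschitz_quantile[OF \<mu> f, of 1] set_integrable_lipschitz_quantile[OF \<nu> f, of 1]
  have "set_integrable lborel {0<..<1} (\<lambda>u. f (quantile \<mu> u) - f (quantile \<nu> u))"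
    using int by (intro set_integral_diff) auto
  then show "set_integrable lborel {0<..<1} (\<lambda>u. \<bar>quantile \<mu> u - quantile \<nu> u\<bar>)"
    by (subst set_integrable_cong[OF refl refl eq]) auto
  have "(LINT u:{0<..<1}|lborel. \<bar>quantile \<mu> u - quantile \<nu> u\<bar>)
      = (LINT u:{0<..<1}|lborel. f (quantile \<mu> u) - f (quantile \<nu> u))"
    by (intro set_lebesgue_integral_cong) (use eq in auto)
  also have "\<dots> = (\<integral>x. f x \<partial>\<mu>) - (\<integral>x. f x \<partial>\<nu>)"
    using int has_integral_part(2)[OF \<mu> lipschitz_borel_measurable[OF f], of 0 1]
      has_integral_part(2)[OF \<nu> lipschitz_borel_measurable[OF f], of 0 1]
    by (subst set_integral_diff) (auto simp: part_0_1 \<mu> \<nu>)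
  finally have "ennreal (LINT u:{0<..<1}|lborel. \<bar>quantile \<mu> u - quantile \<nu> u\<bar>)
      \<le> ennreal \<bar>(\<integral>x. f x \<partial>\<mu>) - (\<integral>x. f x \<partial>\<nu>)\<bar>"
    by (simp add: ennreal_leI)
  also have "\<dots> \<le> W \<mu> \<nu>"
    by (rule W_ge_lipschitz[OF f])
  finally show "ennreal (LINT u:{0<..<1}|lborel. \<bar>quantile \<mu> u - quantile \<nu> u\<bar>) \<le> W \<mu> \<nu>" .
qed

text \<open>The quantile functions couple the two parts level by level; the cost over the levels
  below \<open>s\<close> is at most the cost over all levels, which \<open>quantile_distance\<close>
  bounds.\<close>

lemma W_part_le:
  assumes \<mu>: "\<mu> \<in> finite_moment_probs" and \<nu>: "\<nu> \<in> finite_moment_probs" and s: "0 \<le> s" "s \<le> 1"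
  shows "W (part \<mu> 0 s) (part \<nu> 0 s) \<le> W \<mu> \<nu>"
  unfolding W_def[of "part \<mu> 0 s"]
proof (rule SUP_least)
  fix f :: "real \<Rightarrow> real" assume "f \<in> {f. 1-lipschitz_on UNIV f}"
  then have f: "1-lipschitz_on UNIV f" by simp
  let ?d = "\<lambda>u. \<bar>quantile \<mu> u - quantile \<nu> u\<bar>"
  note int = set_integrable_lipschitz_quantile[OF \<mu> f s] set_integrable_lipschitz_quantile[OF \<nu> f s]
  have d: "set_integrable lborel {0<..<s} ?d"
    by (rule set_integrable_subset[OF quantile_distance(1)[OF \<mu> \<nu>]]) (use s in auto)
  have "\<bar>(\<integral>x. f x \<partial>part \<mu> 0 s) - (\<integral>x. f x \<partial>part \<nu> 0 s)\<bar>
      = \<bar>LINT u:{0<..<s}|lborel. f (quantile \<mu> u) - f (quantile \<nu> u)\<bar>"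
    using int by (simp add: has_integral_part(2)[OF \<mu> lipschitz_borel_measurable[OF f]]
        has_integral_part(2)[OF \<nu> lipschitz_borel_measurable[OF f]] set_integral_diff)
  also have "\<dots> \<le> (LINT u:{0<..<s}|lborel. \<bar>f (quantile \<mu> u) - f (quantile \<nu> u)\<bar>)"
    using set_integral_norm_bound[OF set_integral_diff(1)[OF int]] by simp
  also have "\<dots> \<le> (LINT u:{0<..<s}|lborel. ?d u)"
    using lipschitz_onD[OF f]
    by (intro set_integral_mono set_integrable_abs[OF set_integral_diff(1)[OF int]] d) (auto simp:
        dist_real_def)
  also have "\<dots> \<le> (LINT u:{0<..<1}|lborel. ?d u)"
    unfolding set_lebesgue_integral_def
    using d quantile_distance(1)[OF \<mu> \<nu>] s
    by (intro integral_mono) (auto simp: set_integrable_def indicator_def)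
  finally have "ennreal \<bar>(\<integral>x. f x \<partial>part \<mu> 0 s) - (\<integral>x. f x \<partial>part \<nu> 0 s)\<bar> \<le> ennreal (LINT u:{0<..<1}|lborel.
      ?d u)"
    by (rule ennreal_leI)
  also have "\<dots> \<le> W \<mu> \<nu>"
    by (rule quantile_distance(2)[OF \<mu> \<nu>])
  finally show "ennreal \<bar>(\<integral>x. f x \<partial>part \<mu> 0 s) - (\<integral>x. f x \<partial>part \<nu> 0 s)\<bar> \<le> W \<mu> \<nu>" .
qed

section \<open>Increasing families of measures as joint laws\<close>

text \<open>Tested on the set where \<open>f\<close> exceeds \<open>g\<close>, the hypothesis makes
  the excess integrate to 0; the finite integral of \<open>g\<close> permits the
  cancellation.\<close>

lemma AE_le_of_density_le:
  fixes f g :: "'a \<Rightarrow> ennreal"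
  assumes [measurable]: "f \<in> borel_measurable M" "g \<in> borel_measurable M"
    and fin: "(\<integral>\<^sup>+x. g x \<partial>M) \<noteq> \<infinity>"
    and le: "\<And>A. A \<in> sets M \<Longrightarrow> emeasure (density M f) A \<le> emeasure (density M g) A"
  shows "AE x in M. f x \<le> g x"
proof -
  define A where "A = {x \<in> space M. g x < f x}"
  have [measurable]: "A \<in> sets M" by (simp add: A_def)
  have "(\<integral>\<^sup>+x. g x * indicator A x \<partial>M) + (\<integral>\<^sup>+x. (f x - g x) * indicator A x \<partial>M)
      = (\<integral>\<^sup>+x. g x * indicator A x + (f x - g x) * indicator A x \<partial>M)"
    by (intro nn_integral_add[symmetric]) auto
  also have "\<dots> = (\<integral>\<^sup>+x. f x * indicator A x \<partial>M)"
    by (intro nn_integral_cong) (auto simp: A_def indicator_def add_diff_inverse_ennreal)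
  also have "\<dots> \<le> (\<integral>\<^sup>+x. g x * indicator A x \<partial>M)"
    using le[of A] by (simp add: emeasure_density)
  finally have *: "(\<integral>\<^sup>+x. g x * indicator A x \<partial>M) + (\<integral>\<^sup>+x. (f x - g x) * indicator A x \<partial>M)
      \<le> (\<integral>\<^sup>+x. g x * indicator A x \<partial>M) + 0" by simp
  have "(\<integral>\<^sup>+x. g x * indicator A x \<partial>M) \<le> (\<integral>\<^sup>+x. g x \<partial>M)"
    by (intro nn_integral_mono) (auto simp: indicator_def)
  then have "(\<integral>\<^sup>+x. g x * indicator A x \<partial>M) \<noteq> \<top>"
    using fin by (auto simp: top_unique)
  with * have "(\<integral>\<^sup>+x. (f x - g x) * indicator A x \<partial>M) = 0"
    by (simp add: ennreal_add_left_cancel_le)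
  then have "AE x in M. (f x - g x) * indicator A x = 0"
    by (subst (asm) nn_integral_0_iff_AE) auto
  with AE_space show ?thesis
  proof eventually_elim
    case (elim x)
    show ?case
    proof (rule ccontr)
      assume "\<not> f x \<le> g x"
      with elim have "f x - g x = 0"
        by (auto simp: A_def)
      with \<open>\<not> f x \<le> g x\<close> show False
        by (simp add: diff_eq_0_iff_ennreal)
    qed
  qed
qed

text \<open>An abstract form of the shadows of growing parts of \<mu>: these properties suffice to
  realise the family by restrictions of one law on the plane.\<close>

locale increasing_family = prob_space \<nu> for \<nu> :: "real measure" +
  fixes \<eta> :: "real \<Rightarrow> real measure"
  assumes sets_\<nu>: "sets \<nu> = sets borel"
    and mass_\<eta>: "\<And>s. s \<in> {0..1} \<Longrightarrow> emeasure (\<eta> s) UNIV = ennreal s"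
    and mono_\<eta>: "\<And>s t. s \<in> {0..1} \<Longrightarrow> t \<in> {0..1} \<Longrightarrow> s \<le> t \<Longrightarrow> setwise_le (\<eta> s) (\<eta> t)"
    and last_\<eta>: "\<eta> 1 = \<nu>"
begin

lemma sets_\<eta>: "s \<in> {0..1} \<Longrightarrow> sets (\<eta> s) = sets borel"
  using mono_\<eta>[of s 1] by (simp add: setwise_le_def last_\<eta> sets_\<nu>)

lemma space_\<nu>: "space \<nu> = UNIV"
  using sets_eq_imp_space_eq[OF sets_\<nu>] by simp

lemma finite_\<eta>: "s \<in> {0..1} \<Longrightarrow> finite_measure (\<eta> s)"
  using mass_\<eta>[of s] sets_eq_imp_space_eq[OF sets_\<eta>] by (intro finite_measureI) auto

lemma mono_\<eta>D: "s \<in> {0..1} \<Longrightarrow> t \<in> {0..1} \<Longrightarrow> s \<le> t \<Longrightarrow> B \<in> sets borel \<Longrightarrow> emeasure (\<eta> s) B \<le> emeasure (\<eta> t) B"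
  using mono_\<eta>[of s t] sets_\<eta>[of t] by (auto simp: setwise_le_def)

text \<open>The complement of \<open>B\<close> gains mass as well, so \<open>B\<close> gains at most
  the total gain \<open>t - s\<close>. This continuity in the level lets rational levels determine
  all others.\<close>

lemma measure_\<eta>_diff:
  assumes "s \<in> {0..1}" "t \<in> {0..1}" "s \<le> t" "B \<in> sets borel"
  shows "measure (\<eta> s) B \<le> measure (\<eta> t) B" "measure (\<eta> t) B \<le> measure (\<eta> s) B + (t - s)"
proof -
  interpret s: finite_measure "\<eta> s" by (rule finite_\<eta>[OF assms(1)])
  interpret t: finite_measure "\<eta> t" by (rule finite_\<eta>[OF assms(2)])
  have le: "measure (\<eta> s) C \<le> measure (\<eta> t) C" if "C \<in> sets borel" for C
    using mono_\<eta>D[OF assms(1-3) that] by (simp add: s.emeasure_eq_measure t.emeasure_eq_measure)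
  show "measure (\<eta> s) B \<le> measure (\<eta> t) B"
    using le[OF assms(4)] .
  have split: "measure (\<eta> r) UNIV = measure (\<eta> r) B + measure (\<eta> r) (- B)" if "r \<in> {0..1}" for r
  proof -
    interpret finite_measure "\<eta> r" by (rule finite_\<eta>[OF that])
    have "measure (\<eta> r) (B \<union> - B) = measure (\<eta> r) B + measure (\<eta> r) (- B)"
      using sets_\<eta>[OF that] assms(4) by (intro finite_measure_Union) auto
    then show ?thesis by simp
  qed
  have m: "measure (\<eta> r) UNIV = r" if "r \<in> {0..1}" for r
    using mass_\<eta>[OF that] that by (simp add: measure_def)
  show "measure (\<eta> t) B \<le> measure (\<eta> s) B + (t - s)"
    using split[OF assms(1)] split[OF assms(2)] m[OF assms(1)] m[OF assms(2)] le[of "- B"] assms(4) by simp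
qed

text \<open>Countable, so that almost sure statements can be combined, and dense, so that the other
  levels can be approximated.\<close>

definition levels :: "real set" where
  "levels = \<rat> \<inter> {0..1}"

lemma levels: "countable levels" "s \<in> levels \<Longrightarrow> s \<in> {0..1}" "0 \<in> levels" "1 \<in> levels"
  by (auto simp: levels_def countable_rat)

text \<open>Radon-Nikodym derivatives are ordered only almost everywhere, with a null set for each
  pair of levels. Countably many levels leave a single null set, on which the densities can be
  redefined.\<close>

lemma ex_densities:
  "\<exists>h. (\<forall>s\<in>levels. h s \<in> borel_measurable borel \<and> density \<nu> (h s) = \<eta> s) \<and>
    (\<forall>s\<in>levels. \<forall>y. h s y \<le> 1) \<and> (\<forall>s\<in>levels. \<forall>t\<in>levels. s \<le> t \<longrightarrow> (\<forall>y. h s y \<le> h t y))"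
proof -
  have meas: "borel_measurable \<nu> = borel_measurable borel"
    using sets_\<nu> by (auto intro!: measurable_cong_sets)
  define f where "f = (\<lambda>s. RN_deriv \<nu> (\<eta> s))"
  have fm[measurable]: "f s \<in> borel_measurable borel" for s
    unfolding f_def meas[symmetric] by simp
  have fd: "density \<nu> (f s) = \<eta> s" if "s \<in> levels" for s
    unfolding f_def
  proof (rule density_RN_deriv)
    have s: "s \<in> {0..1}" using levels that by auto
    show "sets (\<eta> s) = sets \<nu>" using sets_\<eta>[OF s] sets_\<nu> by simp
    show "absolutely_continuous \<nu> (\<eta> s)"
      unfolding absolutely_continuous_def
    proof
      fix A assume "A \<in> null_sets \<nu>"
      then show "A \<in> null_sets (\<eta> s)"
        using mono_\<eta>D[OF s, of 1 A] s sets_\<eta>[OF s] sets_\<nu> by (auto simp: null_sets_def last_\<eta>)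
    qed
  qed
  define ok where "ok = {y. (\<forall>s\<in>levels. f s y \<le> 1) \<and> (\<forall>s\<in>levels. \<forall>t\<in>levels. s \<le> t \<longrightarrow> f s y \<le> f t y)}"
  have ok[measurable]: "ok \<in> sets borel"
  proof -
    have ball: "Measurable.pred borel (\<lambda>y. \<forall>s\<in>levels. Q s y)" if "\<And>s. Measurable.pred borel (Q s)"
      for Q :: "real \<Rightarrow> real \<Rightarrow> bool"
      using that by (intro measurable_pred_countable(1)[OF levels(1)]) auto
    have "Measurable.pred borel (\<lambda>y. \<forall>s\<in>levels. f s y \<le> 1)"
      by (rule ball) measurable
    moreover have "Measurable.pred borel (\<lambda>y. \<forall>s\<in>levels. \<forall>t\<in>levels. s \<le> t \<longrightarrow> f s y \<le> f t y)"
      by (rule ball, rule ball) measurable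
    ultimately have "Measurable.pred borel (\<lambda>y. (\<forall>s\<in>levels. f s y \<le> 1) \<and>
        (\<forall>s\<in>levels. \<forall>t\<in>levels. s \<le> t \<longrightarrow> f s y \<le> f t y))"
      by (rule pred_intros_logic)
    then show ?thesis
      by (simp add: ok_def pred_def)
  qed
  have "AE y in \<nu>. f s y \<le> 1" if "s \<in> levels" for s
  proof (rule AE_le_of_density_le)
    fix A assume "A \<in> sets \<nu>"
    moreover have "density \<nu> (\<lambda>_. 1) = \<nu>"
      by (rule measure_eqI) (auto simp: emeasure_density)
    ultimately show "emeasure (density \<nu> (f s)) A \<le> emeasure (density \<nu> (\<lambda>_. 1)) A"
      using mono_\<eta>D[of s 1 A] levels(2)[OF that] by (simp add: fd[OF that] last_\<eta> sets_\<nu>)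
  qed (auto simp: meas)
  moreover have "AE y in \<nu>. f s y \<le> f t y" if "s \<in> levels" "t \<in> levels" "s \<le> t" for s t
  proof (rule AE_le_of_density_le)
    have "(\<integral>\<^sup>+x. f t x \<partial>\<nu>) = emeasure (density \<nu> (f t)) UNIV"
      by (subst emeasure_density) (auto simp: meas sets_\<nu>)
    then show "(\<integral>\<^sup>+x. f t x \<partial>\<nu>) \<noteq> \<infinity>"
      using mass_\<eta>[OF levels(2)[OF that(2)]] by (simp add: fd[OF that(2)])
  next
    fix A assume "A \<in> sets \<nu>"
    then show "emeasure (density \<nu> (f s)) A \<le> emeasure (density \<nu> (f t)) A"
      using mono_\<eta>D[of s t A] levels(2) that by (simp add: fd sets_\<nu>)
  qed (auto simp: meas)
  ultimately have "AE y in \<nu>. y \<in> ok"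
    unfolding ok_def mem_Collect_eq
    by (intro AE_conjI AE_ball_countable[THEN iffD2] levels(1) ballI) (auto simp: AE_ball_countable
        levels(1))
  \<comment> \<open>On the exceptional null set the constants \<open>s\<close> serve, being ordered
    and at most 1.\<close>
  define h where "h = (\<lambda>s y. if y \<in> ok then f s y else ennreal s)"
  have hm: "h s \<in> borel_measurable borel" for s
    unfolding h_def by measurable
  have "density \<nu> (h s) = \<eta> s" if "s \<in> levels" for s
  proof -
    have "density \<nu> (h s) = density \<nu> (f s)"
      by (rule density_cong) (use \<open>AE y in \<nu>. y \<in> ok\<close> hm in \<open>auto simp: meas h_def\<close>)
    then show ?thesis by (simp add: fd[OF that])
  qed
  moreover have "h s y \<le> 1" if "s \<in> levels" for s y
    using that levels(2)[OF that] by (auto simp: h_def ok_def)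
  moreover have "h s y \<le> h t y" if "s \<in> levels" "t \<in> levels" "s \<le> t" for s t y
    using that by (auto simp: h_def ok_def intro: ennreal_leI)
  ultimately show ?thesis
    using hm by (intro exI[of _ h]) auto
qed

text \<open>The first coordinate is \<open>T(y, w) = inf {s. w \<le> h\<^sub>s(y)}\<close> for rational \<open>s\<close>, where \<open>h\<^sub>s\<close> is the density
  of \<open>\<eta> s\<close> with respect to \<open>\<nu>\<close> and \<open>w\<close> is uniformly distributed and independent of \<open>y\<close>.\<close>

lemma ex_joint_law:
  "\<exists>\<theta> :: (real \<times> real) measure. sets \<theta> = sets borel \<and> prob_space \<theta> \<and>
    (\<forall>c\<in>{0..1}. \<forall>B\<in>sets borel. emeasure \<theta> ({..c} \<times> B) = emeasure (\<eta> c) B)"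
proof -
  obtain h where hm: "\<And>s. s \<in> levels \<Longrightarrow> h s \<in> borel_measurable borel"
    and hd: "\<And>s. s \<in> levels \<Longrightarrow> density \<nu> (h s) = \<eta> s"
    and h1: "\<And>s y. s \<in> levels \<Longrightarrow> h s y \<le> (1::ennreal)"
    and hmono: "\<And>s t y. s \<in> levels \<Longrightarrow> t \<in> levels \<Longrightarrow> s \<le> t \<Longrightarrow> h s y \<le> h t y"
    using ex_densities by blast
  define U :: "real measure" where "U = restrict_meas lborel {0<..<1}"
  have U: "sets U = sets borel" "space U = UNIV"
    by (simp_all add: U_def restrict_meas_simps)
  interpret U: prob_space U
    by (rule prob_spaceI) (simp add: U_def restrict_meas_simps emeasure_restrict_meas)
  interpret P: pair_prob_space \<nu> U ..
  let ?\<Omega> = "\<nu> \<Otimes>\<^sub>M U"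
  have sets\<Omega>: "sets ?\<Omega> = sets (borel \<Otimes>\<^sub>M borel)"
    by (intro sets_pair_measure_cong sets_\<nu> U)
  have space\<Omega>: "space ?\<Omega> = UNIV"
    by (simp add: space_pair_measure space_\<nu> U)
  \<comment> \<open>The region over \<open>B\<close> below the graph of \<open>h s\<close>; by
    Fubini its measure is that of \<open>B\<close> under \<open>\<eta> s\<close>.\<close>
  define E where "E = (\<lambda>s B. {p::real \<times> real. fst p \<in> B \<and> ennreal (snd p) \<le> h s (fst p)})"
  have E_sets: "E s B \<in> sets ?\<Omega>" if "s \<in> levels" "B \<in> sets borel" for s B
  proof -
    note [measurable] = hm[OF that(1)] that(2)
    have "{p \<in> space (borel \<Otimes>\<^sub>M borel). fst p \<in> B \<and> ennreal (snd p) \<le> h s (fst p)} \<in> sets (borel \<Otimes>\<^sub>M borel)"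
      by measurable
    then show ?thesis
      by (simp add: E_def sets\<Omega> space_pair_measure)
  qed
  have E: "emeasure ?\<Omega> (E s B) = emeasure (\<eta> s) B" if s: "s \<in> levels" and B: "B \<in> sets borel" for s B
  proof -
    have "emeasure ?\<Omega> (E s B) = (\<integral>\<^sup>+y. emeasure U (Pair y -` E s B) \<partial>\<nu>)"
      by (rule U.emeasure_pair_measure_alt[OF E_sets[OF that]])
    also have "\<dots> = (\<integral>\<^sup>+y. h s y * indicator B y \<partial>\<nu>)"
    proof (rule nn_integral_cong)
      fix y
      obtain r where r: "0 \<le> r" "r \<le> 1" "h s y = ennreal r"
        using h1[OF s, of y] by (cases "h s y") (auto simp: top_unique)
      show "emeasure U (Pair y -` E s B) = h s y * indicator B y"
      proof (cases "y \<in> B")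
        case True
        have "emeasure U {w. ennreal w \<le> ennreal r} = emeasure U {..r}"
          using r by (intro arg_cong[where f = "emeasure U"]) (auto simp: ennreal_le_iff)
        also have "\<dots> = emeasure lborel ({0<..<1} \<inter> {..r})"
          by (simp add: U_def emeasure_restrict_meas)
        also have "\<dots> = emeasure lborel {0<..r}"
        proof (rule emeasure_eq_AE)
          show "AE x in lborel. x \<in> {0<..<1} \<inter> {..r} \<longleftrightarrow> x \<in> {0<..r}"
            using AE_lborel_singleton[of 1] by eventually_elim (use r in auto)
        qed auto
        finally show ?thesis
          using True r by (simp add: E_def)
      qed (simp add: E_def)
    qed
    also have "\<dots> = emeasure (density \<nu> (h s)) B"
      using hm[OF s] B by (subst emeasure_density) (auto simp: sets_\<nu> cong: measurable_cong_sets)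
    finally show ?thesis by (simp add: hd[OF s])
  qed
  \<comment> \<open>Inserting 1 keeps the set non-empty for every \<open>p\<close>, so that
    \<open>Inf\<close> is meaningful.\<close>
  define X where "X = (\<lambda>p::real \<times> real. insert 1 {s \<in> levels. ennreal (snd p) \<le> h s (fst p)})"
  define T where "T = (\<lambda>p. Inf (X p))"
  have X: "X p \<noteq> {}" "bdd_below (X p)" for p
    using levels(2) by (auto simp: X_def intro!: bdd_belowI[of _ 0])
  have T_less: "T p < a \<longleftrightarrow> 1 < a \<or> (\<exists>s\<in>levels. s < a \<and> ennreal (snd p) \<le> h s (fst p))" for p a
    unfolding T_def using cInf_less_iff[OF X, of p a] by (auto simp: X_def)
  have T_le1: "T p \<le> 1" for p
    unfolding T_def using X by (intro cInf_lower) (auto simp: X_def)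
  have T_leI: "T p \<le> s" if "s \<in> levels" "ennreal (snd p) \<le> h s (fst p)" for p s
    unfolding T_def using X that by (intro cInf_lower) (auto simp: X_def)
  have Tm: "T \<in> borel_measurable ?\<Omega>"
    unfolding borel_measurable_iff_less
  proof
    fix a
    have "{p \<in> space ?\<Omega>. T p < a} = (if 1 < a then space ?\<Omega> else (\<Union>s\<in>levels \<inter> {..<a}. E s UNIV))"
      by (auto simp: T_less E_def space\<Omega>)
    also have "\<dots> \<in> sets ?\<Omega>"
      using levels(1) E_sets by (auto intro!: sets.countable_UN')
    finally show "{p \<in> space ?\<Omega>. T p < a} \<in> sets ?\<Omega>" .
  qed
  define \<theta> where "\<theta> = distr ?\<Omega> (borel \<Otimes>\<^sub>M borel) (\<lambda>p. (T p, fst p))"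
  have "fst \<in> measurable ?\<Omega> \<nu>" by measurable
  then have fstm: "fst \<in> borel_measurable ?\<Omega>"
    by (simp add: measurable_cong_sets[OF refl sets_\<nu>])
  have m: "(\<lambda>p. (T p, fst p)) \<in> measurable ?\<Omega> (borel \<Otimes>\<^sub>M borel)"
    using Tm fstm by (intro measurable_Pair) auto
  have \<theta>_sets: "sets \<theta> = sets borel"
    by (simp add: \<theta>_def borel_prod)
  have \<theta>_prob: "prob_space \<theta>"
    unfolding \<theta>_def by (rule P.prob_space_distr[OF m])
  have "emeasure \<theta> ({..c} \<times> B) = emeasure (\<eta> c) B" if c: "c \<in> {0..1}" and B: "B \<in> sets borel" for c B
  proof -
    define G where "G = {p. T p \<le> c \<and> fst p \<in> B}"
    have "emeasure \<theta> ({..c} \<times> B) = emeasure ?\<Omega> ((\<lambda>p. (T p, fst p)) -` ({..c} \<times> B) \<inter> space ?\<Omega>)"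
      unfolding \<theta>_def using B by (intro emeasure_distr m) auto
    also have "(\<lambda>p. (T p, fst p)) -` ({..c} \<times> B) \<inter> space ?\<Omega> = G"
      by (auto simp: G_def space\<Omega>)
    finally have \<theta>G: "emeasure \<theta> ({..c} \<times> B) = emeasure ?\<Omega> G" .
    have G_sets: "G \<in> sets ?\<Omega>"
    proof -
      note [measurable] = Tm fstm B
      have "{p \<in> space ?\<Omega>. T p \<le> c \<and> fst p \<in> B} \<in> sets ?\<Omega>" by measurable
      then show ?thesis by (simp add: G_def space\<Omega>)
    qed
    have mE: "measure ?\<Omega> (E s B) = measure (\<eta> s) B" if "s \<in> levels" for s
      using E[OF that B] by (simp add: measure_def)
    \<comment> \<open>The event \<open>G\<close> lies between the regions of the levels up to
      \<open>c\<close> and those beyond \<open>c\<close>; \<open>measure_\<eta>_diff\<close> then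
      closes the gap.\<close>
    have lower: "measure (\<eta> s) B \<le> measure ?\<Omega> G" if "s \<in> levels" "s \<le> c" for s
      unfolding mE[OF that(1), symmetric]
      by (intro P.finite_measure_mono G_sets) (use T_leI[OF that(1)] that(2) in \<open>force simp: E_def G_def\<close>)
    have upper: "measure ?\<Omega> G \<le> measure (\<eta> t) B" if tl: "t \<in> levels" "c < t" for t
      unfolding mE[OF tl(1), symmetric]
    proof (intro P.finite_measure_mono E_sets tl(1) B subsetI)
      fix p assume "p \<in> G"
      then have "T p < t" "fst p \<in> B" using tl(2) by (auto simp: G_def)
      then obtain s where s: "s \<in> levels" "s < t" "ennreal (snd p) \<le> h s (fst p)"
        using T_less[of p t] levels(2)[OF tl(1)] by auto
      then have "ennreal (snd p) \<le> h t (fst p)"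
        using hmono[OF s(1) tl(1), of "fst p"] by auto
      then show "p \<in> E t B"
        using \<open>fst p \<in> B\<close> by (simp add: E_def)
    qed
    have "measure (\<eta> c) B \<le> measure ?\<Omega> G + e" if e: "e > 0" for e
    \<comment> \<open>There is no smaller level to approximate 0 from below, but 0 is a level
      itself.\<close>
    proof (cases "c = 0")
      case True
      then show ?thesis using lower[OF levels(3)] e by simp
    next
      case False
      then obtain s where s: "s \<in> \<rat>" "max 0 (c - e) < s" "s < c"
        using Rats_dense_in_real[of "max 0 (c - e)" c] c e by auto
      then have sl: "s \<in> levels" using c by (auto simp: levels_def)
      show ?thesis
        using lower[OF sl] measure_\<eta>_diff(2)[OF levels(2)[OF sl] c _ B] s by simp
    qed
    then have 1: "measure (\<eta> c) B \<le> measure ?\<Omega> G"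
      by (rule field_le_epsilon)
    have "measure ?\<Omega> G \<le> measure (\<eta> c) B + e" if e: "e > 0" for e
    \<comment> \<open>There is no level beyond 1; here \<open>\<nu>\<close> itself bounds
      \<open>G\<close>.\<close>
    proof (cases "c = 1")
      case True
      have "G \<subseteq> B \<times> UNIV" by (auto simp: G_def)
      then have "measure ?\<Omega> G \<le> measure ?\<Omega> (B \<times> UNIV)"
        using B by (intro P.finite_measure_mono) (auto simp: sets\<Omega>)
      also have "\<dots> = measure \<nu> B"
        using U.emeasure_pair_measure_Times[of B \<nu> UNIV] B U.emeasure_space_1
        by (simp add: measure_def sets_\<nu> U)
      finally show ?thesis using True e by (simp add: last_\<eta>)
    next
      case False
      then obtain t where t: "t \<in> \<rat>" "c < t" "t < min 1 (c + e)"
        using Rats_dense_in_real[of c "min 1 (c + e)"] c e by auto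
      then have tl: "t \<in> levels" using c by (auto simp: levels_def)
      show ?thesis
        using upper[OF tl] measure_\<eta>_diff(2)[OF c levels(2)[OF tl] _ B] t by simp
    qed
    then have "measure ?\<Omega> G \<le> measure (\<eta> c) B"
      by (rule field_le_epsilon)
    with 1 have eq: "measure ?\<Omega> G = measure (\<eta> c) B" by simp
    interpret c: finite_measure "\<eta> c" by (rule finite_\<eta>[OF c])
    from eq show ?thesis
      by (simp add: \<theta>G P.emeasure_eq_measure c.emeasure_eq_measure)
  qed
  with \<theta>_sets \<theta>_prob show ?thesis by blast
qed

end

section \<open>The left-curtain coupling\<close>

lemma borel_measurable_fst_snd [simp]:
  "fst \<in> borel_measurable (borel :: (real \<times> real) measure)"
  "snd \<in> borel_measurable (borel :: (real \<times> real) measure)"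
  by (intro borel_measurable_continuous_onI continuous_intros)+

lemma setwise_le_eq_mass:
  assumes \<nu>: "\<nu> \<in> finite_moment_measures" and le: "setwise_le \<eta> \<nu>"
    and mass: "emeasure \<eta> UNIV = emeasure \<nu> UNIV"
  shows "\<eta> = \<nu>"
proof -
  obtain \<kappa> where \<kappa>: "sum_measure \<nu> \<eta> \<kappa>"
    using le setwise_le_iff_sum_measure[OF \<nu>] by blast
  have sets: "sets \<nu> = sets borel" "sets \<eta> = sets borel" "sets \<kappa> = sets borel"
    using \<kappa> finite_momentD(2)[OF \<nu>] by (auto simp: sum_measure_def)
  have add: "emeasure \<nu> A = emeasure \<eta> A + emeasure \<kappa> A" if "A \<in> sets borel" for A
    using \<kappa> that by (simp add: sum_measure_def sets)
  have fin: "emeasure \<nu> UNIV \<noteq> \<infinity>"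
    using finite_measure.emeasure_finite[OF finite_momentD(1)[OF \<nu>]] by simp
  have "emeasure \<nu> UNIV + emeasure \<kappa> UNIV = emeasure \<nu> UNIV + 0"
    using add[of UNIV] mass by simp
  then have "emeasure \<kappa> UNIV = 0"
    using fin by (simp add: ennreal_add_left_cancel)
  then have "emeasure \<kappa> A = 0" if "A \<in> sets borel" for A
    using emeasure_mono[of A UNIV \<kappa>] that sets by simp
  then show ?thesis
    using add sets by (intro measure_eqI) auto
qed

text \<open>For fixed \<open>B\<close>, half lines determine the measure that sends \<open>A\<close>
  to the mass of \<open>A \<times> B\<close>. Agreement on all rectangles follows, and these are
  closed under intersection and generate the Borel sets.\<close>

lemma measure_eqI_rectangles:
  fixes M N :: "(real \<times> real) measure"
  assumes M: "sets M = sets borel" and N: "sets N = sets borel"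
    and fin: "finite_measure M" "finite_measure N"
    and eq: "\<And>x B. B \<in> sets borel \<Longrightarrow> emeasure M ({..x} \<times> B) = emeasure N ({..x} \<times> B)"
  shows "M = N"
proof -
  have sp: "space M = UNIV" "space N = UNIV"
    using sets_eq_imp_space_eq[OF M] sets_eq_imp_space_eq[OF N] by auto
  have rect_sets: "A \<times> B \<in> sets borel" if "A \<in> sets borel" "B \<in> sets borel" for A B :: "real set"
    using that by (simp add: borel_prod[symmetric])
  have fst_meas: "fst \<in> borel_measurable (restrict_meas L S)" if "sets L = sets borel" for L :: "(real \<times>
      real) measure" and S
    unfolding measurable_restrict_meas by (subst measurable_cong_sets[OF that refl]) simp
  have slice: "emeasure (distr (restrict_meas L (UNIV \<times> B)) borel fst) A = emeasure L (A \<times> B)"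
    if L: "sets L = sets borel" and A: "A \<in> sets borel" and B: "B \<in> sets borel" for L :: "(real \<times> real)
        measure" and A B
  proof -
    have "emeasure (distr (restrict_meas L (UNIV \<times> B)) borel fst) A
        = emeasure (restrict_meas L (UNIV \<times> B)) (A \<times> UNIV)"
      using A sets_eq_imp_space_eq[OF L]
      by (subst emeasure_distr[OF fst_meas[OF L] A])
        (auto intro!: arg_cong[where f = "emeasure (restrict_meas L (UNIV \<times> B))"] simp: restrict_meas_simps)
    also have "\<dots> = emeasure L ((UNIV \<times> B) \<inter> (A \<times> UNIV))"
      using A B rect_sets by (intro emeasure_restrict_meas) (auto simp: L)
    also have "(UNIV \<times> B) \<inter> (A \<times> UNIV) = A \<times> B" by auto
    finally show ?thesis .
  qed
  have fin': "finite_measure (distr (restrict_meas L (UNIV \<times> B)) borel fst)"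
    if L: "sets L = sets borel" "finite_measure L" and B: "B \<in> sets borel" for L :: "(real \<times> real) measure"
        and B
  proof -
    interpret finite_measure L by fact
    show ?thesis
      using slice[OF L(1) _ B, of UNIV] by (intro finite_measureI) simp
  qed
  have eq': "emeasure M (A \<times> B) = emeasure N (A \<times> B)" if A: "A \<in> sets borel" and B: "B \<in> sets borel" for A B
  proof -
    have "distr (restrict_meas M (UNIV \<times> B)) borel fst = distr (restrict_meas N (UNIV \<times> B)) borel fst"
      using B eq by (intro measure_eqI_atMost fin' M N fin) (auto simp: slice M N)
    then show ?thesis
      using slice[OF M A B] slice[OF N A B] by simp
  qed
  let ?E = "{A \<times> B | A B. A \<in> sets (borel :: real measure) \<and> B \<in> sets (borel :: real measure)}"
  show ?thesis
  proof (rule measure_eqI_generator_eq[where E = ?E and \<Omega> = UNIV and A = "\<lambda>_. UNIV"])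
    show "Int_stable ?E"
      by (rule Int_stable_pair_measure_generator)
    have "sets (borel :: (real \<times> real) measure) = sigma_sets UNIV ?E"
      by (simp add: borel_prod[symmetric] sets_pair_measure)
    then show "sets M = sigma_sets UNIV ?E"
      "sets N = sigma_sets UNIV ?E"
      by (simp_all add: M N)
    show "range (\<lambda>_. UNIV) \<subseteq> ?E"
      by (auto intro!: exI[of _ UNIV])
    show "emeasure M UNIV \<noteq> \<infinity>"
      using finite_measure.emeasure_finite[OF fin(1)] by simp
  qed (use eq' in auto)
qed

locale curtain =
  fixes \<mu> \<nu> :: "real measure"
  assumes pair: "(\<mu>, \<nu>) \<in> convex_ordered_pairs"
begin

lemma \<mu>: "\<mu> \<in> finite_moment_probs" and \<nu>: "\<nu> \<in> finite_moment_probs" and le: "convex_le \<mu> \<nu>"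
  using pair by (auto simp: convex_ordered_pairs_def)

lemmas \<mu>_moment = finite_moment_probsD(1)[OF \<mu>]
lemmas \<nu>_moment = finite_moment_probsD(1)[OF \<nu>]

text \<open>The upper part of \<open>\<mu>\<close> serves as completing measure: both parts add up
  to \<open>\<mu>\<close>, which is below \<open>\<nu>\<close> in convex order.\<close>

lemma shadow_data_part:
  assumes "0 \<le> s" "s \<le> 1"
  shows "shadow_data \<nu> (part \<mu> 0 s) (part \<mu> s 1)"
proof -
  have sum: "sum_measure \<mu> (part \<mu> 0 s) (part \<mu> s 1)"
    using sum_measure_part[OF \<mu> assms] by (simp add: part_0_1[OF \<mu>])
  note p = sum_measure_potential[OF sum \<mu>_moment] and l = convex_leD[OF le]
  show ?thesis
    using part_moment[OF \<mu>] assms p l(3,4) l(5) by unfold_locales (auto simp: \<nu>_moment simp flip: p(1))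
qed

definition \<eta> :: "real \<Rightarrow> real measure" where
  "\<eta> s = shadow \<nu> (part \<mu> 0 s)"

lemma \<eta>_moment: "0 \<le> s \<Longrightarrow> s \<le> 1 \<Longrightarrow> \<eta> s \<in> finite_moment_measures"
  unfolding \<eta>_def using shadow_data.shadow_moment[OF shadow_data_part] by simp

lemma emeasure_\<eta>_UNIV:
  assumes "0 \<le> s" "s \<le> 1"
  shows "emeasure (\<eta> s) UNIV = ennreal s"
proof -
  interpret finite_measure "\<eta> s" by (rule finite_momentD(1)[OF \<eta>_moment[OF assms]])
  have "measure (\<eta> s) UNIV = s"
    using shadow_data.mass_shadow[OF shadow_data_part[OF assms]] assms
    by (simp add: \<eta>_def mass_part[OF \<mu>] flip: mass_def)
  then show ?thesis by (simp add: emeasure_eq_measure)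
qed

sublocale prob_space \<nu>
  by (rule finite_moment_probsD(2)[OF \<nu>])

sublocale increasing_family \<nu> \<eta>
proof
  show "sets \<nu> = sets borel"
    by (rule finite_momentD(2)[OF \<nu>_moment])
  show "emeasure (\<eta> s) UNIV = ennreal s" if "s \<in> {0..1}" for s
    using that emeasure_\<eta>_UNIV by simp
  show "setwise_le (\<eta> s) (\<eta> t)" if "s \<in> {0..1}" "t \<in> {0..1}" "s \<le> t" for s t
    unfolding \<eta>_def using that
    by (intro shadow_mono[OF shadow_data_part sum_measure_part[OF \<mu>] shadow_data_part]) auto
  have "emeasure \<nu> UNIV = 1"
    using emeasure_space_1 finite_momentD(3)[OF \<nu>_moment] by simp
  then show "\<eta> 1 = \<nu>"
    using shadow_data.shadow_le[OF shadow_data_part, of 1]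
    by (intro setwise_le_eq_mass[OF \<nu>_moment]) (auto simp: emeasure_\<eta>_UNIV simp flip: \<eta>_def)
qed

definition \<theta> :: "(real \<times> real) measure" where
  "\<theta> = (SOME \<theta>. sets \<theta> = sets borel \<and> prob_space \<theta> \<and>
    (\<forall>c\<in>{0..1}. \<forall>B\<in>sets borel. emeasure \<theta> ({..c} \<times> B) = emeasure (\<eta> c) B))"

lemma \<theta>: "sets \<theta> = sets borel" "prob_space \<theta>"
  "0 \<le> c \<Longrightarrow> c \<le> 1 \<Longrightarrow> B \<in> sets borel \<Longrightarrow> emeasure \<theta> ({..c} \<times> B) = emeasure (\<eta> c) B"
  using someI_ex[OF ex_joint_law] by (auto simp: \<theta>_def)

lemma space_\<theta>: "space \<theta> = UNIV"
  using sets_eq_imp_space_eq[OF \<theta>(1)] by simp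

lemma measurable_\<theta>: "measurable \<theta> N = measurable borel N"
  by (rule measurable_cong_sets[OF \<theta>(1) refl])

sublocale \<theta>: prob_space \<theta> by (rule \<theta>(2))

lemma rect_sets: "A \<in> sets borel \<Longrightarrow> B \<in> sets borel \<Longrightarrow> A \<times> B \<in> sets (borel :: (real \<times> real) measure)"
  for A B :: "real set"
  by (simp add: borel_prod[symmetric])

text \<open>The level coordinate is uniform because \<open>\<eta> c\<close> has mass
  \<open>c\<close>; half lines ending outside the unit interval follow by monotonicity.\<close>

lemma fst_\<theta>: "distr \<theta> borel fst = restrict_meas lborel {0<..<1}"
proof (rule measure_eqI_atMost)
  have 1: "emeasure (distr \<theta> borel fst) {..x} = emeasure \<theta> ({..x} \<times> UNIV)" for x
    by (subst emeasure_distr) (auto simp: measurable_\<theta> space_\<theta> intro!: arg_cong[where f = "emeasure \<theta>"])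
  have mono: "emeasure \<theta> ({..x} \<times> UNIV) \<le> emeasure \<theta> ({..y} \<times> UNIV)" if "x \<le> y" for x y
    using that by (intro emeasure_mono) (auto simp: \<theta>(1) intro!: rect_sets)
  fix x :: real
  have "emeasure (restrict_meas lborel {0<..<1}) {..x} = emeasure lborel ({0<..<1} \<inter> {..x})"
    by (intro emeasure_restrict_meas) auto
  also have "\<dots> = emeasure \<theta> ({..x} \<times> UNIV)"
  proof -
    consider "x < 0" | "0 \<le> x" "x < 1" | "1 \<le> x" by linarith
    then show ?thesis
    proof cases
      case 1
      then have "emeasure \<theta> ({..x} \<times> UNIV) \<le> 0"
        using mono[of x 0] \<theta>(3)[of 0 UNIV] by (simp add: emeasure_\<eta>_UNIV)
      moreover have "{0<..<1} \<inter> {..x} = {}" using 1 by auto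
      ultimately show ?thesis by simp
    next
      case 2
      then have "{0<..<1} \<inter> {..x} = {0<..x}" by auto
      with 2 show ?thesis
        using \<theta>(3)[of x UNIV] by (simp add: emeasure_\<eta>_UNIV)
    next
      case 3
      then have "1 \<le> emeasure \<theta> ({..x} \<times> UNIV)"
        using mono[of 1 x] \<theta>(3)[of 1 UNIV] by (simp add: emeasure_\<eta>_UNIV)
      then have "emeasure \<theta> ({..x} \<times> UNIV) = 1"
        using \<theta>.emeasure_le_1 by (intro antisym)
      moreover have "{0<..<1} \<inter> {..x} = {0<..<1}" using 3 by auto
      ultimately show ?thesis by simp
    qed
  qed
  finally show "emeasure (distr \<theta> borel fst) {..x} = emeasure (restrict_meas lborel {0<..<1}) {..x}"
    by (simp add: 1)
next
  show "finite_measure (distr \<theta> borel fst)"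
    by (intro \<theta>.finite_measure_distr) (simp add: measurable_\<theta>)
  show "finite_measure (restrict_meas lborel {0<..<1::real})"
    by (intro finite_measureI) (simp add: restrict_meas_simps emeasure_restrict_meas)
qed (simp_all add: restrict_meas_simps)

lemma AE_\<theta>: "AE z in \<theta>. 0 < fst z \<and> fst z < 1"
proof -
  have "AE t in restrict_meas lborel {0<..<1}. 0 < t \<and> t < (1::real)"
    unfolding restrict_meas_def by (subst AE_density) (auto simp: indicator_def)
  then have "AE t in distr \<theta> borel fst. 0 < t \<and> t < 1"
    by (simp only: fst_\<theta>)
  then show ?thesis
    by (subst (asm) AE_distr_iff) (auto simp: measurable_\<theta>)
qed

section \<open>The coupling \<open>plan\<close> and its admissible family of slices\<close>

definition S :: "real \<times> real \<Rightarrow> real \<times> real" where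
  "S z = (quantile \<mu> (fst z), snd z)"

lemma measurable_S: "S \<in> borel_measurable borel"
proof -
  note [measurable] = measurable_quantile[OF \<mu>]
  have "S \<in> measurable (borel \<Otimes>\<^sub>M borel) (borel \<Otimes>\<^sub>M borel)"
    unfolding S_def by measurable
  then show ?thesis by (simp add: borel_prod)
qed

text \<open>Cut by the level and not by the first coordinate of the plan, so that an atom of
  \<open>\<mu>\<close> can be divided at any height.\<close>

definition slice :: "real \<Rightarrow> (real \<times> real) measure" where
  "slice s = distr (restrict_meas \<theta> ({..s} \<times> UNIV)) borel S"

definition plan :: "(real \<times> real) measure" where
  "plan = distr \<theta> borel S"

lemma emeasure_plan: "A \<in> sets borel \<Longrightarrow> emeasure plan A = emeasure \<theta> (S -` A)"
  unfolding plan_def by (subst emeasure_distr) (auto simp: measurable_\<theta> measurable_S space_\<theta>)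

lemma vimage_S: "A \<in> sets borel \<Longrightarrow> S -` A \<in> sets borel"
  using measurable_sets[OF measurable_S] by simp

lemma emeasure_slice:
  assumes "A \<in> sets borel"
  shows "emeasure (slice s) A = emeasure \<theta> (({..s} \<times> UNIV) \<inter> S -` A)"
  unfolding slice_def using assms vimage_S[OF assms]
  by (subst emeasure_distr)
    (auto simp: measurable_restrict_meas measurable_\<theta> measurable_S restrict_meas_simps space_\<theta> \<theta>(1)
      intro!: emeasure_restrict_meas rect_sets)

lemma quantile_mono: "0 < s \<Longrightarrow> s \<le> t \<Longrightarrow> t < 1 \<Longrightarrow> quantile \<mu> s \<le> quantile \<mu> t"
  using quantile_le_iff[OF \<mu>, of t "quantile \<mu> t"] quantile_le_iff[OF \<mu>, of s "quantile \<mu> t"] by simp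

lemma setwise_le_\<theta>I:
  assumes "sets M = sets borel" "sets N = sets borel"
    and "\<And>A. A \<in> sets borel \<Longrightarrow> emeasure M A = emeasure \<theta> (C \<inter> S -` A)"
    and "\<And>A. A \<in> sets borel \<Longrightarrow> emeasure N A = emeasure \<theta> (D \<inter> S -` A)"
    and D: "D \<in> sets borel" and "AE z in \<theta>. z \<in> C \<longrightarrow> z \<in> D"
  shows "setwise_le M N"
  unfolding setwise_le_def
proof (intro conjI ballI)
  fix A assume "A \<in> sets N"
  then have A: "A \<in> sets borel" by (simp add: assms)
  have "emeasure \<theta> (C \<inter> S -` A) \<le> emeasure \<theta> (D \<inter> S -` A)"
    using assms(6) vimage_S[OF A] D by (intro emeasure_mono_AE) (auto simp: \<theta>(1))
  then show "emeasure M A \<le> emeasure N A"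
    by (simp add: assms(3,4)[OF A])
qed (simp add: assms)

lemma emeasure_restrict_plan:
  assumes "B \<in> sets borel" "A \<in> sets borel"
  shows "emeasure (restrict_meas plan (B \<times> UNIV)) A = emeasure \<theta> (S -` (B \<times> UNIV) \<inter> S -` A)"
proof -
  have "emeasure (restrict_meas plan (B \<times> UNIV)) A = emeasure plan ((B \<times> UNIV) \<inter> A)"
    using assms rect_sets by (intro emeasure_restrict_meas) (auto simp: plan_def)
  then show ?thesis
    using assms rect_sets by (simp add: emeasure_plan sets.Int)
qed

lemma admissible_slice: "admissible plan slice"
  unfolding admissible_def
proof (intro conjI ballI impI)
  fix s :: real assume s: "s \<in> {0..1}"
  show "sets (slice s) = sets borel" by (simp add: slice_def)
  show "emeasure (slice s) UNIV = ennreal s"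
    using s \<theta>(3)[of s UNIV] by (simp add: emeasure_slice emeasure_\<eta>_UNIV)
  \<comment> \<open>Infinite thresholds at \<open>s = 0\<close> and \<open>s = 1\<close>, where
    \<open>quantile\<close> only has its default value.\<close>
  define x where "x = (if s = 0 then - \<infinity> else if s = 1 then \<infinity> else ereal (quantile \<mu> s))"
  have B: "{u. ereal u < x} \<in> sets borel" "{u. ereal u \<le> x} \<in> sets borel"
    by (cases x; auto simp flip: lessThan_def atMost_def)+
  have lo: "0 < t \<Longrightarrow> t < 1 \<Longrightarrow> ereal (quantile \<mu> t) < x \<Longrightarrow> t \<le> s" for t
    using quantile_mono[of s t] s by (auto simp: x_def split: if_splits intro: leI)
  have hi: "0 < t \<Longrightarrow> t < 1 \<Longrightarrow> t \<le> s \<Longrightarrow> ereal (quantile \<mu> t) \<le> x" for t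
    using quantile_mono[of t s] s by (auto simp: x_def)
  show "\<exists>x::ereal. setwise_le (restrict_meas plan ({u. ereal u < x} \<times> UNIV)) (slice s) \<and>
      setwise_le (slice s) (restrict_meas plan ({u. ereal u \<le> x} \<times> UNIV))"
  proof (intro exI[of _ x] conjI)
    show "setwise_le (restrict_meas plan ({u. ereal u < x} \<times> UNIV)) (slice s)"
    proof (rule setwise_le_\<theta>I[OF _ _ emeasure_restrict_plan emeasure_slice])
      show "AE z in \<theta>. z \<in> S -` ({u. ereal u < x} \<times> UNIV) \<longrightarrow> z \<in> {..s} \<times> UNIV"
        using AE_\<theta> by eventually_elim (use lo in \<open>auto simp: S_def\<close>)
    qed (auto simp: restrict_meas_simps plan_def slice_def B intro!: rect_sets)
    show "setwise_le (slice s) (restrict_meas plan ({u. ereal u \<le> x} \<times> UNIV))"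
    proof (rule setwise_le_\<theta>I[OF _ _ emeasure_slice emeasure_restrict_plan])
      show "AE z in \<theta>. z \<in> {..s} \<times> UNIV \<longrightarrow> z \<in> S -` ({u. ereal u \<le> x} \<times> UNIV)"
        using AE_\<theta> by eventually_elim (use hi in \<open>auto simp: S_def\<close>)
    qed (auto simp: restrict_meas_simps plan_def slice_def B intro!: rect_sets vimage_S)
  qed
next
  fix s t :: real assume "s \<le> t"
  then show "setwise_le (slice s) (slice t)"
    by (intro setwise_le_\<theta>I[OF _ _ emeasure_slice emeasure_slice])
      (auto simp: slice_def intro!: rect_sets)
qed

lemma fst_slice:
  assumes s: "0 \<le> s" "s \<le> 1"
  shows "fst_marginal (slice s) = part \<mu> 0 s"
proof (rule measure_eqI)
  fix B assume "B \<in> sets (fst_marginal (slice s))"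
  then have B: "B \<in> sets borel" by simp
  have Q: "quantile \<mu> -` B \<in> sets borel"
    using measurable_sets[OF measurable_quantile[OF \<mu>] B] by simp
  have "emeasure (fst_marginal (slice s)) B = emeasure (slice s) (B \<times> UNIV)"
    using B by (subst emeasure_distr) (auto simp: slice_def intro!: arg_cong[where f = "emeasure (distr _
        borel S)"])
  also have "\<dots> = emeasure \<theta> (fst -` ({..s} \<inter> quantile \<mu> -` B) \<inter> space \<theta>)"
    using B rect_sets[of B UNIV]
    by (subst emeasure_slice) (auto simp: S_def space_\<theta> intro!: arg_cong[where f = "emeasure \<theta>"])
  also have "\<dots> = emeasure (distr \<theta> borel fst) ({..s} \<inter> quantile \<mu> -` B)"
    using Q by (intro emeasure_distr[symmetric]) (auto simp: measurable_\<theta>)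
  also have "\<dots> = emeasure lborel ({0<..<1} \<inter> ({..s} \<inter> quantile \<mu> -` B))"
    using Q unfolding fst_\<theta> by (intro emeasure_restrict_meas) auto
  also have "\<dots> = emeasure lborel ({0<..<s} \<inter> quantile \<mu> -` B)"
  proof (rule emeasure_eq_AE)
    show "AE x in lborel. x \<in> {0<..<1} \<inter> ({..s} \<inter> quantile \<mu> -` B) \<longleftrightarrow> x \<in> {0<..<s} \<inter> quantile \<mu> -` B"
      using AE_lborel_singleton[of s] by eventually_elim (use s in auto)
  qed (use Q in auto)
  finally show "emeasure (fst_marginal (slice s)) B = emeasure (part \<mu> 0 s) B"
    by (simp add: emeasure_part[OF \<mu> B])
qed (simp add: sets_part)

lemma snd_slice:
  assumes s: "0 \<le> s" "s \<le> 1"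
  shows "snd_marginal (slice s) = \<eta> s"
proof (rule measure_eqI)
  fix B assume "B \<in> sets (snd_marginal (slice s))"
  then have B: "B \<in> sets borel" by simp
  have "emeasure (snd_marginal (slice s)) B = emeasure (slice s) (UNIV \<times> B)"
    using B by (subst emeasure_distr) (auto simp: slice_def intro!: arg_cong[where f = "emeasure (distr _
        borel S)"])
  also have "\<dots> = emeasure \<theta> ({..s} \<times> B)"
    using B rect_sets[of UNIV B]
    by (subst emeasure_slice) (auto simp: S_def intro!: arg_cong[where f = "emeasure \<theta>"])
  finally show "emeasure (snd_marginal (slice s)) B = emeasure (\<eta> s) B"
    using \<theta>(3)[OF s B] by simp
qed (use s sets_\<eta>[of s] in simp)

lemma slice_1: "slice 1 = plan"
proof (rule measure_eqI)
  fix A assume "A \<in> sets (slice 1)"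
  then have A: "A \<in> sets borel" by (simp add: slice_def)
  have "emeasure \<theta> (({..1} \<times> UNIV) \<inter> S -` A) = emeasure \<theta> (S -` A)"
  proof (rule emeasure_eq_AE)
    show "AE z in \<theta>. z \<in> ({..1} \<times> UNIV) \<inter> S -` A \<longleftrightarrow> z \<in> S -` A"
      using AE_\<theta> by eventually_elim (auto simp: less_imp_le mem_Times_iff)
  qed (use vimage_S[OF A] rect_sets[of "{..1}" UNIV] in \<open>auto simp: \<theta>(1)\<close>)
  then show "emeasure (slice 1) A = emeasure plan A"
    by (simp add: emeasure_slice[OF A] emeasure_plan[OF A])
qed (simp add: slice_def plan_def)

lemma fst_plan: "fst_marginal plan = \<mu>"
  using fst_slice[of 1] by (simp add: slice_1 part_0_1[OF \<mu>])

lemma snd_plan: "snd_marginal plan = \<nu>"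
  using snd_slice[of 1] by (simp add: slice_1 last_\<eta>)

text \<open>For a level \<open>t\<close> in the open unit interval,
  \<open>quantile \<mu> t \<le> x\<close> means \<open>t \<le> cdf \<mu> x\<close>. The half line up
  to \<open>x\<close> thus becomes the levels up to \<open>cdf \<mu> x\<close>, whose part of
  \<open>\<mu>\<close> is the restriction to that half line.\<close>

lemma emeasure_plan_rect:
  assumes B: "B \<in> sets borel"
  shows "emeasure plan ({..x} \<times> B) = emeasure (shadow \<nu> (restrict_meas \<mu> {..x})) B"
proof -
  interpret \<mu>: cdf_distribution \<mu> using cdf_distributionI[OF \<mu>] .
  have c: "0 \<le> cdf \<mu> x" "cdf \<mu> x \<le> 1"
    using \<mu>.cdf_nonneg \<mu>.cdf_bounded_prob by auto
  have "emeasure plan ({..x} \<times> B) = emeasure \<theta> (S -` ({..x} \<times> B))"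
    using B by (intro emeasure_plan rect_sets) auto
  also have "\<dots> = emeasure \<theta> ({..cdf \<mu> x} \<times> B)"
  proof (rule emeasure_eq_AE)
    show "AE z in \<theta>. z \<in> S -` ({..x} \<times> B) \<longleftrightarrow> z \<in> {..cdf \<mu> x} \<times> B"
      using AE_\<theta> by eventually_elim (auto simp: S_def quantile_le_iff[OF \<mu>] mem_Times_iff)
  qed (use B in \<open>auto simp: \<theta>(1) intro!: vimage_S rect_sets\<close>)
  also have "\<dots> = emeasure (\<eta> (cdf \<mu> x)) B"
    by (rule \<theta>(3)[OF c B])
  finally show ?thesis
    by (simp add: \<eta>_def part_eq_restrict[OF \<mu>])
qed

lemma sets_plan: "sets plan = sets borel" and space_plan: "space plan = UNIV"
  by (simp_all add: plan_def)

sublocale plan: prob_space plan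
  unfolding plan_def by (rule \<theta>.prob_space_distr) (simp add: measurable_\<theta> measurable_S)

lemma measurable_plan: "measurable plan N = measurable borel N"
  by (rule measurable_cong_sets[OF sets_plan refl])

lemma fst_restrict_plan: "fst_marginal (restrict_meas plan ({..x} \<times> UNIV)) = restrict_meas \<mu> {..x}"
proof (rule measure_eqI)
  fix B assume "B \<in> sets (fst_marginal (restrict_meas plan ({..x} \<times> UNIV)))"
  then have B: "B \<in> sets borel" by simp
  have "emeasure (fst_marginal (restrict_meas plan ({..x} \<times> UNIV))) B
      = emeasure (restrict_meas plan ({..x} \<times> UNIV)) (fst -` B \<inter> space plan)"
    using B by (subst emeasure_distr) (auto simp: measurable_restrict_meas measurable_plan
        restrict_meas_simps)
  also have "\<dots> = emeasure plan (({..x} \<times> UNIV) \<inter> (fst -` B \<inter> space plan))"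
    using B rect_sets[of "{..x}" UNIV] rect_sets[of B UNIV]
    by (intro emeasure_restrict_meas) (auto simp: sets_plan space_plan vimage_fst)
  also have "({..x} \<times> UNIV) \<inter> (fst -` B \<inter> space plan) = fst -` ({..x} \<inter> B) \<inter> space plan"
    by auto
  also have "emeasure plan \<dots> = emeasure \<mu> ({..x} \<inter> B)"
    using B emeasure_distr[of fst plan borel "{..x} \<inter> B"] by (simp add: measurable_plan fst_plan)
  also have "\<dots> = emeasure (restrict_meas \<mu> {..x}) B"
    using B finite_momentD(2)[OF \<mu>_moment] by (intro emeasure_restrict_meas[symmetric]) auto
  finally show "emeasure (fst_marginal (restrict_meas plan ({..x} \<times> UNIV))) B = emeasure (restrict_meas \<mu>
      {..x}) B" .
qed (simp add: restrict_meas_simps finite_momentD(2)[OF \<mu>_moment])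

lemma emeasure_snd_restrict:
  assumes "sets \<pi> = sets borel" "B \<in> sets borel"
  shows "emeasure (snd_marginal (restrict_meas \<pi> ({..x} \<times> UNIV))) B = emeasure \<pi> ({..x} \<times> B)"
proof -
  have sp: "space \<pi> = UNIV" using sets_eq_imp_space_eq[OF assms(1)] by simp
  have "emeasure (snd_marginal (restrict_meas \<pi> ({..x} \<times> UNIV))) B
      = emeasure (restrict_meas \<pi> ({..x} \<times> UNIV)) (snd -` B \<inter> space \<pi>)"
    using assms
    by (subst emeasure_distr) (auto simp: measurable_restrict_meas restrict_meas_simps
        measurable_cong_sets[OF assms(1) refl])
  also have "\<dots> = emeasure \<pi> (({..x} \<times> UNIV) \<inter> (snd -` B \<inter> space \<pi>))"
    using assms rect_sets[of "{..x}" UNIV] rect_sets[of UNIV B]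
    by (intro emeasure_restrict_meas) (auto simp: sp vimage_snd)
  also have "({..x} \<times> UNIV) \<inter> (snd -` B \<inter> space \<pi>) = {..x} \<times> B"
    by (auto simp: sp)
  finally show ?thesis .
qed

lemma shadow_data_restrict: "\<exists>\<rho>. shadow_data \<nu> (restrict_meas \<mu> {..x}) \<rho>"
proof -
  interpret \<mu>: cdf_distribution \<mu> using cdf_distributionI[OF \<mu>] .
  show ?thesis
    using shadow_data_part[of "cdf \<mu> x"] \<mu>.cdf_nonneg \<mu>.cdf_bounded_prob by (auto simp: part_eq_restrict[OF
        \<mu>])
qed

lemma snd_restrict_plan:
  "snd_marginal (restrict_meas plan ({..x} \<times> UNIV)) = shadow \<nu> (restrict_meas \<mu> {..x})"
proof (rule measure_eqI)
  obtain \<rho> where "shadow_data \<nu> (restrict_meas \<mu> {..x}) \<rho>"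
    using shadow_data_restrict by blast
  from finite_momentD(2)[OF shadow_data.shadow_moment[OF this]]
  show "sets (snd_marginal (restrict_meas plan ({..x} \<times> UNIV))) = sets (shadow \<nu> (restrict_meas \<mu> {..x}))"
    by simp
qed (simp add: emeasure_snd_restrict[OF sets_plan] emeasure_plan_rect)

section \<open>The martingale property of \<open>plan\<close>\<close>

lemma integrable_fst_snd: "integrable plan fst" "integrable plan snd"
proof -
  have m: "fst \<in> measurable plan borel" "snd \<in> measurable plan borel"
    by (simp_all add: measurable_plan)
  have "integrable plan (\<lambda>z. fst z) \<longleftrightarrow> integrable \<mu> (\<lambda>x. x)"
    using integrable_distr_eq[OF m(1), of "\<lambda>x. x"] unfolding fst_plan by simp
  then show "integrable plan fst"
    using finite_momentD(4)[OF \<mu>_moment] by metis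
  have "integrable plan (\<lambda>z. snd z) \<longleftrightarrow> integrable \<nu> (\<lambda>x. x)"
    using integrable_distr_eq[OF m(2), of "\<lambda>x. x"] unfolding snd_plan by simp
  then show "integrable plan snd"
    using finite_momentD(4)[OF \<nu>_moment] by metis
qed

text \<open>The two sides are the means of a shadow and of the measure it is taken of, and convex
  order preserves the mean.\<close>

lemma set_integral_atMost: "(LINT z:{..x} \<times> UNIV|plan. snd z) = (LINT z:{..x} \<times> UNIV|plan. fst z)"
proof -
  let ?R = "restrict_meas plan ({..x} \<times> UNIV)"
  have *: "(LINT z:{..x} \<times> UNIV|plan. f z) = (\<integral>x. x \<partial>distr ?R borel f)" if "f \<in> borel_measurable borel" for
      f :: "real \<times> real \<Rightarrow> real"
  proof -
    have R: "?R = density plan (\<lambda>z. ennreal (indicator ({..x} \<times> UNIV) z))"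
      by (simp add: restrict_meas_def ennreal_indicator)
    have "(\<integral>x. x \<partial>distr ?R borel f) = (\<integral>z. f z \<partial>?R)"
      using that integral_distr[of f ?R borel "\<lambda>x. x"] by (simp add: measurable_restrict_meas
          measurable_plan)
    also have "\<dots> = (\<integral>z. indicator ({..x} \<times> UNIV) z *\<^sub>R f z \<partial>plan)"
      unfolding R using that rect_sets[of "{..x}" UNIV]
      by (subst integral_density) (auto simp: measurable_plan)
    finally show ?thesis by (simp add: set_lebesgue_integral_def)
  qed
  obtain \<rho> where "shadow_data \<nu> (restrict_meas \<mu> {..x}) \<rho>"
    using shadow_data_restrict by blast
  from shadow_data.mean_shadow[OF this] show ?thesis
    by (simp add: * snd_restrict_plan fst_restrict_plan mean_def)
qed

text \<open>Half lines are closed under intersection and generate the Borel sets, and the sets with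
  this property are closed under complements and disjoint unions.\<close>

lemma set_integral_martingale:
  assumes "B \<in> sets borel"
  shows "(LINT z:B \<times> UNIV|plan. snd z) = (LINT z:B \<times> UNIV|plan. fst z)"
proof -
  let ?d = "\<lambda>z. snd z - fst z"
  have int: "set_integrable plan (B \<times> UNIV) f" if "B \<in> sets borel" "integrable plan f" for B and f :: "real
      \<times> real \<Rightarrow> real"
    unfolding set_integrable_def using that rect_sets[of B UNIV]
    by (intro integrable_mult_indicator) (auto simp: sets_plan)
  have intd: "integrable plan ?d"
    using integrable_fst_snd by simp
  have split: "(LINT z:B \<times> UNIV|plan. ?d z) = (LINT z:B \<times> UNIV|plan. snd z) - (LINT z:B \<times> UNIV|plan. fst z)"
    if "B \<in> sets borel" for B
    using int[OF that] integrable_fst_snd by (intro set_integral_diff) auto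
  \<comment> \<open>This serves for complements; it rests on the equality of the means of
    \<open>\<mu>\<close> and \<open>\<nu>\<close>.\<close>
  have total: "(\<integral>z. ?d z \<partial>plan) = 0"
  proof -
    have "(\<integral>z. fst z \<partial>plan) = (\<integral>x. x \<partial>fst_marginal plan)"
      by (subst integral_distr) (auto simp: measurable_plan)
    moreover have "(\<integral>z. snd z \<partial>plan) = (\<integral>x. x \<partial>snd_marginal plan)"
      by (subst integral_distr) (auto simp: measurable_plan)
    ultimately show ?thesis
      using integrable_fst_snd convex_leD(4)[OF le] by (simp add: fst_plan snd_plan mean_def)
  qed
  have B: "B \<in> sigma_sets UNIV (range atMost)"
    using assms unfolding borel_eq_atMost by simp
  have "Int_stable (range atMost :: real set set)" "range atMost \<subseteq> Pow (UNIV :: real set)"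
    by (auto simp: Int_stable_def)
  then have "(LINT z:B \<times> UNIV|plan. ?d z) = 0"
    using B
  proof (induction rule: sigma_sets_induct_disjoint)
    case (basic A)
    then obtain x where "A = {..x}" by auto
    then show ?case
      using split[of A] set_integral_atMost[of x] by simp
  next
    case empty
    show ?case by (simp add: set_lebesgue_integral_def)
  next
    case (compl A)
    then have A: "A \<in> sets borel" unfolding borel_eq_atMost by simp
    have "(LINT z:(UNIV - A) \<times> UNIV|plan. ?d z) = (\<integral>z. ?d z - indicator (A \<times> UNIV) z *\<^sub>R ?d z \<partial>plan)"
      unfolding set_lebesgue_integral_def by (intro Bochner_Integration.integral_cong) (auto simp:
          indicator_def)
    also have "\<dots> = 0"
      using compl.IH total intd int[OF A intd]
      by (subst Bochner_Integration.integral_diff) (auto simp: set_lebesgue_integral_def set_integrable_def)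
    finally show ?case .
  next
    case (union A)
    then have A: "A i \<in> sets borel" for i unfolding borel_eq_atMost by auto
    have eq: "(\<Union>i. A i) \<times> UNIV = (\<Union>i. A i \<times> (UNIV :: real set))" by auto
    have "(LINT z:(\<Union>i. A i \<times> UNIV)|plan. ?d z) = (\<Sum>i. (LINT z:A i \<times> UNIV|plan. ?d z))"
    proof (rule lebesgue_integral_countable_add)
      show "A i \<times> UNIV \<in> sets plan" for i
        using A rect_sets by (simp add: sets_plan)
      show "A i \<times> (UNIV :: real set) \<inter> A j \<times> UNIV = {}" if "i \<noteq> j" for i j
        using union(1) that by (auto simp: disjoint_family_on_def)
      show "set_integrable plan (\<Union>i. A i \<times> UNIV) ?d"
        using int[of "\<Union>i. A i", OF _ intd] A by (auto simp: eq)
    qed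
    then show ?case
      using union.IH by (simp add: eq)
  qed
  with split[OF assms] show ?thesis by simp
qed

text \<open>The events generated by the first coordinate are the strips
  \<open>B \<times> UNIV\<close>, so equal integrals over strips characterise the conditional
  expectation.\<close>

lemma plan_martingale: "plan \<in> martingale_plans \<mu> \<nu>"
proof -
  let ?F = "vimage_algebra (space plan) fst borel"
  have sets_F: "sets ?F = {B \<times> UNIV | B. B \<in> sets borel}"
    by (auto simp: sets_vimage_algebra2 space_plan vimage_fst)
  have sub: "subalgebra plan ?F"
    unfolding subalgebra_def sets_F using rect_sets by (auto simp: sets_plan)
  interpret finite_measure_subalgebra plan ?F
    using sub by unfold_locales
  have "AE z in plan. real_cond_exp plan ?F snd z = fst z"
  proof (rule real_cond_exp_charact)
    fix A assume "A \<in> sets ?F"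
    then show "(LINT z:A|plan. snd z) = (LINT z:A|plan. fst z)"
      unfolding sets_F using set_integral_martingale by auto
  next
    show "fst \<in> borel_measurable ?F"
      by (intro measurable_vimage_algebra1) (simp add: space_plan)
  qed (rule integrable_fst_snd)+
  then show ?thesis
    by (simp add: martingale_plans_def sets_plan plan.prob_space_axioms fst_plan snd_plan)
qed

section \<open>Existence and uniqueness of the left-curtain coupling\<close>

lemma is_left_curtain_plan: "is_left_curtain \<mu> \<nu> plan"
  unfolding is_left_curtain_def
  by (auto simp: plan_martingale fst_restrict_plan snd_restrict_plan)

text \<open>The defining property prescribes the second marginals over all half lines, hence the
  mass of every \<open>{..x} \<times> B\<close>, and these sets determine a plan.\<close>

lemma Curt_eq: "Curt \<mu> \<nu> = plan"
  unfolding Curt_def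
proof (rule the_equality)
  show "is_left_curtain \<mu> \<nu> plan" by (rule is_left_curtain_plan)
  fix \<pi> assume lc: "is_left_curtain \<mu> \<nu> \<pi>"
  then have \<pi>: "sets \<pi> = sets borel" "prob_space \<pi>"
    by (auto simp: is_left_curtain_def martingale_plans_def)
  show "\<pi> = plan"
  proof (rule measure_eqI_rectangles[OF \<pi>(1) sets_plan])
    show "finite_measure \<pi>" using \<pi>(2) by (simp add: prob_space_def)
    show "finite_measure plan" by (rule plan.finite_measure_axioms)
    fix x and B :: "real set" assume B: "B \<in> sets borel"
    have "emeasure \<pi> ({..x} \<times> B) = emeasure (snd_marginal (restrict_meas \<pi> ({..x} \<times> UNIV))) B"
      by (rule emeasure_snd_restrict[OF \<pi>(1) B, symmetric])
    also have "\<dots> = emeasure plan ({..x} \<times> B)"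
      using lc emeasure_plan_rect[OF B] by (simp add: is_left_curtain_def)
    finally show "emeasure \<pi> ({..x} \<times> B) = emeasure plan ({..x} \<times> B)" .
  qed
qed

lemma plan_moment: "plan \<in> finite_moment_probs"
proof -
  have "integrable plan (\<lambda>z. z)"
  proof (rule Bochner_Integration.integrable_bound)
    show "integrable plan (\<lambda>z. \<bar>fst z\<bar> + \<bar>snd z\<bar>)"
      using integrable_fst_snd by (intro Bochner_Integration.integrable_add integrable_abs)
    show "AE z in plan. norm z \<le> norm (\<bar>fst z\<bar> + \<bar>snd z\<bar>)"
    proof (rule AE_I2)
      fix z :: "real \<times> real"
      show "norm z \<le> norm (\<bar>fst z\<bar> + \<bar>snd z\<bar>)"
        using norm_Pair_le[of "fst z" "snd z"] by simp
    qed
  qed (simp add: measurable_plan)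
  then show ?thesis
    by (simp add: finite_moment_probs_def finite_moment_measures_def sets_plan
        plan.prob_space_axioms plan.finite_measure_axioms)
qed

end

section \<open>The bound on \<open>Z\<close>\<close>

theorem W_curtain_shadow_le:
  assumes "curtain \<mu> \<nu>" "curtain \<mu>' \<nu>'" and s: "0 \<le> s" "s \<le> 1"
  shows "W (curtain.\<eta> \<mu> \<nu> s) (curtain.\<eta> \<mu>' \<nu>' s) \<le> W \<mu> \<mu>' + 2 * W \<nu> \<nu>'"
proof -
  interpret A: curtain \<mu> \<nu> by fact
  interpret B: curtain \<mu>' \<nu>' by fact
  have m: "mass \<nu> = mass \<nu>'"
    using A.emeasure_space_1 B.emeasure_space_1
    by (simp add: mass_def measure_def finite_momentD(3)[OF A.\<nu>_moment] finite_momentD(3)[OF B.\<nu>_moment])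
  have "W (A.\<eta> s) (B.\<eta> s) \<le> W (part \<mu> 0 s) (part \<mu>' 0 s) + 2 * W \<nu> \<nu>'"
    unfolding A.\<eta>_def B.\<eta>_def
    using s by (intro W_shadow_le[OF A.shadow_data_part B.shadow_data_part]) (auto simp: mass_part A.\<mu> B.\<mu>
        m)
  also have "\<dots> \<le> W \<mu> \<mu>' + 2 * W \<nu> \<nu>'"
    by (intro add_right_mono W_part_le A.\<mu> B.\<mu> s)
  finally show ?thesis .
qed

theorem Z_Curt_le:
  assumes "(\<mu>, \<nu>) \<in> convex_ordered_pairs" "(\<mu>', \<nu>') \<in> convex_ordered_pairs"
  shows "Z (Curt \<mu> \<nu>) (Curt \<mu>' \<nu>') \<le> W \<mu> \<mu>' + 2 * W \<nu> \<nu>'"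
proof -
  interpret A: curtain \<mu> \<nu> using assms by unfold_locales
  interpret B: curtain \<mu>' \<nu>' using assms by unfold_locales
  have "Z A.plan B.plan \<le> (SUP s\<in>{0..1}. max (W (fst_marginal (A.slice s)) (fst_marginal (B.slice s)))
                        (W (snd_marginal (A.slice s)) (snd_marginal (B.slice s))))"
    unfolding Z_def
    by (rule INF_lower2[of "(A.slice, B.slice)"]) (auto simp: A.admissible_slice B.admissible_slice)
  also have "\<dots> \<le> W \<mu> \<mu>' + 2 * W \<nu> \<nu>'"
  proof (rule SUP_least)
    fix s :: real assume s: "s \<in> {0..1}"
    have "W (part \<mu> 0 s) (part \<mu>' 0 s) \<le> W \<mu> \<mu>' + 2 * W \<nu> \<nu>'"
      using s by (intro add_increasing2 W_part_le A.\<mu> B.\<mu>) auto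
    then show "max (W (fst_marginal (A.slice s)) (fst_marginal (B.slice s)))
        (W (snd_marginal (A.slice s)) (snd_marginal (B.slice s))) \<le> W \<mu> \<mu>' + 2 * W \<nu> \<nu>'"
      using s W_curtain_shadow_le[OF A.curtain_axioms B.curtain_axioms, of s]
      by (simp add: A.fst_slice B.fst_slice A.snd_slice B.snd_slice)
  qed
  finally show ?thesis
    by (simp add: A.Curt_eq B.Curt_eq)
qed

section \<open>Kantorovich metrics\<close>

text \<open>Covers both \<open>W\<close> and \<open>W_plane\<close>, so that the axioms of a metric
  are checked once.\<close>

definition kantorovich :: "('a::euclidean_space \<Rightarrow> real) \<Rightarrow> 'a measure \<Rightarrow> 'a measure \<Rightarrow> ennreal" where
  "kantorovich N M M' = (SUP f\<in>{f :: 'a \<Rightarrow> real. \<forall>x y. \<bar>f x - f y\<bar> \<le> N (x - y)}.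
     ennreal \<bar>(\<integral>x. f x \<partial>M) - (\<integral>x. f x \<partial>M')\<bar>)"

lemma W_eq_kantorovich: "W = kantorovich abs"
proof -
  have "1-lipschitz_on UNIV f \<longleftrightarrow> (\<forall>x y. \<bar>f x - f y\<bar> \<le> \<bar>x - y\<bar>)" for f :: "real \<Rightarrow> real"
    by (simp add: lipschitz_on_def dist_real_def)
  then show ?thesis
    by (intro ext) (simp add: W_def kantorovich_def)
qed

lemma W_plane_eq_kantorovich: "W_plane = kantorovich"
  by (intro ext) (simp add: W_plane_def kantorovich_def)

lemma borel_measurable_norm_lipschitz:
  fixes f :: "'a::euclidean_space \<Rightarrow> real"
  assumes f: "\<And>x y. \<bar>f x - f y\<bar> \<le> C * norm (x - y)"
  shows "f \<in> borel_measurable borel"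
proof -
  \<comment> \<open>The sign of \<open>C\<close> follows from testing with a vector of positive
    norm.\<close>
  have "0 \<le> C * norm (One :: 'a)"
    using f[of One 0] by (metis abs_ge_zero diff_zero order_trans)
  then have "0 \<le> C"
    by (simp add: zero_le_mult_iff)
  with f have "C-lipschitz_on UNIV f"
    by (auto intro!: lipschitz_onI simp: dist_norm)
  then show ?thesis
    by (intro borel_measurable_continuous_onI lipschitz_on_continuous_on)
qed

text \<open>Indicators of non-empty closed sets are pointwise limits of the Lipschitz functions
  \<open>max 0 (1 - real n * infdist x A)\<close>, and closed sets form an intersection-stable
  generator.\<close>

lemma measure_eqI_lipschitz:
  fixes M M' :: "'a::euclidean_space measure"
  assumes M: "sets M = sets borel" "finite_measure M" and M': "sets M' = sets borel" "finite_measure M'"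
    and eq: "\<And>f L. L-lipschitz_on UNIV f \<Longrightarrow> (\<integral>x. f x \<partial>M) = (\<integral>x. (f x :: real) \<partial>M')"
  shows "M = M'"
proof (rule measure_eqI_generator_eq[where E = "Collect closed" and \<Omega> = UNIV and A = "\<lambda>_. UNIV"])
  have lim: "(\<lambda>n. \<integral>x. max 0 (1 - real n * infdist x A) \<partial>K) \<longlonglongrightarrow> measure K A"
    if K: "sets K = sets borel" "finite_measure K" and A: "closed A" "A \<noteq> {}" for K :: "'a measure" and A
  proof -
    interpret finite_measure K by fact
    have sp: "space K = UNIV"
      using sets_eq_imp_space_eq[OF K(1)] by simp
    have m: "borel_measurable K = borel_measurable borel"
      by (rule measurable_cong_sets[OF K(1) refl])
    have "(\<lambda>n. \<integral>x. max 0 (1 - real n * infdist x A) \<partial>K) \<longlonglongrightarrow> (\<integral>x. indicator A x \<partial>K)"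
    proof (rule integral_dominated_convergence[where w = "\<lambda>_. 1"])
      have "(\<lambda>n. max 0 (1 - real n * infdist x A)) \<longlonglongrightarrow> indicator A x" for x
      proof (rule tendsto_eventually)
        show "\<forall>\<^sub>F n in sequentially. max 0 (1 - real n * infdist x A) = indicator A x"
        proof (cases "x \<in> A")
          case False
          then have pos: "infdist x A > 0"
            using in_closed_iff_infdist_zero[OF A] infdist_nonneg[of x A] by (simp add: less_le)
          obtain n0 where "1 / infdist x A \<le> real n0" using real_arch_simple by blast
          then have n0: "1 \<le> real n0 * infdist x A"
            using pos by (simp add: field_simps)
          show ?thesis
          proof (rule eventually_mono[OF eventually_ge_at_top[of n0]])
            fix n assume "n0 \<le> n"
            then have "real n0 * infdist x A \<le> real n * infdist x A"
              using pos by (intro mult_right_mono) auto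
            with n0 False show "max 0 (1 - real n * infdist x A) = indicator A x"
              by simp
          qed
        qed simp
      qed
      then show "AE x in K. (\<lambda>n. max 0 (1 - real n * infdist x A)) \<longlonglongrightarrow> indicator A x"
        by simp
      show "AE x in K. norm (max 0 (1 - real n * infdist x A)) \<le> 1" for n
        by (auto simp: infdist_nonneg)
      show "(\<lambda>x. max 0 (1 - real n * infdist x A)) \<in> borel_measurable K" for n
        unfolding m by (intro borel_measurable_continuous_onI continuous_intros)
      show "indicator A \<in> borel_measurable K"
        unfolding m using A by (intro borel_measurable_indicator) auto
    qed simp
    then show ?thesis
      using A by (simp add: sp K(1))
  qed
  fix A :: "'a set" assume "A \<in> Collect closed"
  then have A: "closed A" by simp
  show "emeasure M A = emeasure M' A"
  proof (cases "A = {}")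
    case False
    have lip: "(real n)-lipschitz_on UNIV (\<lambda>x. max 0 (1 - real n * infdist x A))" for n
    proof (rule lipschitz_onI)
      fix x y :: 'a
      have "real n * \<bar>infdist x A - infdist y A\<bar> \<le> real n * dist x y"
        by (intro mult_left_mono infdist_triangle_abs) auto
      then have "\<bar>real n * infdist x A - real n * infdist y A\<bar> \<le> real n * dist x y"
        by (simp add: abs_mult flip: right_diff_distrib)
      then show "dist (max 0 (1 - real n * infdist x A)) (max 0 (1 - real n * infdist y A)) \<le> real n * dist
          x y"
        by (auto simp: dist_real_def max_def)
    qed simp
    have "measure M A = measure M' A"
      using LIMSEQ_unique[OF lim[OF M A False]] lim[OF M' A False] by (simp add: eq[OF lip])
    then show ?thesis
      using M(2) M'(2) by (simp add: finite_measure.emeasure_eq_measure)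
  qed simp
next
  show "Int_stable (Collect (closed :: 'a set \<Rightarrow> bool))"
    by (auto simp: Int_stable_def)
  have "sets (borel :: 'a measure) = sigma_sets UNIV (Collect closed)"
    by (subst borel_eq_closed) simp
  then show "sets M = sigma_sets UNIV (Collect closed)" "sets M' = sigma_sets UNIV (Collect closed)"
    by (simp_all add: M M')
  show "emeasure M UNIV \<noteq> \<infinity>"
    using finite_measure.emeasure_finite[OF M(2)] by simp
qed auto

text \<open>Comparison with the Euclidean norm suffices for a metric: the upper bound makes test
  functions integrable, the lower bound supplies enough of them to separate measures, and the
  triangle inequality comes from the supremum.\<close>

locale norm_like =
  fixes N :: "'a::euclidean_space \<Rightarrow> real" and c C :: real
  assumes c: "c > 0" and lower: "\<And>x. c * norm x \<le> N x" and upper: "\<And>x. N x \<le> C * norm x"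
begin

lemma C: "0 \<le> C"
proof -
  have "0 \<le> C * norm (One :: 'a)"
    using order_trans[OF lower upper, of "One :: 'a"] c by (meson mult_nonneg_nonneg norm_ge_zero
        less_imp_le order_trans)
  then show ?thesis
    by (simp add: zero_le_mult_iff)
qed

lemma test_integrable:
  assumes M: "M \<in> finite_moment_measures" and f: "\<And>x y. \<bar>f x - f y\<bar> \<le> N (x - y)"
  shows "integrable M f"
proof (rule integrable_linear_growth[OF M])
  show "f \<in> borel_measurable borel"
    using order_trans[OF f upper] by (rule borel_measurable_norm_lipschitz)
  show "\<bar>f x\<bar> \<le> \<bar>f 0\<bar> + C * norm x" for x
    using order_trans[OF f upper, of x 0] by simp
qed

lemma kantorovich_finite:
  assumes M: "M \<in> finite_moment_probs" and M': "M' \<in> finite_moment_probs"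
  shows "kantorovich N M M' < \<top>"
proof -
  let ?B = "C * ((\<integral>x. norm x \<partial>M) + (\<integral>x. norm x \<partial>M'))"
  have "kantorovich N M M' \<le> ennreal ?B"
    unfolding kantorovich_def
  proof (rule SUP_least)
    fix f :: "'a \<Rightarrow> real" assume "f \<in> {f. \<forall>x y. \<bar>f x - f y\<bar> \<le> N (x - y)}"
    then have f: "\<bar>f x - f y\<bar> \<le> N (x - y)" for x y by simp
    have *: "\<bar>(\<integral>x. f x \<partial>K) - f 0\<bar> \<le> C * (\<integral>x. norm x \<partial>K)" if K: "K \<in> finite_moment_probs" for K
    proof -
      note Km = finite_moment_probsD(1)[OF K]
      interpret prob_space K by (rule finite_moment_probsD(2)[OF K])
      have "(\<integral>x. f x \<partial>K) - f 0 = (\<integral>x. f x - f 0 \<partial>K)"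
        using test_integrable[OF Km f] by (simp add: prob_space)
      also have "\<bar>\<dots>\<bar> \<le> (\<integral>x. \<bar>f x - f 0\<bar> \<partial>K)"
        using integral_norm_bound[of K "\<lambda>x. f x - f 0"] by simp
      also have "\<dots> \<le> (\<integral>x. C * norm x \<partial>K)"
        using test_integrable[OF Km f] finite_momentD(4)[OF Km] order_trans[OF f upper, of _ 0]
        by (intro integral_mono) auto
      finally show ?thesis by simp
    qed
    have "\<bar>(\<integral>x. f x \<partial>M) - (\<integral>x. f x \<partial>M')\<bar> \<le> ?B"
      using *[OF M] *[OF M'] by (simp add: distrib_left)
    then show "ennreal \<bar>(\<integral>x. f x \<partial>M) - (\<integral>x. f x \<partial>M')\<bar> \<le> ennreal ?B"
      by (rule ennreal_leI)
  qed
  also have "\<dots> < \<top>" by simp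
  finally show ?thesis .
qed

lemma kantorovich_commute: "kantorovich N M M' = kantorovich N M' M"
  unfolding kantorovich_def by (simp add: abs_minus_commute)

lemma kantorovich_triangle: "kantorovich N M M'' \<le> kantorovich N M M' + kantorovich N M' M''"
  unfolding kantorovich_def[of N M M'']
proof (rule SUP_least)
  fix f :: "'a \<Rightarrow> real" assume f: "f \<in> {f. \<forall>x y. \<bar>f x - f y\<bar> \<le> N (x - y)}"
  have "ennreal \<bar>(\<integral>x. f x \<partial>M) - (\<integral>x. f x \<partial>M'')\<bar> \<le>
      ennreal (\<bar>(\<integral>x. f x \<partial>M) - (\<integral>x. f x \<partial>M')\<bar> + \<bar>(\<integral>x. f x \<partial>M') - (\<integral>x. f x \<partial>M'')\<bar>)"
    by (intro ennreal_leI) linarith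
  also have "\<dots> = ennreal \<bar>(\<integral>x. f x \<partial>M) - (\<integral>x. f x \<partial>M')\<bar> + ennreal \<bar>(\<integral>x. f x \<partial>M') - (\<integral>x. f x \<partial>M'')\<bar>"
    by (simp add: ennreal_plus)
  also have "\<dots> \<le> kantorovich N M M' + kantorovich N M' M''"
    unfolding kantorovich_def by (intro add_mono SUP_upper f)
  finally show "ennreal \<bar>(\<integral>x. f x \<partial>M) - (\<integral>x. f x \<partial>M'')\<bar> \<le> kantorovich N M M' + kantorovich N M' M''" .
qed

lemma kantorovich_eq_0D:
  assumes M: "M \<in> finite_moment_probs" and M': "M' \<in> finite_moment_probs" and 0: "kantorovich N M M' = 0"
  shows "M = M'"
proof (rule measure_eqI_lipschitz)
  note m = finite_moment_probsD(1)[OF M] finite_moment_probsD(1)[OF M']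
  show "sets M = sets borel" "finite_measure M" "sets M' = sets borel" "finite_measure M'"
    using finite_momentD(1,2)[OF m(1)] finite_momentD(1,2)[OF m(2)] by auto
  fix f :: "'a \<Rightarrow> real" and L assume f: "L-lipschitz_on UNIV f"
  \<comment> \<open>This factor scales \<open>f\<close> to a test function for \<open>N\<close>;
    \<open>L + 1\<close> avoids a division by 0.\<close>
  define r where "r = c / (L + 1)"
  have L: "0 \<le> L" using lipschitz_on_nonneg[OF f] .
  then have r: "0 < r" using c by (simp add: r_def)
  have "\<bar>r * f x - r * f y\<bar> \<le> N (x - y)" for x y
  proof -
    have "\<bar>r * f x - r * f y\<bar> = r * \<bar>f x - f y\<bar>"
      using r by (simp add: abs_mult flip: right_diff_distrib)
    also have "\<dots> \<le> r * (L * norm (x - y))"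
      using r lipschitz_onD[OF f, of x y] by (intro mult_left_mono) (auto simp: dist_norm)
    also have "\<dots> \<le> r * ((L + 1) * norm (x - y))"
      using r by (intro mult_left_mono mult_right_mono) auto
    also have "\<dots> = c * norm (x - y)"
      using L by (simp add: r_def)
    also have "\<dots> \<le> N (x - y)" by (rule lower)
    finally show ?thesis .
  qed
  then have "ennreal \<bar>(\<integral>x. r * f x \<partial>M) - (\<integral>x. r * f x \<partial>M')\<bar> \<le> kantorovich N M M'"
    unfolding kantorovich_def by (intro SUP_upper) simp
  then have "(\<integral>x. r * f x \<partial>M) = (\<integral>x. r * f x \<partial>M')"
    by (simp add: 0)
  then show "(\<integral>x. f x \<partial>M) = (\<integral>x. f x \<partial>M')"
    using r by simp
qed

lemma Metric_space_kantorovich: "Metric_space finite_moment_probs (\<lambda>M M'. enn2real (kantorovich N M M'))"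
proof
  show "enn2real (kantorovich N M M') = enn2real (kantorovich N M' M)" for M M'
    by (simp add: kantorovich_commute)
  fix M M' M'' :: "'a measure"
  assume M: "M \<in> finite_moment_probs" and M': "M' \<in> finite_moment_probs"
  have "kantorovich N M M = 0"
    by (simp add: kantorovich_def) (simp add: bot_ennreal SUP_constant)
  then show "enn2real (kantorovich N M M') = 0 \<longleftrightarrow> M = M'"
    using kantorovich_finite[OF M M'] kantorovich_eq_0D[OF M M'] by (auto simp: enn2real_eq_0_iff)
  assume M'': "M'' \<in> finite_moment_probs"
  have "enn2real (kantorovich N M M'') \<le> enn2real (kantorovich N M M' + kantorovich N M' M'')"
    using kantorovich_finite[OF M M'] kantorovich_finite[OF M' M'']
    by (intro enn2real_mono kantorovich_triangle) simp
  also have "\<dots> = enn2real (kantorovich N M M') + enn2real (kantorovich N M' M'')"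
    using kantorovich_finite[OF M M'] kantorovich_finite[OF M' M''] by (intro enn2real_plus) auto
  finally show "enn2real (kantorovich N M M'') \<le> enn2real (kantorovich N M M') + enn2real (kantorovich N M'
      M'')" .
qed simp

end

section \<open>The absolute value on the line and arbitrary norms on the plane\<close>

interpretation abs: norm_like "abs :: real \<Rightarrow> real" 1 1
  by unfold_locales auto

text \<open>Equivalence of norms in the plane: the lower constant is the minimum of \<open>N\<close>
  on the Euclidean unit sphere. The bound by the sum of the coordinates is the form in which test
  functions are used later.\<close>

lemma is_norm_bounds:
  assumes "is_norm N"
  shows "\<exists>c C. norm_like N c C \<and> 0 < C \<and> (\<forall>z. N z \<le> C * (\<bar>fst z\<bar> + \<bar>snd z\<bar>))"
proof -
  have N0: "N x = 0 \<longleftrightarrow> x = 0" and Ns: "N (a *\<^sub>R x) = \<bar>a\<bar> * N x" and Nt: "N (x + y) \<le> N x + N y" for x y a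
    using assms unfolding is_norm_def by blast+
  have Npos: "0 \<le> N x" for x
    using Nt[of x "(-1) *\<^sub>R x"] Ns[of "-1" x] N0[of 0] by simp
  define C where "C = N (1, 0) + N (0, 1) + 1"
  have Cpos: "0 < C"
    using Npos[of "(1, 0)"] Npos[of "(0, 1)"] by (simp add: C_def)
  have C: "N z \<le> C * (\<bar>fst z\<bar> + \<bar>snd z\<bar>)" for z
  proof -
    have "N z = N (fst z *\<^sub>R (1, 0) + snd z *\<^sub>R (0, 1))"
      by (cases z) simp
    also have "\<dots> \<le> \<bar>fst z\<bar> * N (1, 0) + \<bar>snd z\<bar> * N (0, 1)"
      using Nt[of "fst z *\<^sub>R (1, 0)" "snd z *\<^sub>R (0, 1)"] by (simp only: Ns)
    also have "\<dots> \<le> \<bar>fst z\<bar> * C + \<bar>snd z\<bar> * C"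
      using Npos[of "(1, 0)"] Npos[of "(0, 1)"] by (intro add_mono mult_left_mono) (auto simp: C_def)
    finally show ?thesis by (simp add: algebra_simps)
  qed
  have le_norm: "\<bar>fst z\<bar> + \<bar>snd z\<bar> \<le> 2 * norm z" for z :: "real \<times> real"
    using norm_fst_le[of "fst z" "snd z"] norm_snd_le[of "snd z" "fst z"] by simp
  have upper: "N z \<le> (2 * C) * norm z" for z
    using order_trans[OF C mult_left_mono[OF le_norm]] Cpos by (simp add: algebra_simps)
  have "continuous_on UNIV N"
  proof (rule lipschitz_on_continuous_on)
    show "(2 * C)-lipschitz_on UNIV N"
    proof (rule lipschitz_onI)
      fix x y
      have "N x - N y \<le> N (x - y)" "N y - N x \<le> N (y - x)"
        using Nt[of "x - y" y] Nt[of "y - x" x] by simp_all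
      then show "dist (N x) (N y) \<le> 2 * C * dist x y"
        using upper[of "x - y"] upper[of "y - x"] by (auto simp: dist_real_def dist_norm norm_minus_commute
            abs_le_iff)
    qed (use Cpos in simp)
  qed
  then obtain w where w: "w \<in> sphere 0 1" "\<And>z. z \<in> sphere 0 1 \<Longrightarrow> N w \<le> N z"
    using continuous_attains_inf[of "sphere (0 :: real \<times> real) 1" N]
    by (metis compact_sphere continuous_on_subset sphere_eq_empty top_greatest zero_le_one
        not_one_less_zero)
  have c: "N w > 0"
    using Npos[of w] N0[of w] w(1) by (auto simp: less_le)
  have lower: "N w * norm z \<le> N z" for z
  proof (cases "z = 0")
    case False
    have "N w \<le> N ((1 / norm z) *\<^sub>R z)"
      using False by (intro w(2)) simp
    then show ?thesis
      using False by (simp only: Ns) (simp add: field_simps)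
  qed (use Npos in simp)
  have "norm_like N (N w) (2 * C)"
    using c lower upper by unfold_locales
  moreover have "N z \<le> 2 * C * (\<bar>fst z\<bar> + \<bar>snd z\<bar>)" for z
  proof -
    have "0 \<le> C * (\<bar>fst z\<bar> + \<bar>snd z\<bar>)"
      using Cpos by simp
    then show ?thesis
      using C[of z] by linarith
  qed
  ultimately show ?thesis
    using Cpos by (intro exI[of _ "N w"] exI[of _ "2 * C"]) auto
qed

section \<open>Continuity of the left-curtain coupling\<close>

text \<open>Bounds the error of rounding \<open>q\<close> to \<open>grid k\<close>: the mesh width
  inside \<open>[-k, k]\<close>, and at most \<bar>q\<bar> more outside, where \<open>q\<close> is
  moved to an end of the grid.\<close>

definition tail :: "nat \<Rightarrow> real \<Rightarrow> real" where
  "tail k q = 1 / real k + (if real k \<le> \<bar>q\<bar> then \<bar>q\<bar> else 0)"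

text \<open>Rounding \<open>q\<close> up to a grid point \<open>grid k j\<close> is a sum of indicators of half lines.\<close>

lemma rounding:
  assumes "k > 0"
  shows "\<exists>j. (\<forall>\<phi> :: real \<Rightarrow> real. \<phi> (grid k 0) + (\<Sum>i<2 * k * k. of_bool (grid k i < q) * (\<phi> (grid k (Suc i))
      - \<phi> (grid k i)))
      = \<phi> (grid k j)) \<and> \<bar>q - grid k j\<bar> \<le> tail k q"
proof -
  define T where "T = (\<lambda>n (\<phi> :: real \<Rightarrow> real). \<phi> (grid k 0) + (\<Sum>i<n. of_bool (grid k i < q) * (\<phi> (grid k (Suc
      i)) - \<phi> (grid k i))))"
  have all: "T n \<phi> = \<phi> (grid k n)" if "\<And>i. i < n \<Longrightarrow> grid k i < q" for n \<phi>
  proof -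
    have "(\<Sum>i<n. of_bool (grid k i < q) * (\<phi> (grid k (Suc i)) - \<phi> (grid k i))) = (\<Sum>i<n. \<phi> (grid k (Suc i)) -
        \<phi> (grid k i))"
      using that by (intro sum.cong) auto
    then show ?thesis
      by (simp add: T_def sum_lessThan_telescope[of "\<lambda>i. \<phi> (grid k i)"])
  qed
  have mono: "grid k i \<le> grid k j" if "i \<le> j" for i j
    using lift_Suc_mono_le[of "grid k", OF _ that] by (simp add: grid_simps)
  \<comment> \<open>Induction on the number of cells: \<open>q\<close> lies left of the grid, beyond
    its current last point, or in the cell that ends at \<open>grid k j\<close>.\<close>
  have ex: "\<exists>j. (\<forall>\<phi>. T n \<phi> = \<phi> (grid k j)) \<and>
      (q \<le> grid k 0 \<and> j = 0 \<or> grid k n < q \<and> j = n \<or> grid k j - 1 / real k \<le> q \<and> q \<le> grid k j)" for n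
  proof (induction n)
    case 0
    show ?case by (intro exI[of _ 0]) (auto simp: T_def)
  next
    case (Suc n)
    show ?case
    proof (cases "grid k n < q")
      case True
      have "T (Suc n) \<phi> = \<phi> (grid k (Suc n))" for \<phi>
      proof (rule all)
        fix i assume "i < Suc n"
        then show "grid k i < q" using mono[of i n] True by simp
      qed
      then show ?thesis
        using True by (intro exI[of _ "Suc n"]) (auto simp: grid_simps)
    next
      case False
      then have "of_bool (grid k n < q) = (0 :: real)" by simp
      then have "T (Suc n) \<phi> = T n \<phi>" for \<phi>
        by (simp only: T_def sum.lessThan_Suc mult_zero_left add_0_right)
      with Suc False show ?thesis by auto
    qed
  qed
  obtain j where j: "\<And>\<phi>. T (2 * k * k) \<phi> = \<phi> (grid k j)"
    "q \<le> grid k 0 \<and> j = 0 \<or> grid k (2 * k * k) < q \<and> j = 2 * k * k \<or> grid k j - 1 / real k \<le> q \<and> q \<le> grid k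
        j"
    using ex[of "2 * k * k"] by blast
  define r where "r = 1 / real k"
  have "0 < r" using assms by (simp add: r_def)
  then have "\<bar>q - grid k j\<bar> \<le> tail k q"
    using j(2) unfolding tail_def r_def[symmetric] by (auto simp: grid_simps abs_if)
  with j(1) show ?thesis
    unfolding T_def by blast
qed

lemma tail_nonneg: "0 \<le> tail k q"
  by (simp add: tail_def)

lemma tail_le: "tail k q \<le> 1 + \<bar>q\<bar>"
proof -
  have "1 / real k \<le> 1"
    by (cases "k = 0") (auto simp: field_simps)
  moreover have "tail k q \<le> 1 / real k + \<bar>q\<bar>"
    by (simp add: tail_def)
  ultimately show ?thesis by linarith
qed

lemma integrable_tail: "\<mu> \<in> finite_moment_measures \<Longrightarrow> integrable \<mu> (tail k)"
  by (rule integrable_linear_growth[of _ _ "1 / real k" 1]) (auto simp: tail_def[abs_def])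

lemma tail_tendsto:
  assumes \<mu>: "\<mu> \<in> finite_moment_measures"
  shows "(\<lambda>k. \<integral>q. tail k q \<partial>\<mu>) \<longlonglongrightarrow> 0"
proof -
  have "(\<lambda>k. \<integral>q. tail k q \<partial>\<mu>) \<longlonglongrightarrow> (\<integral>q. 0 \<partial>\<mu>)"
  proof (rule integral_dominated_convergence[where w = "\<lambda>q. 1 + \<bar>q\<bar>"])
    have "(\<lambda>k. tail k q) \<longlonglongrightarrow> 0" for q
    proof (rule Lim_transform_eventually[OF lim_const_over_n[of 1]])
      obtain k0 where "\<bar>q\<bar> < real k0" using reals_Archimedean2 by blast
      then show "\<forall>\<^sub>F k in sequentially. 1 / real k = tail k q"
        by (intro eventually_mono[OF eventually_ge_at_top[of k0]]) (auto simp: tail_def)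
    qed
    then show "AE q in \<mu>. (\<lambda>k. tail k q) \<longlonglongrightarrow> 0" by simp
    show "AE q in \<mu>. norm (tail k q) \<le> 1 + \<bar>q\<bar>" for k
      using tail_le[of k] tail_nonneg[of k] by simp
    show "integrable \<mu> (\<lambda>q. 1 + \<bar>q\<bar>)"
      using finite_momentD(4)[OF \<mu>] integrable_const_moment[OF \<mu>] by auto
    show "tail k \<in> borel_measurable \<mu>" for k
      using integrable_tail[OF \<mu>] by auto
  qed simp
  then show ?thesis by simp
qed

lemma lipschitz_integral_diff_le:
  assumes \<phi>: "L-lipschitz_on UNIV \<phi>" and W: "W M M' \<le> ennreal w" and "0 \<le> w" and "0 < L"
  shows "\<bar>(\<integral>x. \<phi> x \<partial>M) - (\<integral>x. \<phi> x \<partial>M')\<bar> \<le> L * w"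
proof -
  have "1-lipschitz_on UNIV (\<lambda>x. \<phi> x / L)"
    using lipschitz_onD[OF \<phi>] \<open>0 < L\<close>
    by (intro lipschitz_onI) (auto simp: dist_real_def field_simps simp flip: diff_divide_distrib)
  then have "ennreal \<bar>(\<integral>x. \<phi> x / L \<partial>M) - (\<integral>x. \<phi> x / L \<partial>M')\<bar> \<le> ennreal w"
    using W_ge_lipschitz W by (meson order_trans)
  then have "\<bar>(\<integral>x. \<phi> x / L \<partial>M) - (\<integral>x. \<phi> x / L \<partial>M')\<bar> \<le> w"
    using \<open>0 \<le> w\<close> by simp
  then show ?thesis
    using \<open>0 < L\<close> by (simp add: field_simps flip: diff_divide_distrib)
qed

section \<open>Integrals against the joint law of level and second coordinate\<close>

context curtain
begin

text \<open>The level is uniform, so any law can be produced from it. Later the quantile function of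
  one first marginal is combined with the joint law belonging to another pair.\<close>

lemma quantile_fst_\<theta>:
  assumes \<mu>0: "\<mu>\<^sub>0 \<in> finite_moment_probs"
  shows "distr \<theta> borel (\<lambda>z. quantile \<mu>\<^sub>0 (fst z)) = \<mu>\<^sub>0"
proof -
  have "distr \<theta> borel (\<lambda>z. quantile \<mu>\<^sub>0 (fst z)) = distr (distr \<theta> borel fst) borel (quantile \<mu>\<^sub>0)"
    using measurable_quantile[OF \<mu>0] by (subst distr_distr) (auto simp: measurable_\<theta> comp_def)
  also have "\<dots> = part \<mu>\<^sub>0 0 1"
    by (simp add: fst_\<theta> part_def)
  finally show ?thesis
    by (simp add: part_0_1[OF \<mu>0])
qed

lemma measurable_quantile_fst:
  assumes "\<mu>\<^sub>0 \<in> finite_moment_probs"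
  shows "(\<lambda>z::real \<times> real. quantile \<mu>\<^sub>0 (fst z)) \<in> borel_measurable borel"
  using measurable_compose[OF borel_measurable_fst_snd(1) measurable_quantile[OF assms]] .

lemma integral_quantile_fst:
  fixes f :: "real \<Rightarrow> real"
  assumes \<mu>0: "\<mu>\<^sub>0 \<in> finite_moment_probs" and f: "integrable \<mu>\<^sub>0 f"
  shows "integrable \<theta> (\<lambda>z. f (quantile \<mu>\<^sub>0 (fst z)))"
    and "(\<integral>z. f (quantile \<mu>\<^sub>0 (fst z)) \<partial>\<theta>) = (\<integral>x. f x \<partial>\<mu>\<^sub>0)"
proof -
  have m: "(\<lambda>z. quantile \<mu>\<^sub>0 (fst z)) \<in> measurable \<theta> borel" "f \<in> borel_measurable borel"
    using measurable_quantile_fst[OF \<mu>0] f finite_moment_measurable[OF finite_moment_probsD(1)[OF \<mu>0]]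
    by (auto simp: measurable_\<theta>)
  show "integrable \<theta> (\<lambda>z. f (quantile \<mu>\<^sub>0 (fst z)))"
    using integrable_distr_eq[OF m] f by (simp add: quantile_fst_\<theta>[OF \<mu>0])
  show "(\<integral>z. f (quantile \<mu>\<^sub>0 (fst z)) \<partial>\<theta>) = (\<integral>x. f x \<partial>\<mu>\<^sub>0)"
    using integral_distr[OF m] by (simp add: quantile_fst_\<theta>[OF \<mu>0])
qed

lemma snd_restrict_\<theta>:
  assumes c: "0 \<le> c" "c \<le> 1"
  shows "snd_marginal (restrict_meas \<theta> ({..c} \<times> UNIV)) = \<eta> c"
  using c by (intro measure_eqI) (auto simp: emeasure_snd_restrict[OF \<theta>(1)] \<theta>(3) sets_\<eta>)

lemma integral_atMost:
  fixes \<phi> :: "real \<Rightarrow> real"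
  assumes c: "0 \<le> c" "c \<le> 1" and \<phi>: "L-lipschitz_on UNIV \<phi>"
  shows "integrable \<theta> (\<lambda>z. indicator ({..c} \<times> UNIV) z * \<phi> (snd z))"
    and "(\<integral>z. indicator ({..c} \<times> UNIV) z * \<phi> (snd z) \<partial>\<theta>) = (\<integral>x. \<phi> x \<partial>\<eta> c)"
proof -
  let ?R = "restrict_meas \<theta> ({..c} \<times> UNIV)"
  have m: "snd \<in> measurable ?R borel" "\<phi> \<in> borel_measurable borel"
    using lipschitz_borel_measurable[OF \<phi>] by (auto simp: measurable_restrict_meas measurable_\<theta>)
  have m': "(\<lambda>z. \<phi> (snd z)) \<in> borel_measurable \<theta>"
    using measurable_compose[OF borel_measurable_fst_snd(2) m(2)] by (simp add: measurable_\<theta>)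
  have R: "?R = density \<theta> (\<lambda>z. ennreal (indicator ({..c} \<times> UNIV) z))"
    by (simp add: restrict_meas_def ennreal_indicator)
  have ind: "indicator ({..c} \<times> UNIV) \<in> borel_measurable \<theta>"
    using rect_sets[of "{..c}" UNIV] by (intro borel_measurable_indicator) (auto simp: \<theta>(1))
  have "integrable (\<eta> c) \<phi>"
    using integrable_lipschitz[OF \<eta>_moment[OF c] \<phi>] .
  then have "integrable ?R (\<lambda>z. \<phi> (snd z))"
    using integrable_distr_eq[OF m] by (simp add: snd_restrict_\<theta>[OF c])
  then show "integrable \<theta> (\<lambda>z. indicator ({..c} \<times> UNIV) z * \<phi> (snd z))"
    unfolding R by (subst (asm) integrable_density) (use m' ind in auto)
  have "(\<integral>x. \<phi> x \<partial>\<eta> c) = (\<integral>z. \<phi> (snd z) \<partial>?R)"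
    using integral_distr[OF m] by (simp add: snd_restrict_\<theta>[OF c])
  also have "\<dots> = (\<integral>z. indicator ({..c} \<times> UNIV) z * \<phi> (snd z) \<partial>\<theta>)"
    unfolding R by (subst integral_density) (use m' ind in auto)
  finally show "(\<integral>z. indicator ({..c} \<times> UNIV) z * \<phi> (snd z) \<partial>\<theta>) = (\<integral>x. \<phi> x \<partial>\<eta> c)" by simp
qed

lemma integral_snd:
  fixes \<phi> :: "real \<Rightarrow> real"
  assumes \<phi>: "L-lipschitz_on UNIV \<phi>"
  shows "integrable \<theta> (\<lambda>z. \<phi> (snd z))" and "(\<integral>z. \<phi> (snd z) \<partial>\<theta>) = (\<integral>x. \<phi> x \<partial>\<nu>)"
proof -
  have m: "(\<lambda>z. \<phi> (snd z)) \<in> borel_measurable \<theta>"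
    using measurable_compose[OF borel_measurable_fst_snd(2) lipschitz_borel_measurable[OF \<phi>]]
    by (simp add: measurable_\<theta>)
  have ae: "AE z in \<theta>. indicator ({..1} \<times> UNIV) z * \<phi> (snd z) = \<phi> (snd z)"
    using AE_\<theta> by eventually_elim (auto simp: indicator_def mem_Times_iff)
  note i = integral_atMost[of 1, OF _ _ \<phi>]
  show "integrable \<theta> (\<lambda>z. \<phi> (snd z))"
    by (rule integrable_cong_AE_imp[OF i(1) m]) (use ae in auto)
  show "(\<integral>z. \<phi> (snd z) \<partial>\<theta>) = (\<integral>x. \<phi> x \<partial>\<nu>)"
    using integral_cong_AE[OF borel_measurable_integrable[OF i(1)] m ae] i(2) by (simp add: last_\<eta>)
qed

text \<open>Up to a null set the indicator is that of levels above
  \<open>cdf \<mu>\<^sub>0 x\<close>. Steps in the first coordinate are thus integrated by the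
  second marginals \<open>\<nu>\<close> and \<open>\<eta>\<close> alone, for which distance bounds
  are available.\<close>

lemma integral_step:
  fixes \<phi> :: "real \<Rightarrow> real"
  assumes \<mu>0: "\<mu>\<^sub>0 \<in> finite_moment_probs" and \<phi>: "L-lipschitz_on UNIV \<phi>"
  shows "integrable \<theta> (\<lambda>z. of_bool (x < quantile \<mu>\<^sub>0 (fst z)) * \<phi> (snd z))"
    and "(\<integral>z. of_bool (x < quantile \<mu>\<^sub>0 (fst z)) * \<phi> (snd z) \<partial>\<theta>) = (\<integral>x. \<phi> x \<partial>\<nu>) - (\<integral>y. \<phi> y \<partial>\<eta> (cdf \<mu>\<^sub>0 x))"
proof -
  interpret m: cdf_distribution \<mu>\<^sub>0 using cdf_distributionI[OF \<mu>0] .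
  define c where "c = cdf \<mu>\<^sub>0 x"
  have c: "0 \<le> c" "c \<le> 1"
    using m.cdf_nonneg m.cdf_bounded_prob by (auto simp: c_def)
  note i = integral_snd[OF \<phi>] integral_atMost[OF c \<phi>]
  have "(\<lambda>z::real \<times> real. of_bool (x < quantile \<mu>\<^sub>0 (fst z)) * \<phi> (snd z)) \<in> borel_measurable borel"
  proof -
    note [measurable] = measurable_quantile_fst[OF \<mu>0]
      measurable_compose[OF borel_measurable_fst_snd(2) lipschitz_borel_measurable[OF \<phi>]]
    show ?thesis by measurable
  qed
  then have m: "(\<lambda>z. of_bool (x < quantile \<mu>\<^sub>0 (fst z)) * \<phi> (snd z)) \<in> borel_measurable \<theta>"
    by (simp add: measurable_\<theta>)
  have int: "integrable \<theta> (\<lambda>z. \<phi> (snd z) - indicator ({..c} \<times> UNIV) z * \<phi> (snd z))"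
    using i by simp
  have ae: "AE z in \<theta>. \<phi> (snd z) - indicator ({..c} \<times> UNIV) z * \<phi> (snd z) = of_bool (x < quantile \<mu>\<^sub>0 (fst
      z)) * \<phi> (snd z)"
    using AE_\<theta>
  proof eventually_elim
    case (elim z)
    then have "fst z \<le> c \<longleftrightarrow> \<not> x < quantile \<mu>\<^sub>0 (fst z)"
      using quantile_le_iff[OF \<mu>0, of "fst z" x] by (auto simp: c_def)
    then show ?case by (cases z) (auto simp: indicator_def)
  qed
  show "integrable \<theta> (\<lambda>z. of_bool (x < quantile \<mu>\<^sub>0 (fst z)) * \<phi> (snd z))"
    by (rule integrable_cong_AE_imp[OF int m]) (use ae in auto)
  have "(\<integral>z. of_bool (x < quantile \<mu>\<^sub>0 (fst z)) * \<phi> (snd z) \<partial>\<theta>) = (\<integral>z. \<phi> (snd z) - indicator ({..c} \<times> UNIV)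
      z * \<phi> (snd z) \<partial>\<theta>)"
    using integral_cong_AE[OF borel_measurable_integrable[OF int] m ae] by simp
  also have "\<dots> = (\<integral>x. \<phi> x \<partial>\<nu>) - (\<integral>y. \<phi> y \<partial>\<eta> c)"
    using i by simp
  finally show "(\<integral>z. of_bool (x < quantile \<mu>\<^sub>0 (fst z)) * \<phi> (snd z) \<partial>\<theta>) = (\<integral>x. \<phi> x \<partial>\<nu>) - (\<integral>y. \<phi> y \<partial>\<eta> (cdf
      \<mu>\<^sub>0 x))"
    by (simp add: c_def)
qed

end

text \<open>The Lipschitz condition is taken with the sum of the coordinate distances, so that the
  two coordinates can be varied separately.\<close>

locale test_function =
  fixes g :: "real \<times> real \<Rightarrow> real" and C :: real
  assumes C: "0 < C" and g: "\<And>z z'. \<bar>g z - g z'\<bar> \<le> C * (\<bar>fst z - fst z'\<bar> + \<bar>snd z - snd z'\<bar>)"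
begin

lemma measurable_g: "g \<in> borel_measurable borel"
proof (rule borel_measurable_norm_lipschitz)
  fix z z' :: "real \<times> real"
  have "\<bar>fst z - fst z'\<bar> + \<bar>snd z - snd z'\<bar> \<le> 2 * norm (z - z')"
    using norm_fst_le[of "fst (z - z')" "snd (z - z')"] norm_snd_le[of "snd (z - z')" "fst (z - z')"]
    by (simp add: minus_prod_def)
  then have "C * (\<bar>fst z - fst z'\<bar> + \<bar>snd z - snd z'\<bar>) \<le> C * (2 * norm (z - z'))"
    using C by (intro mult_left_mono) auto
  with g[of z z'] show "\<bar>g z - g z'\<bar> \<le> (2 * C) * norm (z - z')"
    by simp
qed

lemma lipschitz_section: "C-lipschitz_on UNIV (\<lambda>y. g (x, y))"
  using g[of "(x, _)" "(x, _)"] C by (intro lipschitz_onI) (auto simp: dist_real_def)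

lemma lipschitz_section_diff: "(2 * C)-lipschitz_on UNIV (\<lambda>y. g (x', y) - g (x, y))"
proof (rule lipschitz_onI)
  fix y y' :: real
  show "dist (g (x', y) - g (x, y)) (g (x', y') - g (x, y')) \<le> 2 * C * dist y y'"
    using g[of "(x', y)" "(x', y')"] g[of "(x, y)" "(x, y')"] by (auto simp: dist_real_def)
qed (use C in simp)

text \<open>The function \<open>g\<close> with its first argument rounded to the grid, written with
  indicators of half lines so that \<open>integral_step\<close> applies term by term.\<close>

definition step :: "nat \<Rightarrow> real \<Rightarrow> real \<Rightarrow> real" where
  "step k q y = g (grid k 0, y) +
    (\<Sum>i<2 * k * k. of_bool (grid k i < q) * (g (grid k (Suc i), y) - g (grid k i, y)))"

lemma step_close:
  assumes "k > 0"
  shows "\<bar>g (q, y) - step k q y\<bar> \<le> C * tail k q"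
proof -
  obtain j where r: "\<forall>\<phi> :: real \<Rightarrow> real. \<phi> (grid k 0) +
        (\<Sum>i<2 * k * k. of_bool (grid k i < q) * (\<phi> (grid k (Suc i)) - \<phi> (grid k i))) = \<phi> (grid k j)"
      and j2: "\<bar>q - grid k j\<bar> \<le> tail k q"
    using rounding[OF assms, of q] by blast
  have j: "step k q y = g (grid k j, y)"
    using spec[OF r, of "\<lambda>x. g (x, y)"] by (simp only: step_def)
  have "\<bar>g (q, y) - step k q y\<bar> \<le> C * \<bar>q - grid k j\<bar>"
    using g[of "(q, y)" "(grid k j, y)"] by (simp add: j)
  also have "\<dots> \<le> C * tail k q"
    using C j2 by (intro mult_left_mono) auto
  finally show ?thesis .
qed

lemma integrable_plan_test:
  assumes "curtain \<mu> \<nu>" and \<mu>0: "\<mu>\<^sub>0 \<in> finite_moment_probs"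
  shows "integrable (curtain.\<theta> \<mu> \<nu>) (\<lambda>z. g (quantile \<mu>\<^sub>0 (fst z), snd z))"
proof -
  interpret curtain \<mu> \<nu> by fact
  have "(\<lambda>z::real \<times> real. (quantile \<mu>\<^sub>0 (fst z), snd z)) \<in> borel_measurable borel"
    unfolding borel_prod[symmetric]
    using measurable_quantile_fst[OF \<mu>0] by (intro measurable_Pair) (auto simp: borel_prod)
  from measurable_compose[OF this measurable_g]
  have m: "(\<lambda>z. g (quantile \<mu>\<^sub>0 (fst z), snd z)) \<in> borel_measurable \<theta>"
    by (simp add: measurable_\<theta>)
  have 1: "integrable \<theta> (\<lambda>z. \<bar>quantile \<mu>\<^sub>0 (fst z)\<bar>)"
    using integral_quantile_fst(1)[OF \<mu>0, of abs] finite_momentD(4)[OF finite_moment_probsD(1)[OF \<mu>0]] by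
        simp
  have "1-lipschitz_on UNIV (abs :: real \<Rightarrow> real)"
    by (rule lipschitz_onI) (auto simp: dist_real_def)
  then have 2: "integrable \<theta> (\<lambda>z. \<bar>snd z\<bar>)"
    by (rule integral_snd(1))
  show ?thesis
  proof (rule Bochner_Integration.integrable_bound[OF _ m])
    show "integrable \<theta> (\<lambda>z. \<bar>g 0\<bar> + C * (\<bar>quantile \<mu>\<^sub>0 (fst z)\<bar> + \<bar>snd z\<bar>))"
      using 1 2 by simp
    show "AE z in \<theta>. norm (g (quantile \<mu>\<^sub>0 (fst z), snd z)) \<le> norm (\<bar>g 0\<bar> + C * (\<bar>quantile \<mu>\<^sub>0 (fst z)\<bar> +
        \<bar>snd z\<bar>))"
    proof (rule AE_I2)
      fix z
      show "norm (g (quantile \<mu>\<^sub>0 (fst z), snd z)) \<le> norm (\<bar>g 0\<bar> + C * (\<bar>quantile \<mu>\<^sub>0 (fst z)\<bar> + \<bar>snd z\<bar>))"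
        using g[of "(quantile \<mu>\<^sub>0 (fst z), snd z)" 0] by simp
    qed
  qed
qed

lemma integral_step_eq:
  assumes "curtain \<mu> \<nu>" and \<mu>0: "\<mu>\<^sub>0 \<in> finite_moment_probs"
  shows "integrable (curtain.\<theta> \<mu> \<nu>) (\<lambda>z. step k (quantile \<mu>\<^sub>0 (fst z)) (snd z))"
    and "(\<integral>z. step k (quantile \<mu>\<^sub>0 (fst z)) (snd z) \<partial>curtain.\<theta> \<mu> \<nu>) = (\<integral>y. g (grid k 0, y) \<partial>\<nu>) +
      (\<Sum>i<2 * k * k. (\<integral>y. g (grid k (Suc i), y) - g (grid k i, y) \<partial>\<nu>) -
        (\<integral>y. g (grid k (Suc i), y) - g (grid k i, y) \<partial>curtain.\<eta> \<mu> \<nu> (cdf \<mu>\<^sub>0 (grid k i))))"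
proof -
  interpret curtain \<mu> \<nu> by fact
  note i = integral_snd[OF lipschitz_section, of "grid k 0"]
    integral_step[OF \<mu>0 lipschitz_section_diff]
  show "integrable \<theta> (\<lambda>z. step k (quantile \<mu>\<^sub>0 (fst z)) (snd z))"
    unfolding step_def by (intro Bochner_Integration.integrable_add Bochner_Integration.integrable_sum i)
  show "(\<integral>z. step k (quantile \<mu>\<^sub>0 (fst z)) (snd z) \<partial>\<theta>) = (\<integral>y. g (grid k 0, y) \<partial>\<nu>) +
      (\<Sum>i<2 * k * k. (\<integral>y. g (grid k (Suc i), y) - g (grid k i, y) \<partial>\<nu>) -
        (\<integral>y. g (grid k (Suc i), y) - g (grid k i, y) \<partial>\<eta> (cdf \<mu>\<^sub>0 (grid k i))))"
    unfolding step_def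
    by (simp only: Bochner_Integration.integral_add[OF i(1) Bochner_Integration.integrable_sum[OF i(3)]]
        Bochner_Integration.integral_sum[OF i(3)] i(2,4))
qed

lemma step_error:
  assumes "curtain \<mu> \<nu>" and \<mu>0: "\<mu>\<^sub>0 \<in> finite_moment_probs" and "k > 0"
  shows "\<bar>(\<integral>z. g (quantile \<mu>\<^sub>0 (fst z), snd z) \<partial>curtain.\<theta> \<mu> \<nu>) -
    (\<integral>z. step k (quantile \<mu>\<^sub>0 (fst z)) (snd z) \<partial>curtain.\<theta> \<mu> \<nu>)\<bar> \<le> C * (\<integral>q. tail k q \<partial>\<mu>\<^sub>0)"
proof -
  interpret curtain \<mu> \<nu> by fact
  note i = integrable_plan_test[OF assms(1,2)] integral_step_eq(1)[OF assms(1,2), of k]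
  note t = integral_quantile_fst[OF \<mu>0 integrable_tail[OF finite_moment_probsD(1)[OF \<mu>0]], of k]
  have "(\<integral>z. g (quantile \<mu>\<^sub>0 (fst z), snd z) \<partial>\<theta>) - (\<integral>z. step k (quantile \<mu>\<^sub>0 (fst z)) (snd z) \<partial>\<theta>)
      = (\<integral>z. g (quantile \<mu>\<^sub>0 (fst z), snd z) - step k (quantile \<mu>\<^sub>0 (fst z)) (snd z) \<partial>\<theta>)"
    using i by simp
  also have "\<bar>\<dots>\<bar> \<le> (\<integral>z. \<bar>g (quantile \<mu>\<^sub>0 (fst z), snd z) - step k (quantile \<mu>\<^sub>0 (fst z)) (snd z)\<bar> \<partial>\<theta>)"
    using integral_norm_bound[of \<theta> "\<lambda>z. g (quantile \<mu>\<^sub>0 (fst z), snd z) - step k (quantile \<mu>\<^sub>0 (fst z)) (snd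
        z)"] by simp
  also have "\<dots> \<le> (\<integral>z. C * tail k (quantile \<mu>\<^sub>0 (fst z)) \<partial>\<theta>)"
    using i t step_close[OF \<open>k > 0\<close>] by (intro integral_mono) auto
  also have "\<dots> = C * (\<integral>q. tail k q \<partial>\<mu>\<^sub>0)"
    using t by simp
  finally show ?thesis .
qed

text \<open>The quantile function of \<open>\<mu>'\<close> is first exchanged for that of
  \<open>\<mu>\<close> at cost \<open>C * d\<close>. Then both integrands are rounded, with errors
  depending on \<open>\<mu>\<close> only, so that \<open>k\<close> can be chosen before
  \<open>\<mu>'\<close> is known. The rounded integrals are compared by second marginals.\<close>

lemma plan_estimate:
  assumes A: "curtain \<mu> \<nu>" and B: "curtain \<mu>' \<nu>'" and "k > 0"
    and d: "0 \<le> d" "W \<mu> \<mu>' \<le> ennreal d" "W \<nu> \<nu>' \<le> ennreal d"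
  shows "\<bar>(\<integral>z. g z \<partial>Curt \<mu> \<nu>) - (\<integral>z. g z \<partial>Curt \<mu>' \<nu>')\<bar>
    \<le> 2 * C * (\<integral>q. tail k q \<partial>\<mu>) + C * (2 + 16 * real k * real k) * d"
proof -
  interpret A: curtain \<mu> \<nu> by fact
  interpret B: curtain \<mu>' \<nu>' by fact
  have plan: "(\<integral>z. g z \<partial>curtain.plan \<mu> \<nu>) = (\<integral>z. g (quantile \<mu> (fst z), snd z) \<partial>curtain.\<theta> \<mu> \<nu>)" if "curtain
      \<mu> \<nu>" for \<mu> \<nu>
  proof -
    interpret curtain \<mu> \<nu> by fact
    show ?thesis
      unfolding plan_def using measurable_S measurable_g
      by (subst integral_distr) (auto simp: measurable_\<theta> S_def)
  qed
  let ?IA = "\<integral>z. g (quantile \<mu> (fst z), snd z) \<partial>A.\<theta>"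
  let ?IB' = "\<integral>z. g (quantile \<mu>' (fst z), snd z) \<partial>B.\<theta>"
  let ?IB = "\<integral>z. g (quantile \<mu> (fst z), snd z) \<partial>B.\<theta>"
  let ?HA = "\<integral>z. step k (quantile \<mu> (fst z)) (snd z) \<partial>A.\<theta>"
  let ?HB = "\<integral>z. step k (quantile \<mu> (fst z)) (snd z) \<partial>B.\<theta>"
  \<comment> \<open>Under the joint law of the second pair both quantile functions are evaluated at
    the same uniform level, so \<open>quantile_distance\<close> applies.\<close>
  have 1: "\<bar>?IB' - ?IB\<bar> \<le> C * d"
  proof -
    note i = integrable_plan_test[OF B B.\<mu>] integrable_plan_test[OF B A.\<mu>]
    let ?q = "\<lambda>t. \<bar>quantile \<mu> t - quantile \<mu>' t\<bar>"
    have qm: "?q \<in> borel_measurable borel"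
      using measurable_quantile[OF A.\<mu>] measurable_quantile[OF B.\<mu>] by measurable
    have r: "restrict_meas lborel {0<..<1} = density lborel (\<lambda>x. ennreal (indicator {0<..<1::real} x))"
      by (simp add: restrict_meas_def ennreal_indicator)
    have fm: "fst \<in> measurable B.\<theta> borel"
      by (simp add: B.measurable_\<theta>)
    have iq: "integrable B.\<theta> (\<lambda>z. ?q (fst z))"
    proof -
      have "integrable (restrict_meas lborel {0<..<1}) ?q"
        using quantile_distance(1)[OF A.\<mu> B.\<mu>] qm unfolding r set_integrable_def
        by (subst integrable_density) auto
      then show ?thesis
        using integrable_distr_eq[OF fm qm] by (simp add: B.fst_\<theta>)
    qed
    have "?IB' - ?IB = (\<integral>z. g (quantile \<mu>' (fst z), snd z) - g (quantile \<mu> (fst z), snd z) \<partial>B.\<theta>)"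
      using i by simp
    also have "\<bar>\<dots>\<bar> \<le> (\<integral>z. \<bar>g (quantile \<mu>' (fst z), snd z) - g (quantile \<mu> (fst z), snd z)\<bar> \<partial>B.\<theta>)"
      using integral_norm_bound[of B.\<theta> "\<lambda>z. g (quantile \<mu>' (fst z), snd z) - g (quantile \<mu> (fst z), snd z)"]
          by simp
    also have "\<dots> \<le> (\<integral>z. C * ?q (fst z) \<partial>B.\<theta>)"
    proof (rule integral_mono)
      fix z
      show "\<bar>g (quantile \<mu>' (fst z), snd z) - g (quantile \<mu> (fst z), snd z)\<bar> \<le> C * ?q (fst z)"
        using g[of "(quantile \<mu>' (fst z), snd z)" "(quantile \<mu> (fst z), snd z)"] by (simp add:
            abs_minus_commute)
    qed (use i iq in auto)
    also have "\<dots> = C * (\<integral>t. ?q t \<partial>distr B.\<theta> borel fst)"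
      using integral_distr[OF fm qm] by simp
    also have "(\<integral>t. ?q t \<partial>distr B.\<theta> borel fst) = (LINT u:{0<..<1}|lborel. ?q u)"
      unfolding B.fst_\<theta> r set_lebesgue_integral_def using qm by (subst integral_density) auto
    also have "\<dots> \<le> d"
      using order_trans[OF quantile_distance(2)[OF A.\<mu> B.\<mu>] d(2)] d(1) by simp
    finally show ?thesis
      using C by (simp add: mult_left_mono)
  qed
  have 2: "\<bar>?IA - ?HA\<bar> \<le> C * (\<integral>q. tail k q \<partial>\<mu>)" "\<bar>?IB - ?HB\<bar> \<le> C * (\<integral>q. tail k q \<partial>\<mu>)"
    using step_error[OF A A.\<mu> \<open>k > 0\<close>] step_error[OF B A.\<mu> \<open>k > 0\<close>] by auto
  \<comment> \<open>Both rounded integrals use the quantile function of \<open>\<mu>\<close>, so the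
    same levels \<open>cdf \<mu> (grid k i)\<close> occur on both sides.\<close>
  have 3: "\<bar>?HA - ?HB\<bar> \<le> C * d + real (2 * k * k) * (8 * C * d)"
  proof -
    interpret m: cdf_distribution \<mu> using cdf_distributionI[OF A.\<mu>] .
    let ?D = "\<lambda>i y. g (grid k (Suc i), y) - g (grid k i, y)"
    let ?a = "\<lambda>i. (\<integral>y. ?D i y \<partial>\<nu>) - (\<integral>y. ?D i y \<partial>\<nu>')"
    let ?b = "\<lambda>i. (\<integral>y. ?D i y \<partial>A.\<eta> (cdf \<mu> (grid k i))) - (\<integral>y. ?D i y \<partial>B.\<eta> (cdf \<mu> (grid k i)))"
    have W3: "W (A.\<eta> s) (B.\<eta> s) \<le> ennreal (3 * d)" if "0 \<le> s" "s \<le> 1" for s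
    proof -
      have "W (A.\<eta> s) (B.\<eta> s) \<le> W \<mu> \<mu>' + 2 * W \<nu> \<nu>'"
        by (rule W_curtain_shadow_le[OF A B that])
      also have "\<dots> \<le> ennreal d + 2 * ennreal d"
        using d by (intro add_mono mult_left_mono) auto
      also have "2 * ennreal d = ennreal (2 * d)"
        using d(1) by (simp add: ennreal_mult)
      also have "ennreal d + ennreal (2 * d) = ennreal (3 * d)"
        using d(1) by (subst ennreal_plus[symmetric]) auto
      finally show ?thesis .
    qed
    let ?c = "(\<integral>y. g (grid k 0, y) \<partial>\<nu>) - (\<integral>y. g (grid k 0, y) \<partial>\<nu>')"
    have "?HA - ?HB = ((\<integral>y. g (grid k 0, y) \<partial>\<nu>) - (\<integral>y. g (grid k 0, y) \<partial>\<nu>')) + (\<Sum>i<2 * k * k. ?a i - ?b i)"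
      unfolding integral_step_eq(2)[OF A A.\<mu>] integral_step_eq(2)[OF B A.\<mu>]
      by (simp add: sum_subtractf)
    then have "\<bar>?HA - ?HB\<bar> = \<bar>?c + (\<Sum>i<2 * k * k. ?a i - ?b i)\<bar>"
      by (rule arg_cong)
    also have "\<dots> \<le> \<bar>?c\<bar> + (\<Sum>i<2 * k * k. \<bar>?a i - ?b i\<bar>)"
      by (rule order_trans[OF abs_triangle_ineq add_left_mono[OF sum_abs]])
    also have "\<dots> \<le> C * d + (\<Sum>i<2 * k * k. 8 * C * d)"
    proof (intro add_mono sum_mono)
      show "\<bar>?c\<bar> \<le> C * d"
        by (rule lipschitz_integral_diff_le[OF lipschitz_section d(3,1) C])
      fix i
      have "\<bar>?a i\<bar> \<le> 2 * C * d"
        using C by (intro lipschitz_integral_diff_le[OF lipschitz_section_diff d(3,1)]) simp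
      moreover have "\<bar>?b i\<bar> \<le> 2 * C * (3 * d)"
        using C d(1) m.cdf_nonneg m.cdf_bounded_prob
        by (intro lipschitz_integral_diff_le[OF lipschitz_section_diff W3]) auto
      \<comment> \<open>The constant 8 is 2 + 6: sections differ by a \<open>2 * C\<close>-Lipschitz
        function, \<open>\<nu>\<close> moves by \<open>d\<close> and the shadows by
        \<open>3 * d\<close>.\<close>
      ultimately show "\<bar>?a i - ?b i\<bar> \<le> 8 * C * d"
        by linarith
    qed
    finally show ?thesis by simp
  qed
  have "\<bar>?IA - ?IB'\<bar> \<le> 2 * (C * (\<integral>q. tail k q \<partial>\<mu>)) + (C * d + (C * d + real (2 * k * k) * (8 * C * d)))"
    using 1 2 3 by linarith
  also have "\<dots> = 2 * C * (\<integral>q. tail k q \<partial>\<mu>) + C * (2 + 16 * real k * real k) * d"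
    by (simp add: algebra_simps)
  finally show ?thesis
    by (simp add: A.Curt_eq B.Curt_eq plan[OF A] plan[OF B])
qed

end

section \<open>Passage to the topology of the plane\<close>

text \<open>The rounding \<open>k\<close> is fixed first, from the tail of \<open>\<mu>\<close>;
  only then is \<open>d\<close> chosen, small against the number of cells. Each contributes at most
  half of \<open>e\<close>.\<close>

lemma W_plane_Curt_small:
  assumes A: "(\<mu>, \<nu>) \<in> convex_ordered_pairs" and C: "0 < C"
    and N: "\<And>z. N z \<le> C * (\<bar>fst z\<bar> + \<bar>snd z\<bar>)" and "0 < e"
  shows "\<exists>d>0. \<forall>(\<mu>', \<nu>')\<in>convex_ordered_pairs. W \<mu> \<mu>' \<le> ennreal d \<longrightarrow> W \<nu> \<nu>' \<le> ennreal d \<longrightarrow>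
    W_plane N (Curt \<mu> \<nu>) (Curt \<mu>' \<nu>') \<le> ennreal e"
proof -
  interpret A: curtain \<mu> \<nu> using A by unfold_locales
  have "\<forall>\<^sub>F k in sequentially. (\<integral>q. tail k q \<partial>\<mu>) < e / (4 * C)"
    using tail_tendsto[OF A.\<mu>_moment] C \<open>0 < e\<close> by (intro order_tendstoD) auto
  then obtain k0 where "\<And>k. k0 \<le> k \<Longrightarrow> (\<integral>q. tail k q \<partial>\<mu>) < e / (4 * C)"
    unfolding eventually_sequentially by blast
  then obtain k :: nat where k: "k > 0" "(\<integral>q. tail k q \<partial>\<mu>) < e / (4 * C)"
    using that[of "max k0 1"] by auto
  define d where "d = e / (2 * (C * (2 + 16 * real k * real k)))"
  have pos: "0 < C * (2 + 16 * real k * real k)"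
    using C by (intro mult_pos_pos add_pos_nonneg) auto
  have d: "0 < d"
    using pos \<open>0 < e\<close> by (simp add: d_def)
  have "W_plane N (Curt \<mu> \<nu>) (Curt \<mu>' \<nu>') \<le> ennreal e"
    if B: "(\<mu>', \<nu>') \<in> convex_ordered_pairs" "W \<mu> \<mu>' \<le> ennreal d" "W \<nu> \<nu>' \<le> ennreal d" for \<mu>' \<nu>'
    unfolding W_plane_def
  proof (rule SUP_least)
    fix g :: "real \<times> real \<Rightarrow> real" assume "g \<in> {f. \<forall>x y. \<bar>f x - f y\<bar> \<le> N (x - y)}"
    then have "\<bar>g z - g z'\<bar> \<le> N (z - z')" for z z'
      unfolding mem_Collect_eq by blast
    from order_trans[OF this N] interpret test_function g C
      using C by unfold_locales auto
    interpret B: curtain \<mu>' \<nu>' using B(1) by unfold_locales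
    have "\<bar>(\<integral>z. g z \<partial>Curt \<mu> \<nu>) - (\<integral>z. g z \<partial>Curt \<mu>' \<nu>')\<bar>
        \<le> 2 * C * (\<integral>q. tail k q \<partial>\<mu>) + C * (2 + 16 * real k * real k) * d"
      using d B by (intro plan_estimate[OF A.curtain_axioms B.curtain_axioms k(1)]) auto
    also have "C * (2 + 16 * real k * real k) * d = e / 2"
    proof -
      have "x * (e / (2 * x)) = e / 2" if "0 < x" for x :: real
        using that by simp
      from this[OF pos] show ?thesis
        unfolding d_def .
    qed
    also have "2 * C * (\<integral>q. tail k q \<partial>\<mu>) + e / 2 \<le> e"
      using k(2) C by (simp add: field_simps)
    finally show "ennreal \<bar>(\<integral>z. g z \<partial>Curt \<mu> \<nu>) - (\<integral>z. g z \<partial>Curt \<mu>' \<nu>')\<bar> \<le> ennreal e"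
      by (rule ennreal_leI)
  qed
  with d show ?thesis by blast
qed

lemma continuous_map_Curt:
  assumes "is_norm N"
  shows "continuous_map (subtopology (prod_topology T1_line T1_line) convex_ordered_pairs)
    (subtopology (T1_plane N) all_martingale_plans) (\<lambda>(\<mu>, \<nu>). Curt \<mu> \<nu>)"
proof -
  obtain c C' where "norm_like N c C'" and bound: "0 < C'" "\<And>z. N z \<le> C' * (\<bar>fst z\<bar> + \<bar>snd z\<bar>)"
    using is_norm_bounds[OF assms] by blast
  then interpret norm_like N c C' by simp
  interpret L: Metric_space finite_moment_probs "\<lambda>\<mu> \<nu>. enn2real (W \<mu> \<nu>)"
    using abs.Metric_space_kantorovich by (simp add: W_eq_kantorovich)
  interpret P: Metric_space finite_moment_probs "\<lambda>\<pi> \<pi>'. enn2real (W_plane N \<pi> \<pi>')"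
    using Metric_space_kantorovich by (simp add: W_plane_eq_kantorovich)
  let ?X = "subtopology (prod_topology L.mtopology L.mtopology) convex_ordered_pairs"
  have cur: "Curt \<mu> \<nu> \<in> finite_moment_probs" "Curt \<mu> \<nu> \<in> all_martingale_plans"
    if "(\<mu>, \<nu>) \<in> convex_ordered_pairs" for \<mu> \<nu>
  proof -
    interpret curtain \<mu> \<nu> using that by unfold_locales
    show "Curt \<mu> \<nu> \<in> finite_moment_probs" "Curt \<mu> \<nu> \<in> all_martingale_plans"
      using plan_moment plan_martingale \<mu> \<nu> by (auto simp: Curt_eq all_martingale_plans_def)
  qed
  have "continuous_map ?X P.mtopology (\<lambda>(\<mu>, \<nu>). Curt \<mu> \<nu>)"
    unfolding P.continuous_map_to_metric
  proof (intro ballI allI impI)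
    fix x and e :: real assume x: "x \<in> topspace ?X" and e: "0 < e"
    obtain \<mu> \<nu> where x_eq: "x = (\<mu>, \<nu>)" by (cases x)
    have D: "(\<mu>, \<nu>) \<in> convex_ordered_pairs" and m: "\<mu> \<in> finite_moment_probs" "\<nu> \<in> finite_moment_probs"
      using x by (auto simp: x_eq)
    obtain d where d: "d > 0" and small: "\<And>\<mu>' \<nu>'. (\<mu>', \<nu>') \<in> convex_ordered_pairs \<Longrightarrow>
        W \<mu> \<mu>' \<le> ennreal d \<Longrightarrow> W \<nu> \<nu>' \<le> ennreal d \<Longrightarrow> W_plane N (Curt \<mu> \<nu>) (Curt \<mu>' \<nu>') \<le> ennreal (e / 2)"
      using W_plane_Curt_small[OF D bound half_gt_zero[OF e]] by blast
    let ?U = "(L.mball \<mu> d \<times> L.mball \<nu> d) \<inter> convex_ordered_pairs"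
    have le: "W M M' \<le> ennreal d" if "M' \<in> L.mball M d" for M M'
    proof -
      have "M \<in> finite_moment_probs" "M' \<in> finite_moment_probs" and *: "enn2real (W M M') < d"
        using that by auto
      then have "W M M' < \<top>"
        using abs.kantorovich_finite by (simp add: W_eq_kantorovich)
      then have "W M M' = ennreal (enn2real (W M M'))"
        by simp
      with * show ?thesis
        by (metis ennreal_leI less_imp_le)
    qed
    show "\<exists>U. openin ?X U \<and> x \<in> U \<and> (\<forall>y\<in>U. (case y of (\<mu>, \<nu>) \<Rightarrow> Curt \<mu> \<nu>) \<in> P.mball (case x of (\<mu>, \<nu>) \<Rightarrow> Curt
        \<mu> \<nu>) e)"
    proof (intro exI[of _ ?U] conjI ballI)
      show "openin ?X ?U"
        by (intro openin_subtopology_Int) (simp add: openin_prod_Times_iff)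
      show "x \<in> ?U"
        using D m d by (simp add: x_eq)
      fix y assume y: "y \<in> ?U"
      obtain \<mu>' \<nu>' where y_eq: "y = (\<mu>', \<nu>')" by (cases y)
      have D': "(\<mu>', \<nu>') \<in> convex_ordered_pairs"
        using y by (simp add: y_eq)
      \<comment> \<open>The bound \<open>e / 2\<close> is not strict; halving yields the strict
        inequality that membership in the ball requires.\<close>
      have "W_plane N (Curt \<mu> \<nu>) (Curt \<mu>' \<nu>') \<le> ennreal (e / 2)"
        using y by (intro small D' le) (auto simp: y_eq)
      then have "enn2real (W_plane N (Curt \<mu> \<nu>) (Curt \<mu>' \<nu>')) \<le> e / 2"
        using e by (intro enn2real_leI) auto
      then show "(case y of (\<mu>, \<nu>) \<Rightarrow> Curt \<mu> \<nu>) \<in> P.mball (case x of (\<mu>, \<nu>) \<Rightarrow> Curt \<mu> \<nu>) e"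
        using e cur(1)[OF D] cur(1)[OF D'] by (simp add: x_eq y_eq)
    qed
  qed
  then have "continuous_map ?X (subtopology P.mtopology all_martingale_plans) (\<lambda>(\<mu>, \<nu>). Curt \<mu> \<nu>)"
    by (rule continuous_map_into_subtopology) (auto simp: cur(2))
  then show ?thesis
    by (simp add: T1_line_def T1_plane_def)
qed

theorem corollary2p31:
  shows "(\<forall>N. is_norm N \<longrightarrow>
            continuous_map
              (subtopology (prod_topology T1_line T1_line) convex_ordered_pairs)
              (subtopology (T1_plane N) all_martingale_plans)
              (\<lambda>(\<mu>, \<nu>). Curt \<mu> \<nu>)) \<and>
         (\<forall>(\<mu>, \<nu>)\<in>convex_ordered_pairs. \<forall>(\<mu>', \<nu>')\<in>convex_ordered_pairs.
            Z (Curt \<mu> \<nu>) (Curt \<mu>' \<nu>') \<le> W \<mu> \<mu>' + 2 * W \<nu> \<nu>')"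
  using continuous_map_Curt Z_Curt_le by blast

end
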